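(* Let $h\ge 1$ be an integer and let $0\to F_1\to W\to F_2\to 0$ be a nontrivial extension of vector bundles over $X$, with class $\delta(W)\in H^1(X,\mathrm{Hom}(F_2,F_1))$. Then the point $\langle\delta(W)\rangle\in\mathbb{P}H^1(X,\mathrm{Hom}(F_2,F_1))^*$ belongs to the linear span of at most $h$ independent points of $\Delta|_D$ (mapped to $\mathbb{P}H^1(X,\mathrm{Hom}(F_2,F_1))^*$ by $\psi$) if and only if $W$ has a subbundle lifting from an elementary transformation $\mathcal{G}$ of $F_2$ of the form $$0\to\mathcal{G}\to\mathcal{F}_2\to\tau\to 0,$$ where $\tau\subset\underline{\mathrm{Prin}}(F_1)$ is a skyscraper sheaf of length at most $h$, supported on $D$ and with at most simple poles.
   Context: Let $X$ be a smooth projective geometrically irreducible curve over the finite field $\mathbb{F}_q$, and let $D=x_1+\cdots+x_s$ be a sum of distinct $\mathbb{F}_q$-rational points of $X$. All bundles, maps and points considered are defined over $\mathbb{F}_q$. The sheaf of sections of a vector bundle $F$ is denoted by the script letter $\mathcal{F}$. Projectivization: for a vector space $V$, $\mathbb{P}V$ is the space of codimension one subspaces of $V$, so $\mathbb{P}V^*$ is the space of lines in $V$; for $0\ne v\in V$, $\langle v\rangle$ denotes the point of $\mathbb{P}V^*$ defined by $v$. The same convention is used fiberwise for vector bundles. Principal parts: for a vector bundle $E\to X$ there is a short exact sequence of $\mathcal{O}_X$-modules $0\to\mathcal{E}\to\underline{\mathrm{Rat}}(E)\to\underline{\mathrm{Prin}}(E)\to 0$, where $\underline{\mathrm{Rat}}(E)$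 is the sheaf of rational sections of $E$ and $\underline{\mathrm{Prin}}(E)$ is the sheaf of $E$-valued principal parts. Taking global sections gives $0\to H^0(X,E)\to\mathrm{Rat}(E)\to\mathrm{Prin}(E)\to H^1(X,E)\to 0$; the class in $H^1(X,E)$ of $p\in\mathrm{Prin}(E)$ is denoted $[p]$. A subsheaf of $\underline{\mathrm{Prin}}(F_1)$ is supported on $D$ with at most simple poles if it is contained in $\mathcal{F}_1(D)/\mathcal{F}_1\subset\underline{\mathrm{Prin}}(F_1)$. Decomposable locus: $\Delta\subset\mathbb{P}\mathrm{Hom}(F_2,F_1)^*$ is the locus, over $X$, of points $\langle\phi\rangle$ with $\phi\in\mathrm{Hom}(F_2,F_1)|_x$ a homomorphism of rank one, and $\Delta|_D$ is its restriction to the fibers over $x_1,\ldots,x_s$. The map $\psi$: for a vector bundle $V\to X$, $\psi:\mathbb{P}V^*\dashrightarrow\mathbb{P}H^1(X,V)^*$ is the (rational) map which on the fiber over $x$ is the projectivization of the coboundary map $V(x)|_x\to H^1(X,V)$ of $0\to\mathcal{V}\to\mathcal{V}(x)\to\mathcal{V}(x)/\mathcal{V}\to 0$, using the canonical isomorphism $\mathbb{P}(V^*(-x))|_x\cong\mathbb{P}V^*|_x$. That is, $\psi$ sends $\langle v\rangle\in\mathbb{P}V^*|_x$ to the projectivized class of a $V$-valued principal part supported at $x$ with a simple pole in the direction $v$. It is applied here with $V=\mathrm{Hom}(F_2,F_1)$. Elementary transformations: an elementary transformation of $F_2$ is a vector bundle defined by a locally free subsheaf $\mathcal{G}\subset\mathcal{F}_2$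 of rank equal to the rank of $F_2$. It lifts to a subbundle of $W$ if the inclusion $\mathcal{G}\hookrightarrow\mathcal{F}_2$ factors through $\mathcal{W}\to\mathcal{F}_2$ in such a way that $\mathcal{G}$ is the sheaf of sections of a vector subbundle of $W$ (i.e. the quotient of $\mathcal{W}$ by $\mathcal{G}$ is locally free). *)

theory Defs
  imports
    "HOL-Algebra.Finite_Extensions"
    "HOL-Algebra.Generated_Fields"
    "HOL-Library.Function_Algebras"
    "HOL-Library.Set_Algebras"
    "HOL-Library.Extended_Nat"
begin

section \<open>Modules presented as quotients\<close>

definition ring_on :: "'k::field set \<Rightarrow> 'k ring" where
  "ring_on S = \<lparr>carrier = S, monoid.mult = (*), one = 1, zero = 0, add = (+)\<rparr>"

text \<open>The quotient module of \<open>M\<close> by a submodule \<open>N\<close>, with scalar action induced by \<open>s\<close>. Its elements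
  are the cosets \<open>v + N\<close>. The multiplicative slots of the record play no role for a module.\<close>

definition quot :: "('k \<Rightarrow> 'v \<Rightarrow> 'v) \<Rightarrow> 'v::ab_group_add set \<Rightarrow> 'v set \<Rightarrow> ('k, 'v set) module" where
  "quot s M N = \<lparr>carrier = (\<lambda>v. v +o N) ` M, monoid.mult = (\<lambda>_ _. undefined), one = undefined,
     zero = N, add = (\<lambda>A B. A + B), smult = (\<lambda>a A. s a ` A + N)\<rparr>"

definition proj_point :: "('k, 'r) ring_scheme \<Rightarrow> ('k, 'm, 'z) module_scheme \<Rightarrow> 'm \<Rightarrow> 'm set" where
  "proj_point R M v = {a \<odot>\<^bsub>M\<^esub> v | a. a \<in> carrier R}"

definition mod_span :: "('k, 'r) ring_scheme \<Rightarrow> ('k, 'm, 'z) module_scheme \<Rightarrow> 'm set \<Rightarrow> 'm set" where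
  "mod_span R M S = (\<lambda>H. submodule H R M) hull S"

text \<open>Points of projective space are lines of the underlying vector space, and the linear span of a
  set of points corresponds to the linear span of the union of these lines.\<close>

definition independent_points :: "('k, 'r) ring_scheme \<Rightarrow> ('k, 'm, 'z) module_scheme \<Rightarrow> 'm set set \<Rightarrow> bool" where
  "independent_points R M S \<longleftrightarrow> (\<forall>P\<in>S. \<not> P \<subseteq> mod_span R M (\<Union>(S - {P})))"

definition mod_length :: "('k, 'r) ring_scheme \<Rightarrow> ('k, 'm, 'z) module_scheme \<Rightarrow> 'm set \<Rightarrow> enat" where
  "mod_length R M H = Sup {enat n | n. \<exists>C :: nat \<Rightarrow> 'm set.
     (\<forall>i\<le>n. submodule (C i) R M \<and> C i \<subseteq> H) \<and> (\<forall>i<n. C i \<subset> C (Suc i))}"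


section \<open>The curve\<close>

text \<open>
  A smooth projective geometrically irreducible curve \<open>X\<close> over a finite field \<open>k\<close> is given by its
  function field, the whole type \<open>'k\<close>: a finitely generated extension of \<open>k\<close> of transcendence degree one
  in which \<open>k\<close> is algebraically closed. The last condition is geometric irreducibility, and
  smooth is the same as regular because \<open>k\<close> is perfect.
  The closed points of \<open>X\<close> are the discrete valuation rings of \<open>'k\<close> over \<open>k\<close> (Hartshorne, I.6); each
  point is identified with its local ring. The proper closed sets are the finite ones; the generic point
  is omitted.\<close>

definition curve :: "'k::field set \<Rightarrow> bool" where
  "curve k \<longleftrightarrow> subfield k (ring_on UNIV) \<and> finite k \<and>
     (\<exists>t::'k. ring.transcendental (ring_on UNIV) k t \<and>
        ring.finite_dimension (ring_on UNIV) (generate_field (ring_on UNIV) (insert t k)) UNIV) \<and>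
     (\<forall>f::'k. ring.algebraic (ring_on UNIV) k f \<longrightarrow> f \<in> k)"

definition dvr :: "'k::field set \<Rightarrow> bool" where
  "dvr R \<longleftrightarrow> subring R (ring_on UNIV) \<and>
     (\<exists>t\<in>R. t \<noteq> 0 \<and> inverse t \<notin> R \<and>
       (\<forall>f. f \<noteq> 0 \<longrightarrow> (\<exists>u n. u \<in> R \<and> u \<noteq> 0 \<and> inverse u \<in> R \<and> f = u * t powi n)))"

definition points :: "'k::field set \<Rightarrow> 'k set set" where
  "points k = {R. k \<subseteq> R \<and> dvr R}"

definition max_ideal :: "'k::field set \<Rightarrow> 'k set" where
  "max_ideal R = {f\<in>R. f = 0 \<or> inverse f \<notin> R}"

definition zopen :: "'k::field set \<Rightarrow> 'k set set \<Rightarrow> bool" where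
  "zopen k U \<longleftrightarrow> U \<subseteq> points k \<and> (U = {} \<or> finite (points k - U))"

definition rational_point :: "'k::field set \<Rightarrow> 'k set \<Rightarrow> bool" where
  "rational_point k x \<longleftrightarrow> x \<in> points k \<and> (\<forall>f\<in>x. \<exists>c\<in>k. f - c \<in> max_ideal x)"


section \<open>Vector bundles\<close>

text \<open>
  A locally free sheaf \<open>E\<close> embeds in the constant sheaf of its rational sections. It is recorded by the
  vector space \<open>gen E\<close> = Rat(E) over the function field and the stalks \<open>stalk E x\<close> inside it; the sections
  over \<open>U\<close> are the intersection of the stalks at the points of \<open>U\<close>.\<close>

record ('k, 'v) vbundle =
  scal :: "'k \<Rightarrow> 'v \<Rightarrow> 'v"
  gen :: "'v set"
  stalk :: "'k set \<Rightarrow> 'v set"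

text \<open>The classes of the elements of \<open>B\<close> form a basis of the \<open>R\<close>-module \<open>M / N\<close>.\<close>

definition quot_basis :: "'k::field set \<Rightarrow> ('k \<Rightarrow> 'v \<Rightarrow> 'v) \<Rightarrow> 'v::ab_group_add set \<Rightarrow> 'v set \<Rightarrow> 'v set \<Rightarrow> bool" where
  "quot_basis R s M N B \<longleftrightarrow> finite B \<and>
     M = {(\<Sum>b\<in>B. s (c b) b) + n | c n. (\<forall>b\<in>B. c b \<in> R) \<and> n \<in> N} \<and>
     (\<forall>c. (\<forall>b\<in>B. c b \<in> R) \<and> (\<Sum>b\<in>B. s (c b) b) \<in> N \<longrightarrow> (\<forall>b\<in>B. c b = 0))"

text \<open>The quotient sheaf with stalks \<open>M x / N x\<close> is locally free. The basis of local sections of the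
  quotient is asked to lift to \<open>M\<close>, which can be achieved by shrinking \<open>U\<close>.\<close>

definition locally_free :: "'k::field set \<Rightarrow> ('k \<Rightarrow> 'v \<Rightarrow> 'v) \<Rightarrow> ('k set \<Rightarrow> 'v::ab_group_add set) \<Rightarrow> ('k set \<Rightarrow> 'v set) \<Rightarrow> bool" where
  "locally_free k s M N \<longleftrightarrow> (\<forall>x\<in>points k. \<exists>U B. zopen k U \<and> x \<in> U \<and>
     B \<subseteq> (\<Inter>y\<in>U. M y) \<and> (\<forall>y\<in>U. quot_basis y s (M y) (N y) B))"

definition vector_bundle :: "'k::field set \<Rightarrow> ('k, 'v::ab_group_add) vbundle \<Rightarrow> bool" where
  "vector_bundle k E \<longleftrightarrow> vector_space (scal E) \<and>
     (\<exists>B. finite B \<and> gen E = Modules.module.span (scal E) B) \<and>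
     (\<forall>x\<in>points k. gen E = Modules.module.span (scal E) (stalk E x)) \<and>
     locally_free k (scal E) (stalk E) (\<lambda>_. {0})"

definition rank :: "('k::field, 'v::ab_group_add) vbundle \<Rightarrow> nat" where
  "rank E = vector_space.dim (scal E) (gen E)"

text \<open>A homomorphism of bundles is determined by the linear map it induces on rational sections.\<close>

definition gen_linear :: "('k::field, 'v::ab_group_add) vbundle \<Rightarrow> ('k, 'w::ab_group_add) vbundle \<Rightarrow> ('v \<Rightarrow> 'w) \<Rightarrow> bool" where
  "gen_linear E F f \<longleftrightarrow> (\<forall>v\<in>gen E. f v \<in> gen F) \<and>
     (\<forall>v\<in>gen E. \<forall>w\<in>gen E. f (v + w) = f v + f w) \<and>
     (\<forall>a. \<forall>v\<in>gen E. f (scal E a v) = scal F a (f v))"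

definition bundle_map :: "'k::field set \<Rightarrow> ('k, 'v::ab_group_add) vbundle \<Rightarrow> ('k, 'w::ab_group_add) vbundle \<Rightarrow> ('v \<Rightarrow> 'w) \<Rightarrow> bool" where
  "bundle_map k E F f \<longleftrightarrow> gen_linear E F f \<and> (\<forall>x\<in>points k. f ` stalk E x \<subseteq> stalk F x)"

text \<open>Linear maps are normalised to vanish outside \<open>gen E\<close>, so that equal maps are equal functions.\<close>

definition hom_bundle :: "('k::field, 'v::ab_group_add) vbundle \<Rightarrow> ('k, 'w::ab_group_add) vbundle \<Rightarrow> ('k, 'v \<Rightarrow> 'w) vbundle" where
  "hom_bundle E F = \<lparr>scal = (\<lambda>a f v. scal F a (f v)),
     gen = {f. gen_linear E F f \<and> (\<forall>v. v \<notin> gen E \<longrightarrow> f v = 0)},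
     stalk = (\<lambda>x. {f. gen_linear E F f \<and> (\<forall>v. v \<notin> gen E \<longrightarrow> f v = 0) \<and> f ` stalk E x \<subseteq> stalk F x})\<rparr>"

text \<open>\<open>E(D)\<close> for the reduced divisor with support \<open>D\<close>.\<close>

definition twist :: "('k::field, 'v::ab_group_add) vbundle \<Rightarrow> 'k set set \<Rightarrow> ('k, 'v) vbundle" where
  "twist E D = E\<lparr>stalk := (\<lambda>x. if x \<in> D then {v\<in>gen E. \<forall>a\<in>max_ideal x. scal E a v \<in> stalk E x}
                                else stalk E x)\<rparr>"

text \<open>No sums are needed in \<open>max_stalk\<close>, since the maximal ideal is principal.\<close>

definition max_stalk :: "('k::field, 'v::ab_group_add) vbundle \<Rightarrow> 'k set \<Rightarrow> 'v set" where
  "max_stalk E x = {scal E a v | a v. a \<in> max_ideal x \<and> v \<in> stalk E x}"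

text \<open>The fibre at \<open>x\<close>; the residue field acts through the local ring \<open>x\<close>.\<close>

definition fibre :: "('k::field, 'v::ab_group_add) vbundle \<Rightarrow> 'k set \<Rightarrow> ('k, 'v set) module" where
  "fibre E x = quot (scal E) (stalk E x) (max_stalk E x)"


section \<open>Principal parts and first cohomology\<close>

definition prin_stalk :: "('k::field, 'v::ab_group_add) vbundle \<Rightarrow> 'k set \<Rightarrow> ('k, 'v set) module" where
  "prin_stalk E x = quot (scal E) (gen E) (stalk E x)"

text \<open>Global sections of the quotient sheaf Rat(E)/E: a principal part is represented by a family of
  rational sections, one for each point, which locally agrees modulo \<open>E\<close> with a single rational
  section. Two families represent the same principal part if they differ by an element of
  \<open>stalk E x\<close> at each \<open>x\<close>.\<close>

definition prin_reps :: "'k::field set \<Rightarrow> ('k, 'v::ab_group_add) vbundle \<Rightarrow> ('k set \<Rightarrow> 'v) set" where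
  "prin_reps k E = {r. (\<forall>x\<in>points k. r x \<in> gen E) \<and> (\<forall>x. x \<notin> points k \<longrightarrow> r x = 0) \<and>
     (\<forall>x\<in>points k. \<exists>U. \<exists>v\<in>gen E. zopen k U \<and> x \<in> U \<and> (\<forall>y\<in>U. r y - v \<in> stalk E y))}"

text \<open>The families representing the principal part of a global rational section.\<close>

definition rational_reps :: "'k::field set \<Rightarrow> ('k, 'v::ab_group_add) vbundle \<Rightarrow> ('k set \<Rightarrow> 'v) set" where
  "rational_reps k E = {r\<in>prin_reps k E. \<exists>v\<in>gen E. \<forall>x\<in>points k. r x - v \<in> stalk E x}"

text \<open>\<open>H1 k E\<close> is the cokernel of Rat(E) \<open>\<rightarrow>\<close> Prin(E), as a \<open>k\<close>-vector space.\<close>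

definition H1 :: "'k::field set \<Rightarrow> ('k, 'v::ab_group_add) vbundle \<Rightarrow> ('k, ('k set \<Rightarrow> 'v) set) module" where
  "H1 k E = quot (\<lambda>a r x. scal E a (r x)) (prin_reps k E) (rational_reps k E)"

definition pole_part :: "'k set \<Rightarrow> 'v::ab_group_add \<Rightarrow> 'k set \<Rightarrow> 'v" where
  "pole_part x w = (\<lambda>y. if y = x then w else 0)"

text \<open>A point of the projective bundle of \<open>V\<close> is a pair of a point \<open>x\<close> and a line \<open>L\<close> in the fibre
  \<open>V|\<^sub>x\<close>. The products \<open>a v\<close> with \<open>a\<close> in the inverse of the maximal ideal of \<open>x\<close> and \<open>v\<close> representing
  an element of \<open>L\<close> are the representatives of the line in \<open>V(x)|\<^sub>x\<close> corresponding to \<open>L\<close>; \<open>psi\<close> is the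
  image of this line under the coboundary map. The rational map is defined at \<open>(x, L)\<close> if this image
  is not the zero subspace.\<close>

definition psi :: "'k::field set \<Rightarrow> ('k, 'v::ab_group_add) vbundle \<Rightarrow> 'k set \<times> 'v set set \<Rightarrow> ('k set \<Rightarrow> 'v) set set" where
  "psi k V P = (case P of (x, L) \<Rightarrow>
     {pole_part x (scal V a v) +o rational_reps k V | a v.
        (\<forall>b\<in>max_ideal x. a * b \<in> x) \<and> v \<in> \<Union>L})"

definition psi_defined :: "'k::field set \<Rightarrow> ('k, 'v::ab_group_add) vbundle \<Rightarrow> 'k set \<times> 'v set set \<Rightarrow> bool" where
  "psi_defined k V P \<longleftrightarrow> psi k V P \<noteq> {\<zero>\<^bsub>H1 k V\<^esub>}"


section \<open>The decomposable locus\<close>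

text \<open>The homomorphism of fibres at \<open>x\<close> induced by \<open>f\<close> has rank one: its image is a line.\<close>

definition fibre_rank_one :: "('k::field, 'v::ab_group_add) vbundle \<Rightarrow> ('k, 'w::ab_group_add) vbundle \<Rightarrow> 'k set \<Rightarrow> ('v \<Rightarrow> 'w) \<Rightarrow> bool" where
  "fibre_rank_one E F x f \<longleftrightarrow> (\<exists>w \<in> carrier (fibre F x) - {\<zero>\<^bsub>fibre F x\<^esub>}.
     (\<lambda>v. f v +o max_stalk F x) ` stalk E x = proj_point (ring_on x) (fibre F x) w)"

definition Delta_on :: "('k::field, 'v::ab_group_add) vbundle \<Rightarrow> ('k, 'w::ab_group_add) vbundle \<Rightarrow> 'k set set
    \<Rightarrow> ('k set \<times> ('v \<Rightarrow> 'w) set set) set" where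
  "Delta_on E F D = {(x, proj_point (ring_on x) (fibre (hom_bundle E F) x) (f +o max_stalk (hom_bundle E F) x)) | x f.
     x \<in> D \<and> f \<in> stalk (hom_bundle E F) x \<and> fibre_rank_one E F x f}"


section \<open>Extensions and elementary transformations\<close>

definition extension :: "'k::field set \<Rightarrow> ('k, 'a::ab_group_add) vbundle \<Rightarrow> ('k, 'w::ab_group_add) vbundle \<Rightarrow>
    ('k, 'b::ab_group_add) vbundle \<Rightarrow> ('a \<Rightarrow> 'w) \<Rightarrow> ('w \<Rightarrow> 'b) \<Rightarrow> bool" where
  "extension k F1 W F2 \<iota> \<pi> \<longleftrightarrow> vector_bundle k F1 \<and> vector_bundle k W \<and> vector_bundle k F2 \<and>
     bundle_map k F1 W \<iota> \<and> bundle_map k W F2 \<pi> \<and>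
     (\<forall>x\<in>points k. inj_on \<iota> (stalk F1 x) \<and> \<iota> ` stalk F1 x = {w\<in>stalk W x. \<pi> w = 0} \<and>
        \<pi> ` stalk W x = stalk F2 x)"

definition split_extension :: "'k::field set \<Rightarrow> ('k, 'w::ab_group_add) vbundle \<Rightarrow>
    ('k, 'b::ab_group_add) vbundle \<Rightarrow> ('w \<Rightarrow> 'b) \<Rightarrow> bool" where
  "split_extension k W F2 \<pi> \<longleftrightarrow> (\<exists>\<sigma>. bundle_map k F2 W \<sigma> \<and> (\<forall>v\<in>gen F2. \<pi> (\<sigma> v) = v))"

text \<open>The image of the identity of \<open>F2\<close> under the connecting map from H\<open>\<^sup>0\<close>(Hom(F2, F2)) to
  H\<open>\<^sup>1\<close>(Hom(F2, F1)): lift the identity to a rational section \<open>s\<close> of Hom(F2, W); its principal part comes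
  from a principal part \<open>p\<close> of Hom(F2, F1). All the families \<open>p\<close> so obtained make up one coset, i.e. one
  element of \<open>H1 k (hom_bundle F2 F1)\<close>.\<close>

definition ext_class :: "'k::field set \<Rightarrow> ('k, 'a::ab_group_add) vbundle \<Rightarrow> ('k, 'w::ab_group_add) vbundle \<Rightarrow>
    ('k, 'b::ab_group_add) vbundle \<Rightarrow> ('a \<Rightarrow> 'w) \<Rightarrow> ('w \<Rightarrow> 'b) \<Rightarrow> ('k set \<Rightarrow> 'b \<Rightarrow> 'a) set" where
  "ext_class k F1 W F2 \<iota> \<pi> = {p\<in>prin_reps k (hom_bundle F2 F1).
     \<exists>s\<in>gen (hom_bundle F2 W). (\<forall>v\<in>gen F2. \<pi> (s v) = v) \<and>
       (\<forall>x\<in>points k. (\<lambda>v. s v - \<iota> (p x v)) \<in> stalk (hom_bundle F2 W) x)}"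

definition elementary_transformation :: "'k::field set \<Rightarrow> ('k, 'b::ab_group_add) vbundle \<Rightarrow> ('k, 'b) vbundle \<Rightarrow> bool" where
  "elementary_transformation k F2 G \<longleftrightarrow> vector_bundle k G \<and> scal G = scal F2 \<and>
     (\<forall>x\<in>points k. stalk G x \<subseteq> stalk F2 x) \<and> rank G = rank F2"

definition lifts_to_subbundle :: "'k::field set \<Rightarrow> ('k, 'w::ab_group_add) vbundle \<Rightarrow> ('w \<Rightarrow> 'b::ab_group_add) \<Rightarrow>
    ('k, 'b) vbundle \<Rightarrow> bool" where
  "lifts_to_subbundle k W \<pi> G \<longleftrightarrow> (\<exists>\<sigma>. bundle_map k G W \<sigma> \<and> (\<forall>v\<in>gen G. \<pi> (\<sigma> v) = v) \<and>
     locally_free k (scal W) (stalk W) (\<lambda>x. \<sigma> ` stalk G x))"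

text \<open>Local sections of Prin(E) are families of stalk elements vanishing at almost all points, so
  subsheaves of modules correspond to arbitrary families of submodules of the stalks.\<close>

definition prin_subsheaf :: "'k::field set \<Rightarrow> ('k, 'v::ab_group_add) vbundle \<Rightarrow> ('k set \<Rightarrow> 'v set set) \<Rightarrow> bool" where
  "prin_subsheaf k E \<tau> \<longleftrightarrow> (\<forall>x\<in>points k. submodule (\<tau> x) (ring_on x) (prin_stalk E x))"

text \<open>Containment in E(D)/E: support on \<open>D\<close> and at most simple poles.\<close>

definition simple_poles_on :: "'k::field set \<Rightarrow> ('k, 'v::ab_group_add) vbundle \<Rightarrow> 'k set set \<Rightarrow> ('k set \<Rightarrow> 'v set set) \<Rightarrow> bool" where
  "simple_poles_on k E D \<tau> \<longleftrightarrow> (\<forall>x\<in>points k.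
     \<tau> x \<subseteq> carrier (quot (scal E) (stalk (twist E D) x) (stalk E x)))"

text \<open>The length of a subsheaf of Prin(E) supported on the finite set \<open>D\<close>.\<close>

definition skyscraper_length :: "('k::field, 'v::ab_group_add) vbundle \<Rightarrow> 'k set set \<Rightarrow> ('k set \<Rightarrow> 'v set set) \<Rightarrow> enat" where
  "skyscraper_length E D \<tau> = (\<Sum>x\<in>D. mod_length (ring_on x) (prin_stalk E x) (\<tau> x))"

text \<open>There is an exact sequence of sheaves \<open>0 \<rightarrow> G \<rightarrow> F2 \<rightarrow> \<tau> \<rightarrow> 0\<close> whose first map is the inclusion.
  A map to a skyscraper sheaf with finite support is the same as a family of maps of stalks.\<close>

definition quotient_sequence :: "'k::field set \<Rightarrow> ('k, 'b::ab_group_add) vbundle \<Rightarrow> ('k, 'b) vbundle \<Rightarrow>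
    ('k, 'a::ab_group_add) vbundle \<Rightarrow> ('k set \<Rightarrow> 'a set set) \<Rightarrow> bool" where
  "quotient_sequence k G F2 F1 \<tau> \<longleftrightarrow> (\<exists>q. \<forall>x\<in>points k.
     (\<forall>v\<in>stalk F2 x. \<forall>w\<in>stalk F2 x. q x (v + w) = q x v \<oplus>\<^bsub>prin_stalk F1 x\<^esub> q x w) \<and>
     (\<forall>a\<in>x. \<forall>v\<in>stalk F2 x. q x (scal F2 a v) = a \<odot>\<^bsub>prin_stalk F1 x\<^esub> q x v) \<and>
     q x ` stalk F2 x = \<tau> x \<and>
     {v\<in>stalk F2 x. q x v = \<zero>\<^bsub>prin_stalk F1 x\<^esub>} = stalk G x)"

end

theory Submission
  imports Defs "HOL-Computational_Algebra.Polynomial"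
begin

text \<open>
  The extension class is represented by the polar part of a rational splitting. A rational section
  \<open>s\<close> of \<open>\<pi>\<close> over the generic point fails to be regular at finitely many points only; a family \<open>p\<close> of
  rational homomorphisms from \<open>F2\<close> to \<open>F1\<close> with \<open>s - \<iota> p\<close> regular everywhere is a principal part
  that represents the class, and adding to \<open>p\<close> the principal part of a rational homomorphism amounts
  to choosing another \<open>s\<close>. All representatives of the class arise in this way
  (\<open>splits_translate\<close>, \<open>ext_class_coset\<close>).

  For such a pair, \<open>s u\<close> is a regular section of \<open>W\<close> exactly when \<open>p u\<close> is a regular section of
  \<open>F1\<close>. Hence the kernel \<open>G\<close> of \<open>p\<close>, viewed as a map from \<open>F2\<close> to the sheaf of \<open>F1\<close>-valued principal
  parts, is the largest subsheaf of \<open>F2\<close> that \<open>s\<close> embeds in \<open>W\<close>; it is saturated in \<open>W\<close>, and \<open>F2 / G\<close> is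
  the image of \<open>p\<close>. If the class lies in the span of at most \<open>h\<close> points of \<open>\<Delta>\<close> over \<open>D\<close>, then \<open>p\<close> can be taken to
  be a sum of at most \<open>h\<close> simple poles in rank one directions. Each of them has values in one line over the
  residue field, which is \<open>k\<close>, so that the image has length at most \<open>h\<close>
  (\<open>class_in_span_gives_subbundle\<close>).

  Conversely, let \<open>G\<close> lift to a subbundle by \<open>\<sigma>\<close>. Then \<open>\<sigma>\<close> is a rational splitting whose polar part
  vanishes on \<open>G\<close>. At a point of \<open>D\<close> choose a basis of \<open>F2\<close> with as few elements as possible outside \<open>G\<close>;
  their images in \<open>F2 / G\<close> generate a strictly increasing chain of submodules, so that their number
  is at most the length of \<open>F2 / G\<close> (\<open>basis_adapted_to_kernel\<close>). The polar part is the sum, over these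
  elements, of a coordinate function times one vector of \<open>F1\<close> with a simple pole, and such a product
  has rank one (\<open>subbundle_gives_class_in_span\<close>). A subfamily of least cardinality whose span still
  contains the class is independent (\<open>independent_subfamily_exists\<close>).

  The geometry of the curve enters through one fact: a rational function has finitely many poles
  (\<open>finite_poles\<close>). It makes bases of stalks at one point into bases at almost all points, which is
  what local freeness of \<open>G\<close> and of \<open>W / G\<close> requires. Finiteness of \<open>k\<close> allows lengths to be bounded by
  counting elements.
\<close>

section \<open>The function field as a ring\<close>

lemma field_ring_on: "field (ring_on (UNIV::'k::field set))"
proof -
  have inv: "\<exists>y. x + y = 0" "\<exists>y. y + x = 0" for x :: 'k
    by (rule exI[of _ "-x"]; simp)+
  have inv2: "x \<noteq> 0 \<Longrightarrow> \<exists>y. x * y = 1" for x :: 'k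
    by (rule exI[of _ "inverse x"]) simp
  have cr: "cring (ring_on (UNIV::'k set))"
    by (rule cringI)
      (auto simp: ring_on_def algebra_simps inv intro!: abelian_groupI comm_monoidI)
  then interpret cring "ring_on (UNIV::'k set)" .
  show ?thesis
    by (rule cring_fieldI2) (auto simp: ring_on_def inv2)
qed

lemma a_inv_ring_on: "\<ominus>\<^bsub>ring_on (UNIV::'k::field set)\<^esub> x = - x"
proof -
  interpret field "ring_on (UNIV::'k set)" by (rule field_ring_on)
  have "x \<oplus>\<^bsub>ring_on (UNIV::'k set)\<^esub> (-x) = \<zero>\<^bsub>ring_on (UNIV::'k set)\<^esub>" by (simp add: ring_on_def)
  then show ?thesis by (intro sum_zero_eq_neg[symmetric]) (auto simp: ring_on_def)
qed

lemma m_inv_ring_on: "x \<noteq> 0 \<Longrightarrow> inv\<^bsub>ring_on (UNIV::'k::field set)\<^esub> x = inverse x"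
proof -
  interpret field "ring_on (UNIV::'k set)" by (rule field_ring_on)
  assume "x \<noteq> 0"
  then have "x \<otimes>\<^bsub>ring_on (UNIV::'k set)\<^esub> (inverse x) = \<one>\<^bsub>ring_on (UNIV::'k set)\<^esub>" by (simp add: ring_on_def)
  then show ?thesis by (intro comm_inv_char) (auto simp: ring_on_def)
qed

text \<open>Subrings of the function field, in terms of the type class operations rather than of a record.\<close>

definition closed_ring :: "'k::field set \<Rightarrow> bool" where
  "closed_ring R \<longleftrightarrow> 0 \<in> R \<and> 1 \<in> R \<and> (\<forall>a\<in>R. \<forall>b\<in>R. a + b \<in> R \<and> a * b \<in> R) \<and> (\<forall>a\<in>R. - a \<in> R)"

lemma closed_ringD:
  assumes "closed_ring R"
  shows "0 \<in> R" "1 \<in> R" "a \<in> R \<Longrightarrow> b \<in> R \<Longrightarrow> a + b \<in> R" "a \<in> R \<Longrightarrow> b \<in> R \<Longrightarrow> a * b \<in> R"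
    "a \<in> R \<Longrightarrow> - a \<in> R" "a \<in> R \<Longrightarrow> b \<in> R \<Longrightarrow> a - b \<in> R"
proof -
  show *: "0 \<in> R" "1 \<in> R" "a \<in> R \<Longrightarrow> b \<in> R \<Longrightarrow> a + b \<in> R" "a \<in> R \<Longrightarrow> b \<in> R \<Longrightarrow> a * b \<in> R"
    "a \<in> R \<Longrightarrow> - a \<in> R" for a b using assms by (auto simp: closed_ring_def)
  show "a \<in> R \<Longrightarrow> b \<in> R \<Longrightarrow> a - b \<in> R" using *(3)[of a "-b"] *(5)[of b] by simp
qed

lemma closed_ring_power: "closed_ring R \<Longrightarrow> a \<in> R \<Longrightarrow> a ^ n \<in> R"
  by (induction n) (auto simp: closed_ringD)

lemma closed_ring_sum: "closed_ring R \<Longrightarrow> (\<And>i. i \<in> I \<Longrightarrow> f i \<in> R) \<Longrightarrow> sum f I \<in> R"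
  by (induction I rule: infinite_finite_induct) (auto simp: closed_ringD)

lemma subring_closed_ring: "subring R (ring_on UNIV) \<Longrightarrow> closed_ring R"
  using subringE(2,3,5,6,7)[of R "ring_on UNIV", unfolded a_inv_ring_on]
  unfolding closed_ring_def by (auto simp: ring_on_def)

lemma subfield_closed_ring:
  assumes "subfield k (ring_on UNIV)"
  shows "closed_ring k" "a \<in> k \<Longrightarrow> inverse a \<in> k"
proof -
  interpret field "ring_on (UNIV::'a set)" by (rule field_ring_on)
  show c: "closed_ring k" using subring_closed_ring[OF subfieldE(1)[OF assms]] .
  show "inverse a \<in> k" if "a \<in> k"
  proof (cases "a = 0")
    case True then show ?thesis using c by (simp add: closed_ringD)
  next
    case False
    then have "a \<in> k - {\<zero>\<^bsub>ring_on UNIV\<^esub>}" using that by (simp add: ring_on_def)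
    from subfield_m_inv(1)[OF assms this] show ?thesis using m_inv_ring_on[OF False] by simp
  qed
qed

lemma cring_ring_on: "closed_ring R \<Longrightarrow> cring (ring_on R)"
proof -
  assume R: "closed_ring R"
  have inv: "x \<in> R \<Longrightarrow> \<exists>y\<in>R. y + x = 0" "x \<in> R \<Longrightarrow> \<exists>y\<in>R. x + y = 0" for x :: 'a
    by (rule bexI[of _ "-x"]; auto simp: closed_ringD[OF R])+
  show ?thesis
    by (rule cringI)
      (auto simp: ring_on_def algebra_simps inv closed_ringD[OF R] intro!: abelian_groupI comm_monoidI)
qed

section \<open>Discrete valuation rings\<close>

lemma dvr_closed_ring: "dvr R \<Longrightarrow> closed_ring R"
  using subring_closed_ring unfolding dvr_def by blast

text \<open>The integer \<open>n\<close> in \<open>f = u * t powi n\<close> is the valuation of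
  \<open>f\<close>; the last clause says that the ring consists of the elements of nonnegative
  valuation.\<close>

lemma dvr_form:
  assumes "dvr R"
  obtains t where "t \<in> R" "t \<noteq> 0" "max_ideal R = {t * r | r. r \<in> R}"
    "\<And>f. f \<noteq> 0 \<Longrightarrow> \<exists>u n. u \<in> R \<and> u \<noteq> 0 \<and> inverse u \<in> R \<and> f = u * t powi n"
    "\<And>u n. u \<in> R \<Longrightarrow> u \<noteq> 0 \<Longrightarrow> inverse u \<in> R \<Longrightarrow> u * t powi n \<in> R \<longleftrightarrow> n \<ge> 0"
proof -
  note R = closed_ringD[OF dvr_closed_ring[OF assms]]
  from assms obtain t where t: "t \<in> R" "t \<noteq> 0" "inverse t \<notin> R"
    and f: "\<And>f. f \<noteq> 0 \<Longrightarrow> \<exists>u n. u \<in> R \<and> u \<noteq> 0 \<and> inverse u \<in> R \<and> f = u * t powi n"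
    unfolding dvr_def by blast
  have pw: "t powi n \<in> R" if "n \<ge> 0" for n
    using that closed_ring_power[OF dvr_closed_ring[OF assms] t(1)] by (simp add: power_int_def)
  have npw: "t powi n \<notin> R" if "n < 0" for n
  proof
    assume "t powi n \<in> R"
    moreover have "t powi (-n - 1) \<in> R" using that by (intro pw) simp
    ultimately have "t powi n * t powi (-n - 1) \<in> R" by (rule R)
    moreover have "t powi n * t powi (-n - 1) = inverse t"
      using t(2) power_int_add[of t n "-n-1"] by (simp add: power_int_minus)
    ultimately show False using t by simp
  qed
  have iff: "u * t powi n \<in> R \<longleftrightarrow> n \<ge> 0" if u: "u \<in> R" "u \<noteq> 0" "inverse u \<in> R" for u n
  proof
    assume "u * t powi n \<in> R"
    then have "inverse u * (u * t powi n) \<in> R" using R u by blast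
    then show "n \<ge> 0" using npw[of n] u by (cases "n < 0") (auto simp flip: mult.assoc)
  qed (use R u pw in auto)
  have max: "max_ideal R = {t * r | r. r \<in> R}"
  proof (intro Set.set_eqI iffI)
    fix g assume g: "g \<in> max_ideal R"
    show "g \<in> {t * r | r. r \<in> R}"
    proof (cases "g = 0")
      case True then show ?thesis using R by auto
    next
      case False
      from f[OF this] obtain u n where u: "u \<in> R" "u \<noteq> 0" "inverse u \<in> R" "g = u * t powi n" by auto
      have "inverse g = inverse u * t powi (-n)" using u by (simp add: power_int_minus)
      moreover have "inverse g \<notin> R" using g False by (simp add: max_ideal_def)
      ultimately have "n > 0" using iff[of "inverse u" "-n"] u by auto
      then have "u * t powi (n - 1) \<in> R" using iff u by simp
      moreover have "g = t * (u * t powi (n - 1))"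
        using u t power_int_add[of t 1 "n - 1"] by simp
      ultimately show ?thesis by blast
    qed
  next
    fix g assume "g \<in> {t * r | r. r \<in> R}"
    then obtain r where r: "g = t * r" "r \<in> R" by blast
    have "inverse g \<notin> R" if "g \<noteq> 0"
    proof
      assume "inverse g \<in> R"
      then have "r * inverse g \<in> R" using R r by blast
      moreover have "r * inverse g = inverse t" using r that by simp
      ultimately show False using t by simp
    qed
    then show "g \<in> max_ideal R" using r R t by (auto simp: max_ideal_def)
  qed
  from that[OF t(1,2) max f iff] show thesis by blast
qed

lemma max_ideal_uniformizer:
  assumes "dvr R"
  obtains t where "t \<in> R" "t \<noteq> 0" "max_ideal R = {t * r | r. r \<in> R}"
  by (rule dvr_form[OF assms]) (rule that; assumption)

definition uniformizer :: "'k::field set \<Rightarrow> 'k" where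
  "uniformizer R = (SOME t. t \<in> R \<and> t \<noteq> 0 \<and> max_ideal R = {t * r | r. r \<in> R})"

lemma uniformizer:
  assumes "dvr R"
  shows "uniformizer R \<in> R \<and> uniformizer R \<noteq> 0 \<and> max_ideal R = {uniformizer R * r | r. r \<in> R}"
proof -
  obtain t where "t \<in> R \<and> t \<noteq> 0 \<and> max_ideal R = {t * r | r. r \<in> R}"
    using max_ideal_uniformizer[OF assms] by blast
  then show ?thesis unfolding uniformizer_def by (rule someI)
qed

lemma max_ideal_subset: "max_ideal R \<subseteq> R"
  by (auto simp: max_ideal_def)

lemma one_notin_max_ideal: "dvr R \<Longrightarrow> 1 \<notin> max_ideal R"
  using closed_ringD[OF dvr_closed_ring] by (auto simp: max_ideal_def)

lemma max_ideal_closed: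
  assumes "dvr R"
  shows "0 \<in> max_ideal R" "a \<in> max_ideal R \<Longrightarrow> b \<in> max_ideal R \<Longrightarrow> a + b \<in> max_ideal R"
    "a \<in> R \<Longrightarrow> b \<in> max_ideal R \<Longrightarrow> a * b \<in> max_ideal R" "b \<in> max_ideal R \<Longrightarrow> a \<in> R \<Longrightarrow> b * a \<in> max_ideal R"
    "a \<in> max_ideal R \<Longrightarrow> - a \<in> max_ideal R"
proof -
  obtain t where t: "max_ideal R = {t * r | r. r \<in> R}" using max_ideal_uniformizer[OF assms] by blast
  note R = closed_ringD[OF dvr_closed_ring[OF assms]]
  show "0 \<in> max_ideal R" using R unfolding t by force
  show "a \<in> max_ideal R \<Longrightarrow> b \<in> max_ideal R \<Longrightarrow> a + b \<in> max_ideal R"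
    using R(3) unfolding t by (auto simp flip: distrib_left)
  show "a \<in> max_ideal R \<Longrightarrow> - a \<in> max_ideal R"
    using R(5) unfolding t by (auto simp flip: mult_minus_right)
  show m: "a \<in> R \<Longrightarrow> b \<in> max_ideal R \<Longrightarrow> a * b \<in> max_ideal R" for a b
  proof -
    assume a: "a \<in> R" "b \<in> max_ideal R"
    then obtain r where r: "b = t * r" "r \<in> R" unfolding t by blast
    then have "a * b = t * (a * r)" by simp
    then show "a * b \<in> max_ideal R" using R(4)[OF a(1) r(2)] unfolding t by blast
  qed
  show "b \<in> max_ideal R \<Longrightarrow> a \<in> R \<Longrightarrow> b * a \<in> max_ideal R" using m[of a b] by (metis mult.commute)
qed

lemma dvr_valuation:
  assumes "dvr R" "f \<notin> R"
  shows "inverse f \<in> max_ideal R"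
proof -
  obtain t where t: "t \<in> R" "t \<noteq> 0"
    "\<And>f. f \<noteq> 0 \<Longrightarrow> \<exists>u n. u \<in> R \<and> u \<noteq> 0 \<and> inverse u \<in> R \<and> f = u * t powi n"
    "\<And>u n. u \<in> R \<Longrightarrow> u \<noteq> 0 \<Longrightarrow> inverse u \<in> R \<Longrightarrow> u * t powi n \<in> R \<longleftrightarrow> n \<ge> 0"
    by (rule dvr_form[OF assms(1)]) (rule that; assumption)
  have f0: "f \<noteq> 0" using assms closed_ringD(1)[OF dvr_closed_ring[OF assms(1)]] by auto
  from t(3)[OF f0] obtain u n where u: "u \<in> R" "u \<noteq> 0" "inverse u \<in> R" "f = u * t powi n" by auto
  then have "n < 0" using t(4) assms by force
  moreover have "inverse f = inverse u * t powi (-n)" using u by (simp add: power_int_minus)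
  ultimately have "inverse f \<in> R" using t(4)[of "inverse u" "-n"] u by simp
  then show ?thesis using assms by (simp add: max_ideal_def)
qed

text \<open>An element of the maximal ideal has positive valuation, so a high power of it outweighs any pole
  of \<open>b\<close>.\<close>

lemma max_ideal_power_mult:
  assumes "dvr R" "a \<in> max_ideal R"
  obtains n where "\<And>m. m \<ge> n \<Longrightarrow> a ^ m * b \<in> max_ideal R"
proof -
  obtain t where t: "t \<in> R" "t \<noteq> 0" "max_ideal R = {t * r | r. r \<in> R}"
    "\<And>f. f \<noteq> 0 \<Longrightarrow> \<exists>u n. u \<in> R \<and> u \<noteq> 0 \<and> inverse u \<in> R \<and> f = u * t powi n"
    "\<And>u n. u \<in> R \<Longrightarrow> u \<noteq> 0 \<Longrightarrow> inverse u \<in> R \<Longrightarrow> u * t powi n \<in> R \<longleftrightarrow> n \<ge> 0"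
    by (rule dvr_form[OF assms(1)]) (rule that; assumption)
  note R = closed_ringD[OF dvr_closed_ring[OF assms(1)]]
  show thesis
  proof (cases "b = 0")
    case True
    then show ?thesis using max_ideal_closed(1)[OF assms(1)] by (intro that[of 0]) simp
  next
    case False
    from t(4)[OF this] obtain u n where u: "u \<in> R" "u \<noteq> 0" "inverse u \<in> R" "b = u * t powi n" by auto
    from assms(2) t(3) obtain r where r: "a = t * r" "r \<in> R" by auto
    show ?thesis
    proof (rule that[of "nat (1 - n)"])
      fix m assume "m \<ge> nat (1 - n)"
      then have m: "int m + n \<ge> 1" by linarith
      have "a ^ m * b = t * (r ^ m * (u * t powi (int m + n - 1)))"
      proof -
        have "t ^ m * t powi n = t * t powi (int m + n - 1)"
          using t(2) power_int_add[of t 1 "int m + n - 1"] power_int_add[of t "int m" n] by simp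
        then show ?thesis using r u by (simp add: power_mult_distrib mult_ac)
      qed
      moreover have "r ^ m * (u * t powi (int m + n - 1)) \<in> R"
        using R(4) closed_ring_power[OF dvr_closed_ring[OF assms(1)] r(2)] t(5)[of u] u m by simp
      ultimately show "a ^ m * b \<in> max_ideal R" unfolding t(3) by blast
    qed
  qed
qed

text \<open>If \<open>f\<close> lies in \<open>S\<close> but not in \<open>R\<close>, then \<open>b = f ^ n
  * (inverse f ^ n * b)\<close> lies in \<open>S\<close> for every \<open>b\<close> and large
  \<open>n\<close>, and \<open>S\<close> would be the whole field.\<close>

lemma dvr_maximal:
  assumes "dvr R" "dvr S" "R \<subseteq> S"
  shows "R = S"
proof (rule ccontr)
  assume "R \<noteq> S"
  then obtain f where f: "f \<in> S" "f \<notin> R" using assms by blast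
  have inv: "inverse f \<in> max_ideal R" using dvr_valuation[OF assms(1) f(2)] .
  have "b \<in> S" for b
  proof -
    obtain n where "inverse f ^ n * b \<in> max_ideal R"
      using max_ideal_power_mult[OF assms(1) inv] by blast
    then have "inverse f ^ n * b \<in> S" using max_ideal_subset assms by blast
    then have "f ^ n * (inverse f ^ n * b) \<in> S"
      using closed_ringD(4)[OF dvr_closed_ring[OF assms(2)]] closed_ring_power[OF dvr_closed_ring[OF assms(2)] f(1)] by blast
    moreover have "f \<noteq> 0" using f closed_ringD(1)[OF dvr_closed_ring[OF assms(1)]] by auto
    ultimately show "b \<in> S" by (simp flip: mult.assoc power_mult_distrib)
  qed
  then show False using assms(2) unfolding dvr_def by blast
qed

lemma unit_plus_max_ideal:
  assumes "dvr R" "c \<in> R" "c \<notin> max_ideal R" "a \<in> max_ideal R"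
  shows "c + a \<in> R" "c + a \<noteq> 0" "inverse (c + a) \<in> R"
proof -
  note R = closed_ringD[OF dvr_closed_ring[OF assms(1)]]
  show ca: "c + a \<in> R" using assms max_ideal_subset R by blast
  have n: "c + a \<notin> max_ideal R"
  proof
    assume "c + a \<in> max_ideal R"
    then have "c + a + (- a) \<in> max_ideal R" using max_ideal_closed[OF assms(1)] assms(4) by blast
    then show False using assms by simp
  qed
  show "c + a \<noteq> 0" using n max_ideal_closed(1)[OF assms(1)] by auto
  show "inverse (c + a) \<in> R" using n ca by (auto simp: max_ideal_def)
qed

lemma power_max_ideal: "dvr R \<Longrightarrow> a \<in> max_ideal R \<Longrightarrow> n > 0 \<Longrightarrow> a ^ n \<in> max_ideal R"
  by (induction n) (auto simp: max_ideal_closed closed_ring_power[OF dvr_closed_ring] max_ideal_subset[THEN subsetD])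

text \<open>The inductive step of the weak approximation theorem. The element found for \<open>S\<close> is
  corrected at the new point \<open>Q\<close> by a factor \<open>b\<close> with a pole at
  \<open>P\<close> and a zero at \<open>Q\<close>.\<close>

lemma separating_element:
  assumes "finite S" "\<And>R. R \<in> S \<Longrightarrow> dvr R" "dvr P" "P \<notin> S"
  shows "\<exists>a. a \<noteq> 0 \<and> inverse a \<in> max_ideal P \<and> (\<forall>R\<in>S. a \<in> max_ideal R)"
  using assms
proof (induction S rule: finite_induct)
  case empty
  obtain t where t: "t \<in> P" "t \<noteq> 0" "max_ideal P = {t * r | r. r \<in> P}"
    using max_ideal_uniformizer[OF empty(2)] .
  then have "t \<in> max_ideal P" using closed_ringD(2)[OF dvr_closed_ring[OF empty(2)]] by force
  then show ?case using t by (intro exI[of _ "inverse t"]) simp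
next
  case (insert Q S)
  then have dQ: "dvr Q" and dP: "dvr P" and PQ: "P \<noteq> Q" and dS: "\<And>R. R \<in> S \<Longrightarrow> dvr R" by auto
  obtain a where a: "a \<noteq> 0" "inverse a \<in> max_ideal P" "\<forall>R\<in>S. a \<in> max_ideal R"
    using insert by auto
  obtain f where f: "f \<in> Q" "f \<notin> P" using dvr_maximal[OF dQ dP] PQ by blast
  obtain g where g: "g \<in> P" "g \<notin> Q" using dvr_maximal[OF dP dQ] PQ by blast
  \<comment> \<open>a pole at \<open>P\<close> and a zero at \<open>Q\<close>\<close>
  define b where "b = f * inverse g"
  have fg0: "f \<noteq> 0" "g \<noteq> 0" using f g closed_ringD(1)[OF dvr_closed_ring] dP dQ by auto
  have bP: "inverse b \<in> max_ideal P"
    using max_ideal_closed(3)[OF dP g(1) dvr_valuation[OF dP f(2)]] by (simp add: b_def mult.commute)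
  have bQ: "b \<in> max_ideal Q"
    using max_ideal_closed(3)[OF dQ f(1) dvr_valuation[OF dQ g(2)]] by (simp add: b_def)
  have b0: "b \<noteq> 0" using fg0 by (simp add: b_def)
  have "\<exists>n. \<forall>m\<ge>n. a ^ m * b \<in> max_ideal R" if "R \<in> S" for R
    using max_ideal_power_mult[OF dS[OF that], of a b] a(3) that by metis
  then obtain N where N: "\<And>R m. R \<in> S \<Longrightarrow> m \<ge> N R \<Longrightarrow> a ^ m * b \<in> max_ideal R" by metis
  \<comment> \<open>an exponent for which the zeros of \<open>a\<close> outweigh the poles of \<open>b\<close> on \<open>S\<close>\<close>
  define m where "m = Suc (\<Sum>R\<in>S. N R)"
  have "m \<ge> N R" if "R \<in> S" for R
    unfolding m_def using member_le_sum[of R S N] that insert(1) by simp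
  then have mS: "a ^ m * b \<in> max_ideal R" if "R \<in> S" for R using N that by blast
  have am: "inverse a ^ m \<in> max_ideal P" using power_max_ideal[OF dP a(2), of m] by (simp add: m_def del: power_Suc)
  show ?case
  proof (cases "a \<in> Q")
    case True
    have "a ^ m * b \<in> max_ideal Q"
      using max_ideal_closed(3)[OF dQ closed_ring_power[OF dvr_closed_ring[OF dQ] True] bQ] .
    moreover have "inverse (a ^ m * b) \<in> max_ideal P"
      using max_ideal_closed(3)[OF dP _ bP, of "inverse a ^ m"] am max_ideal_subset
      by (auto simp: power_inverse)
    ultimately show ?thesis using mS a(1) b0 by (intro exI[of _ "a ^ m * b"]) auto
  next
    case False
    have aQ: "inverse a ^ m \<in> max_ideal Q"
      using power_max_ideal[OF dQ dvr_valuation[OF dQ False], of m] by (simp add: m_def del: power_Suc)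
    \<comment> \<open>\<open>a ^ m / (1 + a ^ m) = 1 / u\<close> is a unit at \<open>P\<close> and at \<open>Q\<close>, and behaves like \<open>a ^ m\<close> on \<open>S\<close>\<close>
    define u where "u = 1 + inverse a ^ m"
    note uP = unit_plus_max_ideal[OF dP closed_ringD(2)[OF dvr_closed_ring[OF dP]] one_notin_max_ideal[OF dP] am, folded u_def]
    note uQ = unit_plus_max_ideal[OF dQ closed_ringD(2)[OF dvr_closed_ring[OF dQ]] one_notin_max_ideal[OF dQ] aQ, folded u_def]
    have eq: "inverse u * b = inverse (1 + a ^ m) * (a ^ m * b)"
    proof -
      have "u = (1 + a ^ m) * inverse (a ^ m)" using a(1) by (simp add: u_def power_inverse field_simps)
      then show ?thesis by (simp add: mult_ac)
    qed
    have "inverse u * b \<in> max_ideal R" if R: "R \<in> S" for R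
    proof -
      have "a ^ m \<in> max_ideal R" using power_max_ideal[OF dS[OF R], of a m] a(3) R by (simp add: m_def del: power_Suc)
      then have "inverse (1 + a ^ m) \<in> R"
        using unit_plus_max_ideal(3)[OF dS[OF R] closed_ringD(2)[OF dvr_closed_ring[OF dS[OF R]]] one_notin_max_ideal[OF dS[OF R]]] by blast
      then show ?thesis unfolding eq using max_ideal_closed(3)[OF dS[OF R]] mS[OF R] by blast
    qed
    moreover have "inverse u * b \<in> max_ideal Q" using max_ideal_closed(3)[OF dQ uQ(3) bQ] .
    moreover have "inverse (inverse u * b) \<in> max_ideal P"
      using max_ideal_closed(3)[OF dP uP(1) bP] by simp
    ultimately show ?thesis using uP(2) b0 by (intro exI[of _ "inverse u * b"]) auto
  qed
qed

text \<open>If \<open>a\<close> has a pole at one point and zeros at the others, then \<open>1 / (1 + 1 / a)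
  = a / (1 + a)\<close> is a unit at the first point and vanishes at the others.\<close>

lemma approximation_units:
  assumes "finite S" "\<And>R. R \<in> S \<Longrightarrow> dvr R"
  obtains z where "\<And>R. R \<in> S \<Longrightarrow> z R \<in> R \<and> z R \<notin> max_ideal R"
    "\<And>R Q. R \<in> S \<Longrightarrow> Q \<in> S \<Longrightarrow> R \<noteq> Q \<Longrightarrow> z R \<in> max_ideal Q"
proof -
  have "\<exists>z. z \<in> R \<and> z \<notin> max_ideal R \<and> (\<forall>Q\<in>S - {R}. z \<in> max_ideal Q)" if R: "R \<in> S" for R
  proof -
    have dR: "dvr R" using assms R by blast
    obtain a where a: "a \<noteq> 0" "inverse a \<in> max_ideal R" "\<forall>Q\<in>S - {R}. a \<in> max_ideal Q"
      using separating_element[of "S - {R}" R] assms R by blast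
    define u where "u = 1 + inverse a"
    note u = unit_plus_max_ideal[OF dR closed_ringD(2)[OF dvr_closed_ring[OF dR]] one_notin_max_ideal[OF dR] a(2), folded u_def]
    have "inverse u \<notin> max_ideal R" using u by (auto simp: max_ideal_def)
    moreover have "inverse u \<in> max_ideal Q" if Q: "Q \<in> S - {R}" for Q
    proof -
      have dQ: "dvr Q" using assms Q by blast
      have "inverse (1 + a) \<in> Q"
        using unit_plus_max_ideal(3)[OF dQ closed_ringD(2)[OF dvr_closed_ring[OF dQ]] one_notin_max_ideal[OF dQ]] a Q by blast
      then have "inverse (1 + a) * a \<in> max_ideal Q" using max_ideal_closed(3)[OF dQ] a Q by blast
      moreover have "inverse u = inverse (1 + a) * a"
      proof -
        have "u = (1 + a) * inverse a" using a(1) by (simp add: u_def field_simps)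
        then show ?thesis by simp
      qed
      ultimately show ?thesis by simp
    qed
    ultimately show ?thesis using u by blast
  qed
  then obtain z where "\<And>R. R \<in> S \<Longrightarrow> z R \<in> R \<and> z R \<notin> max_ideal R \<and> (\<forall>Q\<in>S - {R}. z R \<in> max_ideal Q)" by metis
  then show thesis by (intro that[of z]) auto
qed

section \<open>Rational functions have finitely many poles\<close>

abbreviation (input) "KR \<equiv> ring_on UNIV"

definition polys_over :: "'k::field set \<Rightarrow> 'k poly set" where
  "polys_over L = {p. \<forall>i. coeff p i \<in> L}"

lemma polys_over_closed:
  assumes "closed_ring L"
  shows "0 \<in> polys_over L" "1 \<in> polys_over L" "p \<in> polys_over L \<Longrightarrow> q \<in> polys_over L \<Longrightarrow> p + q \<in> polys_over L"
    "p \<in> polys_over L \<Longrightarrow> q \<in> polys_over L \<Longrightarrow> p * q \<in> polys_over L"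
    "p \<in> polys_over L \<Longrightarrow> - p \<in> polys_over L" "c \<in> L \<Longrightarrow> monom c i \<in> polys_over L"
proof -
  note L = closed_ringD[OF assms]
  show "0 \<in> polys_over L" "1 \<in> polys_over L" "p \<in> polys_over L \<Longrightarrow> q \<in> polys_over L \<Longrightarrow> p + q \<in> polys_over L"
    "p \<in> polys_over L \<Longrightarrow> - p \<in> polys_over L" "c \<in> L \<Longrightarrow> monom c i \<in> polys_over L"
    using L by (auto simp: polys_over_def one_pCons coeff_pCons split: nat.splits)
  show "p \<in> polys_over L \<Longrightarrow> q \<in> polys_over L \<Longrightarrow> p * q \<in> polys_over L"
    using L by (auto simp: polys_over_def coeff_mult intro!: closed_ring_sum[OF assms])
qed

lemma polys_over_prod:
  assumes "closed_ring L" "\<And>i. i \<in> I \<Longrightarrow> f i \<in> polys_over L"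
  shows "prod f I \<in> polys_over L"
  using assms(2) by (induction I rule: infinite_finite_induct) (auto simp: polys_over_closed[OF assms(1)])

lemma polys_over_sum:
  assumes "closed_ring L" "\<And>i. i \<in> I \<Longrightarrow> f i \<in> polys_over L"
  shows "sum f I \<in> polys_over L"
  using assms(2) by (induction I rule: infinite_finite_induct) (auto simp: polys_over_closed[OF assms(1)])

lemma poly_mem:
  assumes "closed_ring R" "p \<in> polys_over R" "x \<in> R"
  shows "poly p x \<in> R"
  unfolding poly_altdef using assms(2)
  by (intro closed_ring_sum[OF assms(1)] closed_ringD(4)[OF assms(1)] closed_ring_power[OF assms(1,3)])
     (auto simp: polys_over_def)

text \<open>Polynomials over a ring given by a record are lists with the leading coefficient first.\<close>

lemma eval_ring_on: "ring.eval KR xs (x::'k::field) = poly (Poly (rev xs)) x"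
proof -
  interpret K: field "KR :: 'k ring" by (rule field_ring_on)
  have pw: "x [^]\<^bsub>KR\<^esub> n = x ^ n" for n :: nat
    by (induction n) (simp_all add: K.nat_pow_Suc ring_on_def)
  show ?thesis
  proof (induction xs)
    case Nil then show ?case by simp (simp add: ring_on_def)
  next
    case (Cons a xs)
    then show ?case using pw[of "length xs"]
      by (simp add: Poly_snoc poly_monom) (simp add: ring_on_def)
  qed
qed

lemma algebraic_ring_on:
  assumes "subfield L (KR :: 'k::field ring)"
  shows "ring.algebraic KR L x \<longleftrightarrow> (\<exists>p\<in>polys_over L. p \<noteq> 0 \<and> poly p x = 0)"
proof -
  interpret K: field "KR :: 'k ring" by (rule field_ring_on)
  note L = subfield_closed_ring(1)[OF assms]
  have z: "\<zero>\<^bsub>KR\<^esub> = (0::'k)" "carrier KR = (UNIV :: 'k set)" by (auto simp: ring_on_def)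
  show ?thesis
  proof
    assume "K.algebraic L x"
    then obtain p where p: "p \<in> carrier (L [X]\<^bsub>KR\<^esub>)" "p \<noteq> []" "K.eval p x = \<zero>\<^bsub>KR\<^esub>"
      using K.algebraicE[OF subfieldE(1)[OF assms], of x] unfolding over_def z by blast
    then have p': "set p \<subseteq> L" "hd p \<noteq> 0"
      by (auto simp: univ_poly_def polynomial_def z)
    have "coeff (Poly (rev p)) (length p - 1) = hd p"
      using p(2) by (simp add: nth_default_def rev_nth hd_conv_nth)
    then have "Poly (rev p) \<noteq> 0" using p'(2) by (metis coeff_0)
    moreover have "Poly (rev p) \<in> polys_over L"
      using p'(1) closed_ringD(1)[OF L] nth_mem[of _ "rev p"] by (auto simp: polys_over_def nth_default_def)
    ultimately show "\<exists>p\<in>polys_over L. p \<noteq> 0 \<and> poly p x = 0"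
      using p(3) unfolding eval_ring_on z by blast
  next
    assume "\<exists>p\<in>polys_over L. p \<noteq> 0 \<and> poly p x = 0"
    then obtain p where p: "p \<in> polys_over L" "p \<noteq> 0" "poly p x = 0" by blast
    have "set (coeffs p) \<subseteq> L"
    proof
      fix c assume "c \<in> set (coeffs p)"
      then show "c \<in> L" using p(1) by (auto simp: coeffs_def polys_over_def split: if_splits)
    qed
    then have "rev (coeffs p) \<in> carrier (L [X]\<^bsub>KR\<^esub>)"
      using p(2) last_coeffs_eq_coeff_degree[OF p(2)]
      by (auto simp: univ_poly_def polynomial_def z hd_rev)
    moreover have "K.eval (rev (coeffs p)) x = \<zero>\<^bsub>KR\<^esub>" using p(3) unfolding eval_ring_on z by simp
    ultimately show "K.algebraic L x"
      using K.algebraicI[of "rev (coeffs p)" L x] p(2) unfolding over_def by simp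
  qed
qed

lemma generate_field_fractions:
  assumes "subfield k (KR :: 'k::field ring)" "c \<in> generate_field KR (insert g k)"
  shows "\<exists>p\<in>polys_over k. \<exists>q\<in>polys_over k. poly q g \<noteq> 0 \<and> c = poly p g / poly q g"
  using assms(2)
proof (induction rule: generate_field.induct)
  note k = polys_over_closed[OF subfield_closed_ring(1)[OF assms(1)]]
  note k' = closed_ringD[OF subfield_closed_ring(1)[OF assms(1)]]
  {
    case one
    then show ?case using k by (intro bexI[of _ 1]) (auto simp: ring_on_def)
  next
    case (incl h)
    show ?case
    proof (cases "h \<in> k")
      case True
      then show ?thesis using k by (intro bexI[of _ "monom h 0"] bexI[of _ 1]) (auto simp: poly_monom)
    next
      case False
      then show ?thesis using k incl k' by (intro bexI[of _ "monom 1 1"] bexI[of _ 1]) (auto simp: poly_monom)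
    qed
  next
    case (a_inv h)
    then obtain p q where "p \<in> polys_over k" "q \<in> polys_over k" "poly q g \<noteq> 0" "h = poly p g / poly q g" by blast
    then show ?case using k(5) unfolding a_inv_ring_on
      by (intro bexI[of _ "-p"] bexI[of _ q]) auto
  next
    case (m_inv h)
    then obtain p q where "p \<in> polys_over k" "q \<in> polys_over k" "poly q g \<noteq> 0" "h = poly p g / poly q g" by blast
    moreover have h0: "h \<noteq> 0" using m_inv by (simp add: ring_on_def)
    ultimately have "poly p g \<noteq> 0" "inverse h = poly q g / poly p g" by auto
    then show ?case unfolding m_inv_ring_on[OF h0]
      using \<open>p \<in> polys_over k\<close> \<open>q \<in> polys_over k\<close> by blast
  next
    case (eng_add h1 h2)
    then obtain p q p' q' where "p \<in> polys_over k" "q \<in> polys_over k" "poly q g \<noteq> 0" "h1 = poly p g / poly q g"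
      "p' \<in> polys_over k" "q' \<in> polys_over k" "poly q' g \<noteq> 0" "h2 = poly p' g / poly q' g" by blast
    moreover from this have "h1 \<oplus>\<^bsub>KR\<^esub> h2 = poly (p * q' + p' * q) g / poly (q * q') g"
      by (simp add: ring_on_def add_frac_eq)
    ultimately show ?case using k(3,4)
      by (intro bexI[of _ "p * q' + p' * q"] bexI[of _ "q * q'"]) auto
  next
    case (eng_mult h1 h2)
    then obtain p q p' q' where "p \<in> polys_over k" "q \<in> polys_over k" "poly q g \<noteq> 0" "h1 = poly p g / poly q g"
      "p' \<in> polys_over k" "q' \<in> polys_over k" "poly q' g \<noteq> 0" "h2 = poly p' g / poly q' g" by blast
    moreover from this have "h1 \<otimes>\<^bsub>KR\<^esub> h2 = poly (p * p') g / poly (q * q') g"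
      by (simp add: ring_on_def)
    ultimately show ?case using k(3,4)
      by (intro bexI[of _ "p * p'"] bexI[of _ "q * q'"]) auto
  }
qed

text \<open>An algebraic equation of \<open>g\<close> over \<open>k(t)\<close> becomes, after clearing
  denominators, a polynomial relation between \<open>t\<close> and \<open>g\<close> over
  \<open>k\<close>. Read as an equation for \<open>t\<close> it has coefficients in
  \<open>k[g]\<close>, and these are not all zero because \<open>g\<close> is transcendental.\<close>

lemma algebraic_exchange:
  assumes k: "subfield k (KR :: 'k::field ring)"
    and alg: "ring.algebraic KR (generate_field KR (insert t k)) g"
    and tr: "\<not> ring.algebraic KR k g"
  shows "ring.algebraic KR (generate_field KR (insert g k)) t"
proof -
  interpret K: field "KR :: 'k ring" by (rule field_ring_on)
  have c: "carrier KR = (UNIV::'k set)" by (simp add: ring_on_def)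
  have sub: "subfield (generate_field KR (insert a k)) KR" for a :: 'k
    by (rule K.generate_field_is_subfield) (simp add: c)
  note k' = subfield_closed_ring(1)[OF k]
  note pk = polys_over_closed[OF k']
  from alg obtain p where p: "p \<in> polys_over (generate_field KR (insert t k))" "p \<noteq> 0" "poly p g = 0"
    unfolding algebraic_ring_on[OF sub] by blast
  have "\<exists>a b. a \<in> polys_over k \<and> b \<in> polys_over k \<and> poly b t \<noteq> 0 \<and> coeff p i = poly a t / poly b t" for i
    using generate_field_fractions[OF k, of "coeff p i" t] p(1) unfolding polys_over_def by blast
  then obtain a b where ab: "\<And>i. a i \<in> polys_over k" "\<And>i. b i \<in> polys_over k" "\<And>i. poly (b i) t \<noteq> 0"
    "\<And>i. coeff p i = poly (a i) t / poly (b i) t" by metis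
  define n where "n = degree p"
  define P where "P i = a i * (\<Prod>j\<in>{..n} - {i}. b j)" for i
  \<comment> \<open>the common denominator of the coefficients, which turns them into the values \<open>P i\<close>\<close>
  define d where "d = poly (\<Prod>j\<le>n. b j) t"
  have Pk: "P i \<in> polys_over k" for i unfolding P_def by (intro pk(4) ab(1) polys_over_prod[OF k'] ab(2))
  have d0: "d \<noteq> 0" using ab(3) by (simp add: d_def poly_prod)
  have Pt: "poly (P i) t = coeff p i * d" if "i \<le> n" for i
  proof -
    have "(\<Prod>j\<le>n. b j) = b i * (\<Prod>j\<in>{..n} - {i}. b j)" using that by (subst prod.remove[of _ i]) auto
    then show ?thesis using ab(3)[of i] by (simp add: P_def d_def ab(4))
  qed
  have eq0: "(\<Sum>i\<le>n. poly (P i) t * g ^ i) = 0"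
  proof -
    have "(\<Sum>i\<le>n. poly (P i) t * g ^ i) = d * (\<Sum>i\<le>n. coeff p i * g ^ i)"
      unfolding sum_distrib_left by (intro sum.cong) (auto simp: Pt)
    then show ?thesis using p(3) by (simp add: poly_altdef n_def)
  qed
  define M where "M = Max ((\<lambda>i. degree (P i)) ` {..n})"
  have M: "degree (P i) \<le> M" if "i \<le> n" for i unfolding M_def using that by (intro Max_ge) auto
  define r where "r j = (\<Sum>i\<le>n. monom (coeff (P i) j) i)" for j
  define q where "q j = poly (r j) g" for j
  have rk: "r j \<in> polys_over k" for j unfolding r_def
    using Pk by (intro polys_over_sum[OF k'] pk(6)) (auto simp: polys_over_def)
  define Q where "Q = (\<Sum>j\<le>M. monom (q j) j)"
  have Pt': "poly (P i) t = (\<Sum>j\<le>M. coeff (P i) j * t ^ j)" if "i \<le> n" for i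
    unfolding poly_altdef using M[OF that] by (intro sum.mono_neutral_left) (auto simp: coeff_eq_0)
  have "poly Q t = (\<Sum>j\<le>M. (\<Sum>i\<le>n. coeff (P i) j * g ^ i) * t ^ j)"
    by (simp add: Q_def poly_sum poly_monom q_def r_def)
  also have "\<dots> = (\<Sum>i\<le>n. \<Sum>j\<le>M. coeff (P i) j * g ^ i * t ^ j)"
    by (subst sum.swap) (simp add: sum_distrib_right)
  also have "\<dots> = (\<Sum>i\<le>n. poly (P i) t * g ^ i)"
    by (intro sum.cong refl) (simp add: Pt' sum_distrib_left mult_ac)
  finally have Qt: "poly Q t = 0" using eq0 by simp
  have "coeff p n \<noteq> 0" using p(2) by (simp add: n_def)
  then have "poly (P n) t \<noteq> 0" using Pt[of n] d0 by simp
  then have "P n \<noteq> 0" by auto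
  then obtain j where j: "coeff (P n) j \<noteq> 0" by (metis leading_coeff_0_iff)
  have jM: "j \<le> M" using le_degree[OF j] M[of n] by simp
  have "coeff (r j) n = coeff (P n) j" by (simp add: r_def coeff_sum)
  then have "r j \<noteq> 0" using j by auto
  then have "q j \<noteq> 0" using tr rk[of j] unfolding algebraic_ring_on[OF k] q_def by blast
  moreover have "coeff Q j = q j" using jM by (simp add: Q_def coeff_sum)
  ultimately have Q0: "Q \<noteq> 0" by auto
  have kin: "k \<subseteq> generate_field KR (insert g k)" "g \<in> generate_field KR (insert g k)"
    by (auto intro: generate_field.incl)
  note gg = subfield_closed_ring(1)[OF sub, of g]
  have "q j \<in> generate_field KR (insert g k)" for j
    unfolding q_def using rk[of j] kin by (intro poly_mem[OF gg]) (auto simp: polys_over_def)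
  then have "Q \<in> polys_over (generate_field KR (insert g k))"
    unfolding Q_def by (intro polys_over_sum[OF gg] polys_over_closed(6)[OF gg])
  then show ?thesis unfolding algebraic_ring_on[OF sub] using Q0 Qt by blast
qed

text \<open>The field is finite over \<open>k(g, t)\<close>, which is finite over \<open>k(g)\<close>, since
  \<open>t\<close> is algebraic over \<open>k(g)\<close>.\<close>

lemma finite_over_transcendental:
  assumes "curve k" "(g::'k::field) \<notin> k"
  shows "ring.finite_dimension KR (generate_field KR (insert g k)) UNIV"
proof -
  interpret K: field "KR :: 'k ring" by (rule field_ring_on)
  have c: "carrier KR = (UNIV::'k set)" by (simp add: ring_on_def)
  have k: "subfield k KR" using assms(1) by (simp add: curve_def)
  have sub: "subfield (generate_field KR (insert a k)) KR" for a :: 'k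
    by (rule K.generate_field_is_subfield) (simp add: c)
  from assms(1) obtain t where t: "K.finite_dimension (generate_field KR (insert t k)) UNIV"
    unfolding curve_def by blast
  have tr: "\<not> K.algebraic k g" using assms unfolding curve_def by blast
  have "K.algebraic (generate_field KR (insert t k)) g"
    using K.finite_dimension_imp_algebraic[OF sub K.carrier_is_subring, unfolded c, OF t] by (simp add: over_def)
  then have alg: "K.algebraic (generate_field KR (insert g k)) t" using algebraic_exchange[OF k _ tr] by blast
  define L where "L = generate_field KR (insert g k)"
  have L: "subfield L KR" using sub by (simp add: L_def)
  define L' where "L' = K.simple_extension L t"
  have L': "subfield L' KR" "K.finite_dimension L L'"
    using K.simple_extension_is_subfield[OF L, of t] K.finite_dimension_simple_extension[OF L, of t] alg
    unfolding L'_def L_def c over_def by auto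
  have LL': "L \<subseteq> L'" unfolding L'_def by (rule K.simple_extension_incl) (auto simp: c)
  have "t \<in> L'" unfolding L'_def by (rule K.simple_extension_mem[OF subfieldE(1)[OF L]]) (simp add: c)
  moreover have "k \<subseteq> L" unfolding L_def by (auto intro: generate_field.incl)
  ultimately have tk: "insert t k \<subseteq> L'" using LL' by blast
  have kt: "generate_field KR (insert t k) \<subseteq> L'"
    by (rule K.generate_field_min_subfield1[OF _ L'(1) tk]) (simp add: c)
  from t obtain n where n: "K.dimension n (generate_field KR (insert t k)) UNIV" by auto
  obtain Vs where Vs: "K.Span (generate_field KR (insert t k)) Vs = UNIV"
    using K.exists_base[OF sub n] by (elim exE conjE)
  have "{K.combine Ks Vs | Ks. set Ks \<subseteq> generate_field KR (insert t k)} \<subseteq> {K.combine Ks Vs | Ks. set Ks \<subseteq> L'}"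
    using kt by blast
  moreover have "K.Span L' Vs = {K.combine Ks Vs | Ks. set Ks \<subseteq> L'}"
    by (rule K.Span_eq_combine_set[OF L'(1)]) (simp add: c)
  moreover have "K.Span (generate_field KR (insert t k)) Vs = {K.combine Ks Vs | Ks. set Ks \<subseteq> generate_field KR (insert t k)}"
    by (rule K.Span_eq_combine_set[OF sub]) (simp add: c)
  ultimately have SL: "K.Span L' Vs = UNIV" using Vs by (metis top.extremum_uniqueI)
  have "K.finite_dimension L' (K.Span L' Vs)"
    by (rule K.Span_finite_dimension[OF L'(1)]) (simp add: c)
  then have fin: "K.finite_dimension L' UNIV" unfolding SL .
  show ?thesis using K.telescopic_base_dim(1)[OF L L'(1) L'(2) fin] unfolding L_def .
qed

text \<open>Take the lowest power of the variable out of the polynomial. The remaining factor has a nonzero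
  constant term in \<open>k\<close>, and all other terms vanish at the zeros of \<open>g\<close>.\<close>

lemma poly_order_at_zeros:
  assumes k: "subfield k KR" and p: "p \<in> polys_over k" "poly p g \<noteq> 0"
  shows "\<exists>n u. poly p g = g ^ n * u \<and> u \<noteq> 0 \<and> (\<forall>R\<in>points k. g \<in> max_ideal R \<longrightarrow> u \<in> R \<and> inverse u \<in> R)"
proof -
  have "p \<noteq> 0" using p(2) by auto
  define n where "n = (LEAST i. coeff p i \<noteq> 0)"
  have n: "coeff p n \<noteq> 0" "\<And>i. i < n \<Longrightarrow> coeff p i = 0"
    using LeastI_ex[of "\<lambda>i. coeff p i \<noteq> 0"] not_less_Least[of _ "\<lambda>i. coeff p i \<noteq> 0"] \<open>p \<noteq> 0\<close>
    unfolding n_def by (metis leading_coeff_0_iff, blast)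
  have peq: "p = monom 1 n * poly_shift n p"
    by (rule poly_eqI) (auto simp: coeff_monom_mult coeff_poly_shift n)
  obtain c r where cr: "poly_shift n p = pCons c r" by (cases "poly_shift n p") auto
  have "c = coeff p n" using cr coeff_poly_shift[of n p 0] by simp
  then have c: "c \<in> k" "c \<noteq> 0" using n p by (auto simp: polys_over_def)
  have r: "r \<in> polys_over k"
  proof -
    have "coeff r i = coeff p (Suc i + n)" for i using cr coeff_poly_shift[of n p "Suc i"] by simp
    then show ?thesis using p by (auto simp: polys_over_def)
  qed
  have eq: "poly p g = g ^ n * (c + g * poly r g)" using peq cr by (metis poly_mult poly_monom poly_pCons mult_1)
  have "c + g * poly r g \<in> R \<and> inverse (c + g * poly r g) \<in> R" if R: "R \<in> points k" "g \<in> max_ideal R" for R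
  proof -
    have d: "dvr R" "k \<subseteq> R" using R by (auto simp: points_def)
    have "c \<in> R" "inverse c \<in> R" using c d subfield_closed_ring[OF k] by auto
    then have cR: "c \<in> R" "c \<notin> max_ideal R" using c by (auto simp: max_ideal_def)
    have "poly r g \<in> R" using r d R max_ideal_subset by (intro poly_mem[OF dvr_closed_ring]) (auto simp: polys_over_def)
    then have "g * poly r g \<in> max_ideal R" using max_ideal_closed[OF d(1)] R by blast
    then show ?thesis using unit_plus_max_ideal[OF d(1) cR] by blast
  qed
  then show ?thesis using eq p(2) by (intro exI[of _ n] exI[of _ "c + g * poly r g"]) auto
qed

lemma generated_order_at_zeros:
  assumes k: "subfield k KR" and c: "c \<in> generate_field KR (insert g k)" "c \<noteq> 0" "g \<noteq> 0"
  shows "\<exists>n u. c = g powi n * u \<and> u \<noteq> 0 \<and> (\<forall>R\<in>points k. g \<in> max_ideal R \<longrightarrow> u \<in> R \<and> inverse u \<in> R)"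
proof -
  obtain p q where pq: "p \<in> polys_over k" "q \<in> polys_over k" "poly q g \<noteq> 0" "c = poly p g / poly q g"
    using generate_field_fractions[OF k c(1)] by blast
  then have "poly p g \<noteq> 0" using c by auto
  from poly_order_at_zeros[OF k pq(1) this] obtain n u where u: "poly p g = g ^ n * u" "u \<noteq> 0"
    "\<forall>R\<in>points k. g \<in> max_ideal R \<longrightarrow> u \<in> R \<and> inverse u \<in> R" by blast
  from poly_order_at_zeros[OF k pq(2,3)] obtain m v where v: "poly q g = g ^ m * v" "v \<noteq> 0"
    "\<forall>R\<in>points k. g \<in> max_ideal R \<longrightarrow> v \<in> R \<and> inverse v \<in> R" by blast
  have "c = g powi (int n - int m) * (u * inverse v)"
    using u v pq(4) c(3) by (simp add: power_int_diff field_simps)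
  moreover have "u * inverse v \<in> R \<and> inverse (u * inverse v) \<in> R" if "R \<in> points k" "g \<in> max_ideal R" for R
  proof -
    have "u \<in> R" "inverse u \<in> R" "v \<in> R" "inverse v \<in> R" using u v that by auto
    moreover have "closed_ring R" using that dvr_closed_ring by (auto simp: points_def)
    ultimately show ?thesis using closed_ringD(4)[of R u "inverse v"] closed_ringD(4)[of R "inverse u" v] by simp
  qed
  ultimately show ?thesis using u v by (intro exI[of _ "int n - int m"] exI[of _ "u * inverse v"]) auto
qed

lemma combine_ring_on:
  assumes "length Ks = length Us"
  shows "ring.combine KR Ks Us = (\<Sum>i<length Us. Ks ! i * Us ! i :: 'k::field)"
proof -
  interpret K: field "KR :: 'k ring" by (rule field_ring_on)
  show ?thesis using assms
  proof (induction Ks Us rule: list_induct2)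
    case Nil then show ?case by simp (simp add: ring_on_def)
  next
    case (Cons a Ks u Us)
    then show ?case by (simp add: lessThan_Suc_eq_insert_0 sum.reindex o_def del: sum.lessThan_Suc)
        (simp add: ring_on_def)
  qed
qed

text \<open>Choose for each of the given zeros of \<open>g\<close> a function that is a unit there and
  vanishes at the other ones. These functions are linearly independent over \<open>k(g)\<close>,
  so there are at most as many zeros as the degree of the field over \<open>k(g)\<close>.\<close>

lemma zeros_bounded:
  assumes cu: "curve k" and g: "(g::'k::field) \<notin> k"
  shows "\<exists>N. \<forall>S. finite S \<longrightarrow> S \<subseteq> {R\<in>points k. g \<in> max_ideal R} \<longrightarrow> card S \<le> N"
proof -
  interpret K: field "KR :: 'k ring" by (rule field_ring_on)
  have car: "carrier KR = (UNIV::'k set)" "\<zero>\<^bsub>KR\<^esub> = (0::'k)" by (auto simp: ring_on_def)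
  have k: "subfield k KR" using cu by (simp add: curve_def)
  define L where "L = generate_field KR (insert g k)"
  have L: "subfield L KR" unfolding L_def
    by (rule K.generate_field_is_subfield) (simp add: car)
  from finite_over_transcendental[OF cu g] obtain N where N: "K.dimension N L UNIV"
    unfolding L_def by auto
  have g0: "g \<noteq> 0" using g closed_ringD(1)[OF subfield_closed_ring(1)[OF k]] by auto
  have "card S \<le> N" if S: "finite S" "S \<subseteq> {R\<in>points k. g \<in> max_ideal R}" for S
  proof (rule ccontr)
    assume "\<not> card S \<le> N"
    have dS: "\<And>R. R \<in> S \<Longrightarrow> dvr R" using S by (auto simp: points_def)
    obtain z where z: "\<And>R. R \<in> S \<Longrightarrow> z R \<in> R \<and> z R \<notin> max_ideal R"
      "\<And>R Q. R \<in> S \<Longrightarrow> Q \<in> S \<Longrightarrow> R \<noteq> Q \<Longrightarrow> z R \<in> max_ideal Q"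
      using approximation_units[OF S(1) dS] by blast
    obtain ys where ys: "set ys = S" "distinct ys" using finite_distinct_list[OF S(1)] by blast
    have len: "length ys = card S" using ys distinct_card by fastforce
    have "K.dependent L (map z ys)"
      using K.independent_length_le_dimension[OF L N, of "map z ys"] len \<open>\<not> card S \<le> N\<close> by auto
    then obtain Ks where Ks: "length Ks = length ys" "K.combine Ks (map z ys) = 0" "set Ks \<subseteq> L" "set Ks \<noteq> {0}"
      using K.dependent_imp_non_trivial_combine[OF L, of "map z ys"] by (auto simp: car)
    have "length ys \<noteq> 0" using len \<open>\<not> card S \<le> N\<close> by simp
    then have "set Ks \<noteq> {}" using Ks(1) by auto
    then obtain i0 where i0: "i0 < length ys" "Ks ! i0 \<noteq> 0"
      using Ks(1,4) by (metis in_set_conv_nth subsetI subset_singleton_iff singletonI)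
    have "\<exists>n u. Ks ! i \<noteq> 0 \<longrightarrow> Ks ! i = g powi n * u \<and> u \<noteq> 0 \<and> (\<forall>R\<in>points k. g \<in> max_ideal R \<longrightarrow> u \<in> R \<and> inverse u \<in> R)"
      if "i < length ys" for i
    proof -
      have "Ks ! i \<in> generate_field KR (insert g k)" using Ks(1,3) nth_mem[of i Ks] that unfolding L_def by auto
      then show ?thesis using generated_order_at_zeros[OF k _ _ g0, of "Ks ! i"] by blast
    qed
    then obtain n u where nu: "\<And>i. i < length ys \<Longrightarrow> Ks ! i \<noteq> 0 \<Longrightarrow> Ks ! i = g powi (n i) * u i \<and> u i \<noteq> 0 \<and>
      (\<forall>R\<in>points k. g \<in> max_ideal R \<longrightarrow> u i \<in> R \<and> inverse (u i) \<in> R)" by metis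
    define I where "I = {i. i < length ys \<and> Ks ! i \<noteq> 0}"
    have I: "finite I" "i0 \<in> I" using i0 by (auto simp: I_def)
    \<comment> \<open>division by a coefficient of least order in \<open>g\<close> makes all coefficients regular\<close>
    define i where "i = arg_min_on n I"
    have i: "i \<in> I" "\<And>j. j \<in> I \<Longrightarrow> n i \<le> n j"
      using arg_min_if_finite[OF I(1), of n] arg_min_least[OF I(1), of _ n] I(2) unfolding i_def by auto
    define R where "R = ys ! i"
    have R: "R \<in> S" "dvr R" "R \<in> points k" "g \<in> max_ideal R"
      using i(1) ys S(2) dS nth_mem[of i ys] by (auto simp: R_def I_def)
    note RR = closed_ringD[OF dvr_closed_ring[OF R(2)]]
    have quo: "Ks ! j / Ks ! i \<in> R" if "j < length ys" for j
    proof (cases "Ks ! j = 0")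
      case True then show ?thesis using RR by simp
    next
      case False
      then have j: "j \<in> I" using that by (simp add: I_def)
      have "Ks ! j / Ks ! i = g powi (n j - n i) * (u j * inverse (u i))"
        using nu[of j] nu[of i] j i(1) g0 by (simp add: I_def power_int_diff field_simps)
      moreover have "g powi (n j - n i) \<in> R"
        using i(2)[OF j] closed_ring_power[OF dvr_closed_ring[OF R(2)]] R(4) max_ideal_subset
        by (auto simp: power_int_def)
      moreover have "u j \<in> R" "inverse (u i) \<in> R" using nu[of j] nu[of i] j i(1) R by (auto simp: I_def)
      ultimately show ?thesis using RR(4) by simp
    qed
    have "(\<Sum>j<length ys. Ks ! j * z (ys ! j)) = 0"
      using Ks(2) combine_ring_on[of Ks "map z ys"] Ks(1) by simp
    then have "(\<Sum>j<length ys. (Ks ! j / Ks ! i) * z (ys ! j)) = 0"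
      by (simp add: sum_divide_distrib[symmetric])
    moreover have il: "i < length ys" "Ks ! i \<noteq> 0" using i(1) by (auto simp: I_def)
    ultimately have sum0: "z R + (\<Sum>j\<in>{..<length ys} - {i}. (Ks ! j / Ks ! i) * z (ys ! j)) = 0"
      by (subst (asm) sum.remove[of _ i]) (auto simp: R_def)
    have "(\<Sum>j\<in>J. (Ks ! j / Ks ! i) * z (ys ! j)) \<in> max_ideal R" if "J \<subseteq> {..<length ys} - {i}" for J
      using finite_subset[OF that] that
    proof (induction J rule: infinite_finite_induct)
      case (insert j J)
      have "ys ! j \<noteq> R" using insert ys(2) il by (auto simp: R_def nth_eq_iff_index_eq)
      then have "z (ys ! j) \<in> max_ideal R" using z(2)[of "ys ! j" R] insert R ys by auto
      then have "(Ks ! j / Ks ! i) * z (ys ! j) \<in> max_ideal R"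
        using quo[of j] insert.prems by (intro max_ideal_closed(3)[OF R(2)]) auto
      then show ?case using insert by (simp only: sum.insert) (auto intro: max_ideal_closed(2)[OF R(2)])
    qed (auto simp: max_ideal_closed[OF R(2)])
    then have "- (\<Sum>j\<in>{..<length ys} - {i}. (Ks ! j / Ks ! i) * z (ys ! j)) \<in> max_ideal R"
      using max_ideal_closed(5)[OF R(2)] by blast
    then have "z R \<in> max_ideal R" using iffD2[OF eq_neg_iff_add_eq_0 sum0] by argo
    then show False using z(1)[OF R(1)] by blast
  qed
  then show ?thesis by blast
qed

text \<open>The poles of \<open>f\<close> are the zeros of \<open>inverse f\<close>.\<close>

theorem finite_poles:
  assumes "curve k"
  shows "finite {R \<in> points k. f \<notin> R}"
proof (cases "inverse f \<in> k")
  case True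
  have k: "subfield k KR" using assms by (simp add: curve_def)
  have "f \<in> k" using subfield_closed_ring(2)[OF k True] by simp
  then have "{R \<in> points k. f \<notin> R} = {}" by (auto simp: points_def)
  then show ?thesis by (simp only: finite.emptyI)
next
  case False
  obtain N where N: "\<And>S. finite S \<Longrightarrow> S \<subseteq> {R\<in>points k. inverse f \<in> max_ideal R} \<Longrightarrow> card S \<le> N"
    using zeros_bounded[OF assms False] by blast
  have fin: "finite {R\<in>points k. inverse f \<in> max_ideal R}"
    using infinite_arbitrarily_large[of "{R\<in>points k. inverse f \<in> max_ideal R}" "Suc N"] N
    by (metis Suc_n_not_le_n)
  show ?thesis
    by (rule finite_subset[OF _ fin]) (auto simp: points_def intro: dvr_valuation)
qed

section \<open>Lattices over discrete valuation rings\<close>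

definition lspan :: "('k \<Rightarrow> 'v \<Rightarrow> 'v) \<Rightarrow> 'k::field set \<Rightarrow> 'v::ab_group_add set \<Rightarrow> 'v set" where
  "lspan s R S = {(\<Sum>b\<in>S. s (c b) b) | c. \<forall>b\<in>S. c b \<in> R}"

definition rmodule :: "('k \<Rightarrow> 'v \<Rightarrow> 'v) \<Rightarrow> 'k::field set \<Rightarrow> 'v::ab_group_add set \<Rightarrow> bool" where
  "rmodule s R M \<longleftrightarrow> 0 \<in> M \<and> (\<forall>u\<in>M. \<forall>v\<in>M. u + v \<in> M) \<and> (\<forall>a\<in>R. \<forall>v\<in>M. s a v \<in> M)"

lemma lspanE:
  assumes "v \<in> lspan s R S"
  obtains c where "v = (\<Sum>b\<in>S. s (c b) b)" "\<And>b. b \<in> S \<Longrightarrow> c b \<in> R"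
  using assms unfolding lspan_def by (auto intro: that)

lemma rmoduleD:
  assumes "rmodule s R M"
  shows "0 \<in> M" "u \<in> M \<Longrightarrow> v \<in> M \<Longrightarrow> u + v \<in> M" "a \<in> R \<Longrightarrow> v \<in> M \<Longrightarrow> s a v \<in> M"
  using assms by (auto simp: rmodule_def)

lemma rmodule_sum: "rmodule s R M \<Longrightarrow> (\<And>i. i \<in> I \<Longrightarrow> f i \<in> M) \<Longrightarrow> sum f I \<in> M"
  by (induction I rule: infinite_finite_induct) (auto simp: rmodule_def)

lemma (in vector_space) rmodule_uminus:
  assumes "rmodule scale R M" "closed_ring R"
  shows "v \<in> M \<Longrightarrow> - v \<in> M" "u \<in> M \<Longrightarrow> v \<in> M \<Longrightarrow> u - v \<in> M"
proof -
  show *: "- v \<in> M" if "v \<in> M" for v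
  proof -
    have "- 1 \<in> R" using closed_ringD[OF assms(2)] by blast
    from rmoduleD(3)[OF assms(1) this that] show ?thesis by simp
  qed
  show "u \<in> M \<Longrightarrow> v \<in> M \<Longrightarrow> u - v \<in> M" using rmoduleD(2)[OF assms(1), of u "-v"] * by simp
qed

text \<open>Among finitely many elements one of least valuation divides all the others.\<close>

lemma dvr_minimal_valuation:
  assumes "dvr R" "finite I" "\<exists>i\<in>I. c i \<noteq> 0"
  shows "\<exists>i\<in>I. c i \<noteq> 0 \<and> (\<forall>j\<in>I. c j / c i \<in> R)"
  using assms(2,3)
proof (induction I rule: finite_induct)
  case (insert i I)
  note R = closed_ringD[OF dvr_closed_ring[OF assms(1)]]
  show ?case
  proof (cases "\<exists>i\<in>I. c i \<noteq> 0")
    case False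
    then have "c i \<noteq> 0" using insert by auto
    then show ?thesis using False R by (intro bexI[of _ i]) auto
  next
    case True
    then obtain j where j: "j \<in> I" "c j \<noteq> 0" "\<forall>l\<in>I. c l / c j \<in> R" using insert by blast
    show ?thesis
    proof (cases "c i / c j \<in> R")
      case True
      then show ?thesis using j by (intro bexI[of _ j]) auto
    next
      case False
      then have "inverse (c i / c j) \<in> R" using dvr_valuation[OF assms(1)] max_ideal_subset by blast
      then have ji: "c j / c i \<in> R" by simp
      have i: "c i \<noteq> 0" using False R by auto
      have "c l / c i \<in> R" if "l \<in> I" for l
      proof -
        have "c l / c i = (c l / c j) * (c j / c i)" using j by simp
        then show ?thesis using R(4)[of "c l / c j" "c j / c i"] ji j(3) that by auto
      qed
      then show ?thesis using i R by (intro bexI[of _ i]) auto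
    qed
  qed
qed simp

context vector_space
begin

lemma lspan_rmodule:
  assumes "closed_ring R"
  shows "rmodule scale R (lspan scale R S)"
proof -
  note R = closed_ringD[OF assms]
  have "0 \<in> lspan scale R S" unfolding lspan_def using R by (auto intro!: exI[of _ "\<lambda>_. 0"])
  moreover have "u + v \<in> lspan scale R S" if uv: "u \<in> lspan scale R S" "v \<in> lspan scale R S" for u v
  proof -
    from uv obtain c d where "u = (\<Sum>b\<in>S. c b *s b)" "v = (\<Sum>b\<in>S. d b *s b)" "\<forall>b\<in>S. c b \<in> R" "\<forall>b\<in>S. d b \<in> R"
      unfolding lspan_def by blast
    then show ?thesis using R unfolding lspan_def
      by (auto intro!: exI[of _ "\<lambda>b. c b + d b"] simp: sum.distrib scale_left_distrib)
  qed
  moreover have "a *s u \<in> lspan scale R S" if uv: "u \<in> lspan scale R S" "a \<in> R" for a u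
  proof -
    from uv obtain c where "u = (\<Sum>b\<in>S. c b *s b)" "\<forall>b\<in>S. c b \<in> R"
      unfolding lspan_def by blast
    then show ?thesis using R uv unfolding lspan_def
      by (auto intro!: exI[of _ "\<lambda>b. a * c b"] simp: scale_sum_right)
  qed
  ultimately show ?thesis unfolding rmodule_def by blast
qed

lemma lspan_superset:
  assumes "closed_ring R" "finite S"
  shows "S \<subseteq> lspan scale R S"
proof
  fix v assume "v \<in> S"
  have "(\<Sum>b\<in>S. (if b = v then 1 else 0) *s b) = (\<Sum>b\<in>S. if b = v then b else 0)"
    by (intro sum.cong) auto
  also have "\<dots> = v" using assms \<open>v \<in> S\<close> by simp
  finally show "v \<in> lspan scale R S"
    unfolding lspan_def using closed_ringD[OF assms(1)]
    by (auto intro!: exI[of _ "\<lambda>b. if b = v then 1 else 0"])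
qed

lemma lspan_minimal:
  assumes "rmodule scale R M" "S \<subseteq> M"
  shows "lspan scale R S \<subseteq> M"
proof
  fix v assume "v \<in> lspan scale R S"
  then obtain c where c: "v = (\<Sum>b\<in>S. c b *s b)" "\<forall>b\<in>S. c b \<in> R" unfolding lspan_def by blast
  show "v \<in> M" unfolding c(1) using c(2) assms(2)
    by (intro rmodule_sum[OF assms(1)] rmoduleD(3)[OF assms(1)]) auto
qed

lemma lspan_mono_span: "lspan scale R S \<subseteq> span S"
  unfolding lspan_def by (auto intro!: span_sum span_scale intro: span_base)

lemma span_lspan: "closed_ring R \<Longrightarrow> finite S \<Longrightarrow> span (lspan scale R S) = span S"
  using lspan_mono_span[of R S] lspan_superset[of R S] by (metis span_mono span_span subset_antisym)

text \<open>Adding a generator \<open>b\<close> to a free module: if \<open>b\<close> depends on the basis,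
  but with coefficients outside the ring, then the basis vector whose coefficient has least
  valuation can be expressed by \<open>b\<close> and the other basis vectors, and is exchanged for
  \<open>b\<close>.\<close>

lemma finitely_generated_free:
  assumes "dvr R" "finite S"
  shows "\<exists>B. finite B \<and> independent B \<and> lspan scale R B = lspan scale R S"
  using assms(2)
proof (induction S rule: finite_induct)
  case empty
  then show ?case using independent_empty by blast
next
  case (insert b S)
  note cR = dvr_closed_ring[OF assms(1)]
  note R = closed_ringD[OF cR]
  obtain B where B: "finite B" "independent B" "lspan scale R B = lspan scale R S" using insert by blast
  have S_sub: "lspan scale R S \<subseteq> lspan scale R (insert b S)"
    using lspan_superset[OF cR, of "insert b S"] insert(1) by (intro lspan_minimal lspan_rmodule cR) auto
  have b_in: "b \<in> lspan scale R (insert b S)" using lspan_superset[OF cR, of "insert b S"] insert(1) by auto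
  have B_sub: "B \<subseteq> lspan scale R (insert b S)" using lspan_superset[OF cR B(1)] B(3) S_sub by blast
  have gen: "lspan scale R (insert b S) = lspan scale R B'"
    if B': "finite B'" "B' \<subseteq> insert b B" "b \<in> lspan scale R B'" "B \<subseteq> lspan scale R B'" for B'
  proof
    show "lspan scale R B' \<subseteq> lspan scale R (insert b S)"
      using B' b_in B_sub by (intro lspan_minimal lspan_rmodule cR) auto
    have "lspan scale R B \<subseteq> lspan scale R B'" using B' by (intro lspan_minimal lspan_rmodule cR) auto
    then have "S \<subseteq> lspan scale R B'" using lspan_superset[OF cR insert(1)] B(3) by blast
    then show "lspan scale R (insert b S) \<subseteq> lspan scale R B'"
      using B' by (intro lspan_minimal lspan_rmodule cR) auto
  qed
  show ?case
  proof (cases "b \<in> span B")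
    case False
    then have "independent (insert b B)" using B by (intro independent_insertI)
    moreover have "lspan scale R (insert b S) = lspan scale R (insert b B)"
      using lspan_superset[OF cR, of "insert b B"] B by (intro gen) auto
    ultimately show ?thesis using B by blast
  next
    case True
    define c where "c = representation B b"
    have bc: "b = (\<Sum>v\<in>B. c v *s v)" unfolding c_def using sum_representation_eq[OF B(2) True B(1)] by simp
    show ?thesis
    proof (cases "\<forall>v\<in>B. c v \<in> R")
      case True
      then have "b \<in> lspan scale R B" unfolding lspan_def using bc by blast
      then have "lspan scale R (insert b S) = lspan scale R B"
        using lspan_superset[OF cR B(1)] B by (intro gen) auto
      then show ?thesis using B by blast
    next
      case False
      then have "\<exists>v\<in>B. c v \<noteq> 0" using R by metis
      then obtain i where i: "i \<in> B" "c i \<noteq> 0" "\<And>j. j \<in> B \<Longrightarrow> c j / c i \<in> R"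
        using dvr_minimal_valuation[OF assms(1) B(1)] by blast
      have "c i \<notin> R"
      proof
        assume "c i \<in> R"
        then have "c j / c i * c i \<in> R" if "j \<in> B" for j using R(4)[OF i(3)[OF that]] by blast
        then show False using False i(2) by auto
      qed
      then have inv: "inverse (c i) \<in> R" using dvr_valuation[OF assms(1)] max_ideal_subset by blast
      \<comment> \<open>\<open>b\<close> replaces the basis vector \<open>i\<close>\<close>
      define B' where "B' = insert b (B - {i})"
      have finB': "finite B'" using B by (simp add: B'_def)
      note B'R = lspan_superset[OF cR finB']
      note M = lspan_rmodule[OF cR, of B']
      have "b = c i *s i + (\<Sum>v\<in>B - {i}. c v *s v)" using bc sum.remove[OF B(1) i(1)] by metis
      then have "inverse (c i) *s b = i + inverse (c i) *s (\<Sum>v\<in>B - {i}. c v *s v)"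
        using i(2) by (simp add: scale_right_distrib)
      then have ieq: "i = inverse (c i) *s b - (\<Sum>v\<in>B - {i}. (c v / c i) *s v)"
        by (simp add: scale_sum_right divide_inverse mult.commute)
      have "i \<in> lspan scale R B'"
        by (subst ieq, intro rmodule_uminus[OF M cR] rmodule_sum[OF M] rmoduleD(3)[OF M] inv i(3))
          (use B'R in \<open>auto simp: B'_def\<close>)
      then have BB': "B \<subseteq> lspan scale R B'" using B'R by (auto simp: B'_def)
      have "lspan scale R (insert b S) = lspan scale R B'"
        using BB' B'R finB' by (intro gen) (auto simp: B'_def)
      moreover have "independent B'"
      proof -
        have "b \<notin> span (B - {i})"
        proof
          assume b: "b \<in> span (B - {i})"
          have "i \<in> span (B - {i})"
            by (subst ieq, intro span_diff span_sum span_scale b span_base)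
          then show False using B(2) i(1) by (auto simp: dependent_def)
        qed
        then show ?thesis unfolding B'_def by (intro independent_insertI independent_mono[OF B(2)]) auto
      qed
      ultimately show ?thesis using finB' by metis
    qed
  qed
qed

text \<open>A relation over the field, divided by a coefficient of least valuation, is a relation over the
  ring; so independence over the ring and over the field agree.\<close>

lemma quot_basis_zero_iff:
  assumes "dvr R"
  shows "quot_basis R scale M {0} B \<longleftrightarrow> finite B \<and> M = lspan scale R B \<and> independent B"
proof -
  note R = closed_ringD[OF dvr_closed_ring[OF assms]]
  have indep: "independent B" if B: "finite B"
    "\<forall>c. (\<forall>b\<in>B. c b \<in> R) \<and> (\<Sum>b\<in>B. c b *s b) = 0 \<longrightarrow> (\<forall>b\<in>B. c b = 0)"
  proof (rule independent_if_scalars_zero[OF B(1)])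
    fix c b assume c: "(\<Sum>b\<in>B. c b *s b) = 0" "b \<in> B"
    show "c b = 0"
    proof (rule ccontr)
      assume "c b \<noteq> 0"
      then obtain i where i: "i \<in> B" "c i \<noteq> 0" "\<forall>j\<in>B. c j / c i \<in> R"
        using dvr_minimal_valuation[OF assms B(1)] c(2) by blast
      have "(\<Sum>b\<in>B. (c b / c i) *s b) = inverse (c i) *s (\<Sum>b\<in>B. c b *s b)"
        by (simp add: scale_sum_right divide_inverse mult.commute)
      then have "(\<Sum>b\<in>B. (c b / c i) *s b) = 0" using c by simp
      then have "c i / c i = 0" using B(2)[rule_format, of "\<lambda>b. c b / c i" i] i by blast
      then show False using i by simp
    qed
  qed
  have ls: "{(\<Sum>b\<in>B. c b *s b) + n | c n. (\<forall>b\<in>B. c b \<in> R) \<and> n \<in> {0}} = lspan scale R B"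
    unfolding lspan_def by auto
  show ?thesis
  proof
    assume "quot_basis R scale M {0} B"
    note q = this[unfolded quot_basis_def ls]
    show "finite B \<and> M = lspan scale R B \<and> independent B"
      using q[THEN conjunct1] q[THEN conjunct2, THEN conjunct1] q[THEN conjunct2, THEN conjunct2] indep by simp
  next
    assume B: "finite B \<and> M = lspan scale R B \<and> independent B"
    then have "\<forall>b\<in>B. c b = 0" if "(\<Sum>b\<in>B. c b *s b) \<in> {0}" for c
      using independentD[of B B c] that by auto
    then show "quot_basis R scale M {0} B" unfolding quot_basis_def ls using B by (intro conjI) auto
  qed
qed

text \<open>The coordinates of the vectors in \<open>S\<close> with respect to \<open>S'\<close> are
  finitely many functions, with finitely many poles.\<close>

lemma lspan_generic_inclusion:
  assumes "curve k" "finite S" "finite S'" "S \<subseteq> span S'"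
  shows "finite {y\<in>points k. \<not> S \<subseteq> lspan scale y S'}"
proof -
  have "finite {y\<in>points k. v \<notin> lspan scale y S'}" if "v \<in> S" for v
  proof -
    have "v \<in> range (\<lambda>c. \<Sum>b\<in>S'. c b *s b)" using that assms(4) span_finite[OF assms(3)] by auto
    then obtain c where c: "v = (\<Sum>b\<in>S'. c b *s b)" by (elim rangeE)
    show ?thesis
    proof (rule finite_subset)
      show "{y\<in>points k. v \<notin> lspan scale y S'} \<subseteq> (\<Union>b\<in>S'. {y\<in>points k. c b \<notin> y})"
      proof
        fix y assume y: "y \<in> {y\<in>points k. v \<notin> lspan scale y S'}"
        have "v \<in> lspan scale y S'" if "\<forall>b\<in>S'. c b \<in> y"
          unfolding lspan_def by (intro CollectI exI[of _ c] conjI c that)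
        then show "y \<in> (\<Union>b\<in>S'. {y\<in>points k. c b \<notin> y})" using y by auto
      qed
      show "finite (\<Union>b\<in>S'. {y\<in>points k. c b \<notin> y})"
        using assms(3) finite_poles[OF assms(1)] by (intro finite_UN_I)
    qed
  qed
  then have "finite (\<Union>v\<in>S. {y\<in>points k. v \<notin> lspan scale y S'})" using assms(2) by (intro finite_UN_I)
  then show ?thesis by (rule finite_subset[rotated]) blast
qed

lemma lspan_generic_eq:
  assumes "curve k" "finite S" "finite S'" "span S = span S'"
  shows "finite {y\<in>points k. lspan scale y S \<noteq> lspan scale y S'}"
proof (rule finite_subset)
  show "{y\<in>points k. lspan scale y S \<noteq> lspan scale y S'} \<subseteq>
     {y\<in>points k. \<not> S \<subseteq> lspan scale y S'} \<union> {y\<in>points k. \<not> S' \<subseteq> lspan scale y S}"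
  proof
    fix y assume y: "y \<in> {y\<in>points k. lspan scale y S \<noteq> lspan scale y S'}"
    then have "closed_ring y" by (auto simp: points_def intro: dvr_closed_ring)
    then have "lspan scale y S = lspan scale y S'" if "S \<subseteq> lspan scale y S'" "S' \<subseteq> lspan scale y S"
      using that by (intro subset_antisym lspan_minimal lspan_rmodule)
    then show "y \<in> {y\<in>points k. \<not> S \<subseteq> lspan scale y S'} \<union> {y\<in>points k. \<not> S' \<subseteq> lspan scale y S}"
      using y by blast
  qed
  show "finite ({y\<in>points k. \<not> S \<subseteq> lspan scale y S'} \<union> {y\<in>points k. \<not> S' \<subseteq> lspan scale y S})"
    using assms span_superset by (intro finite_UnI lspan_generic_inclusion) auto
qed

lemma scale_into_lspan:
  assumes "dvr R" "finite B" "v \<in> span B"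
  shows "\<exists>a\<in>R. a \<noteq> 0 \<and> a *s v \<in> lspan scale R B"
proof -
  note R = closed_ringD[OF dvr_closed_ring[OF assms(1)]]
  have "v \<in> range (\<lambda>c. \<Sum>b\<in>B. c b *s b)" using assms(3) span_finite[OF assms(2)] by auto
  then obtain c where c: "v = (\<Sum>b\<in>B. c b *s b)" by (elim rangeE)
  show ?thesis
  proof (cases "\<exists>b\<in>B. c b \<notin> R")
    case False
    then have "v \<in> lspan scale R B" unfolding c lspan_def by blast
    then show ?thesis using R by (intro bexI[of _ 1]) auto
  next
    case True
    then have "\<exists>b\<in>B. c b \<noteq> 0" using R by metis
    then obtain i where i: "i \<in> B" "c i \<noteq> 0" "\<forall>j\<in>B. c j / c i \<in> R"
      using dvr_minimal_valuation[OF assms(1,2)] by blast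
    have "c i \<notin> R"
    proof
      assume "c i \<in> R"
      then have "c j / c i * c i \<in> R" if "j \<in> B" for j using R(4)[of "c j / c i"] i(3) that by blast
      then show False using True i(2) by auto
    qed
    then have "inverse (c i) \<in> R" using dvr_valuation[OF assms(1)] max_ideal_subset by blast
    moreover have "inverse (c i) *s v = (\<Sum>b\<in>B. (c b / c i) *s b)"
      by (simp add: c scale_sum_right divide_inverse mult.commute)
    then have "inverse (c i) *s v \<in> lspan scale R B" unfolding lspan_def using i(3) by auto
    ultimately show ?thesis using i(2) by (intro bexI[of _ "inverse (c i)"]) auto
  qed
qed

end

text \<open>Spreading out: a basis at one point generates the same modules as \<open>S0\<close> at almost
  all points.\<close>

lemma (in vector_space) locally_freeI:
  assumes "curve k" "finite S0" "finite {x\<in>points k. M x \<noteq> lspan scale x S0}"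
    "\<And>x. x \<in> points k \<Longrightarrow> \<exists>S. finite S \<and> M x = lspan scale x S \<and> span S = span S0"
  shows "locally_free k scale M (\<lambda>_. {0})"
  unfolding locally_free_def
proof (intro ballI)
  fix x assume x: "x \<in> points k"
  then have dx: "dvr x" by (simp add: points_def)
  obtain S where S: "finite S" "M x = lspan scale x S" "span S = span S0" using assms(4)[OF x] by blast
  obtain B where B: "finite B" "independent B" "lspan scale x B = lspan scale x S"
    using finitely_generated_free[OF dx S(1)] by blast
  have spB: "span B = span S0" using B S span_lspan dvr_closed_ring[OF dx] by metis
  define U where "U = {y\<in>points k. M y = lspan scale y B}"
  have xU: "x \<in> U" using x B S by (simp add: U_def)
  have "finite (points k - U)"
  proof (rule finite_subset)
    show "points k - U \<subseteq> {x\<in>points k. M x \<noteq> lspan scale x S0} \<union> {y\<in>points k. lspan scale y S0 \<noteq> lspan scale y B}"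
      by (auto simp: U_def)
    show "finite ({x\<in>points k. M x \<noteq> lspan scale x S0} \<union> {y\<in>points k. lspan scale y S0 \<noteq> lspan scale y B})"
      using assms(1-3) B spB by (intro finite_UnI lspan_generic_eq) auto
  qed
  then have "zopen k U" by (auto simp: zopen_def U_def)
  moreover have "B \<subseteq> (\<Inter>y\<in>U. M y)"
    using lspan_superset[OF dvr_closed_ring B(1)] by (auto simp: U_def points_def)
  moreover have "\<forall>y\<in>U. quot_basis y scale (M y) {0} B"
  proof
    fix y assume "y \<in> U"
    then have "dvr y" "M y = lspan scale y B" by (auto simp: U_def points_def)
    then show "quot_basis y scale (M y) {0} B" using B quot_basis_zero_iff by blast
  qed
  ultimately show "\<exists>U B. zopen k U \<and> x \<in> U \<and> B \<subseteq> (\<Inter>y\<in>U. M y) \<and> (\<forall>y\<in>U. quot_basis y scale (M y) {0} B)"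
    using xU by (intro exI[of _ U] exI[of _ B] conjI)
qed

text \<open>The quotient of a locally free sheaf by the kernel of a linear map \<open>\<rho>\<close> is the
  image of \<open>\<rho>\<close>, a sheaf of finitely generated torsion free modules. A basis of
  the image at one point, lifted to \<open>M\<close>, remains a basis of the quotient at almost
  all points.\<close>

lemma (in vector_space) locally_free_quotientI:
  assumes "curve k" "finite S0" "finite {x\<in>points k. M x \<noteq> lspan scale x S0}"
    "\<And>x. x \<in> points k \<Longrightarrow> \<exists>S. finite S \<and> M x = lspan scale x S \<and> span S = span S0"
    and add: "\<And>u v. u \<in> span S0 \<Longrightarrow> v \<in> span S0 \<Longrightarrow> \<rho> (u + v) = \<rho> u + \<rho> v"
    and scl: "\<And>a v. v \<in> span S0 \<Longrightarrow> \<rho> (a *s v) = a *s \<rho> v"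
  shows "locally_free k scale M (\<lambda>x. {v \<in> M x. \<rho> v = 0})"
  unfolding locally_free_def
proof (intro ballI)
  fix x assume x: "x \<in> points k"
  then have dx: "dvr x" by (simp add: points_def)
  note cx = dvr_closed_ring[OF dx]
  have r0: "\<rho> 0 = 0" using scl[of 0 0] span_zero by simp
  have sum: "\<rho> (\<Sum>i\<in>I. c i *s f i) = (\<Sum>i\<in>I. c i *s \<rho> (f i))"
    if "\<And>i. i \<in> I \<Longrightarrow> f i \<in> span S0" for I :: "'b set" and c f
    using that
  proof (induction I rule: infinite_finite_induct)
    case (insert i I)
    then show ?case by (simp add: add[OF span_scale span_sum] scl span_scale)
  qed (auto simp: r0)
  have img: "\<rho> ` lspan scale y S = lspan scale y (\<rho> ` S)" if S: "finite S" "S \<subseteq> span S0" "closed_ring y" for y S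
  proof
    show "\<rho> ` lspan scale y S \<subseteq> lspan scale y (\<rho> ` S)"
    proof
      fix w assume "w \<in> \<rho> ` lspan scale y S"
      then obtain c where c: "w = \<rho> (\<Sum>b\<in>S. c b *s b)" "\<forall>b\<in>S. c b \<in> y" unfolding lspan_def by auto
      have "w = (\<Sum>b\<in>S. c b *s \<rho> b)" unfolding c(1) using S(2) by (intro sum) auto
      then show "w \<in> lspan scale y (\<rho> ` S)"
        using lspan_superset[OF S(3), of "\<rho> ` S"] S(1) c(2)
        by (simp only:, intro rmodule_sum[OF lspan_rmodule[OF S(3)]] rmoduleD(3)[OF lspan_rmodule[OF S(3)]]) auto
    qed
    have M: "rmodule scale y (lspan scale y S)" by (rule lspan_rmodule[OF S(3)])
    have sp: "lspan scale y S \<subseteq> span S0" using lspan_mono_span S(2) span_minimal[OF _ subspace_span] by blast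
    have "rmodule scale y (\<rho> ` lspan scale y S)"
      unfolding rmodule_def
    proof (intro conjI ballI)
      show "0 \<in> \<rho> ` lspan scale y S" using rmoduleD(1)[OF M] r0 by (metis imageI)
      fix u assume "u \<in> \<rho> ` lspan scale y S"
      then obtain u' where u: "u = \<rho> u'" "u' \<in> lspan scale y S" by blast
      { fix v assume "v \<in> \<rho> ` lspan scale y S"
        then obtain v' where v: "v = \<rho> v'" "v' \<in> lspan scale y S" by blast
        have "u + v = \<rho> (u' + v')" using u v add[of u' v'] subsetD[OF sp u(2)] subsetD[OF sp v(2)] by simp
        then show "u + v \<in> \<rho> ` lspan scale y S" using rmoduleD(2)[OF M u(2) v(2)] by blast }
    next
      fix a v assume a: "a \<in> y" "v \<in> \<rho> ` lspan scale y S"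
      then obtain v' where v: "v = \<rho> v'" "v' \<in> lspan scale y S" by blast
      have "a *s v = \<rho> (a *s v')" using v scl[of v' a] subsetD[OF sp v(2)] by simp
      then show "a *s v \<in> \<rho> ` lspan scale y S" using rmoduleD(3)[OF M a(1) v(2)] by blast
    qed
    then show "lspan scale y (\<rho> ` S) \<subseteq> \<rho> ` lspan scale y S"
      using lspan_superset[OF S(3,1)] by (intro lspan_minimal) auto
  qed
  have spimg: "\<rho> ` span S = span (\<rho> ` S)" if S: "finite S" "S \<subseteq> span S0" for S
  proof -
    have eq: "span T = lspan scale UNIV T" if "finite T" for T
      using span_finite[OF that] unfolding lspan_def by auto
    show ?thesis using img[OF S, of UNIV] S(1) by (simp add: eq closed_ring_def)
  qed
  obtain S where S: "finite S" "M x = lspan scale x S" "span S = span S0" using assms(4)[OF x] by blast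
  have SS: "S \<subseteq> span S0" using S(3) span_superset by blast
  obtain B where B: "finite B" "independent B" "lspan scale x B = lspan scale x (\<rho> ` S)"
    using finitely_generated_free[OF dx, of "\<rho> ` S"] S(1) by auto
  have rM: "\<rho> ` M x = lspan scale x B" using img[OF S(1) SS cx] S(2) B(3) by simp
  have spB: "span B = span (\<rho> ` S0)"
    using B(3) span_lspan[OF cx B(1)] span_lspan[OF cx, of "\<rho> ` S"] S spimg[OF S(1) SS] spimg[OF assms(2) span_superset] by auto
  have "\<exists>v. v \<in> M x \<and> \<rho> v = b" if "b \<in> B" for b
  proof -
    have "b \<in> \<rho> ` M x" using lspan_superset[OF cx B(1)] that unfolding rM by (rule subsetD)
    then show ?thesis by auto
  qed
  then obtain g where g: "\<And>b. b \<in> B \<Longrightarrow> g b \<in> M x" "\<And>b. b \<in> B \<Longrightarrow> \<rho> (g b) = b" by metis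
  have inj: "inj_on g B" using g(2) by (metis inj_onI)
  have gsp: "g ` B \<subseteq> span S0" using g(1) S(2,3) lspan_mono_span[of x S] by blast
  \<comment> \<open>the points where the basis of the image at \<open>x\<close> and its lifts are still good\<close>
  define U where "U = {y\<in>points k. M y \<subseteq> span S0 \<and> rmodule scale y (M y) \<and> \<rho> ` M y = lspan scale y B \<and> g ` B \<subseteq> M y}"
  have Mx: "M x \<subseteq> span S0" "rmodule scale x (M x)" using S lspan_mono_span[of x S] lspan_rmodule[OF cx] by auto
  then have xU: "x \<in> U" using x rM g(1) by (auto simp: U_def)
  have "finite (points k - U)"
  proof (rule finite_subset)
    show "points k - U \<subseteq> {x\<in>points k. M x \<noteq> lspan scale x S0} \<union> {y\<in>points k. lspan scale y (\<rho> ` S0) \<noteq> lspan scale y B}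
      \<union> {y\<in>points k. \<not> g ` B \<subseteq> lspan scale y S0}"
    proof
      fix y assume y: "y \<in> points k - U"
      then have cy: "closed_ring y" using dvr_closed_ring by (auto simp: points_def)
      show "y \<in> {x\<in>points k. M x \<noteq> lspan scale x S0} \<union> {y\<in>points k. lspan scale y (\<rho> ` S0) \<noteq> lspan scale y B}
        \<union> {y\<in>points k. \<not> g ` B \<subseteq> lspan scale y S0}"
        using img[OF assms(2) span_superset cy] lspan_rmodule[OF cy, of S0] lspan_mono_span[of y S0] y
        by (auto simp: U_def)
    qed
    show "finite ({x\<in>points k. M x \<noteq> lspan scale x S0} \<union> {y\<in>points k. lspan scale y (\<rho> ` S0) \<noteq> lspan scale y B}
      \<union> {y\<in>points k. \<not> g ` B \<subseteq> lspan scale y S0})"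
      using assms(1-3) B spB gsp by (intro finite_UnI lspan_generic_eq lspan_generic_inclusion) auto
  qed
  then have "zopen k U" by (auto simp: zopen_def U_def)
  moreover have "g ` B \<subseteq> (\<Inter>y\<in>U. M y)" by (auto simp: U_def)
  moreover have "quot_basis y scale (M y) {v \<in> M y. \<rho> v = 0} (g ` B)" if y: "y \<in> U" for y
  proof -
    have dy: "dvr y" and cy: "closed_ring y" using y dvr_closed_ring by (auto simp: U_def points_def)
    have My: "M y \<subseteq> span S0" "rmodule scale y (M y)" "\<rho> ` M y = lspan scale y B" "g ` B \<subseteq> M y"
      using y by (auto simp: U_def)
    have rs: "\<rho> (\<Sum>b\<in>B. c b *s g b) = (\<Sum>b\<in>B. c b *s b)" for c
      using gsp g(2) by (subst sum) (auto intro: sum.cong)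
    have re: "(\<Sum>b\<in>g ` B. c b *s b) = (\<Sum>b\<in>B. c (g b) *s g b)" for c
      by (simp add: sum.reindex[OF inj])
    have sM: "(\<Sum>b\<in>B. c b *s g b) \<in> M y" if "\<forall>b\<in>B. c b \<in> y" for c
      using that My(4) by (intro rmodule_sum[OF My(2)] rmoduleD(3)[OF My(2)]) auto
    show ?thesis unfolding quot_basis_def
    proof (intro conjI allI impI)
      show "finite (g ` B)" using B by simp
      show "M y = {(\<Sum>b\<in>g ` B. c b *s b) + n | c n. (\<forall>b\<in>g ` B. c b \<in> y) \<and> n \<in> {v \<in> M y. \<rho> v = 0}}" (is "_ = ?X")
      proof
        show "?X \<subseteq> M y"
          using sM rmoduleD(2)[OF My(2)] unfolding re by auto
        show "M y \<subseteq> ?X"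
        proof
          fix w assume w: "w \<in> M y"
          then have "\<rho> w \<in> lspan scale y B" using My(3) by blast
          then obtain c where c: "\<rho> w = (\<Sum>b\<in>B. c b *s b)" "\<forall>b\<in>B. c b \<in> y"
            unfolding lspan_def by blast
          define n where "n = w - (\<Sum>b\<in>B. c b *s g b)"
          have n: "n \<in> M y" unfolding n_def using w sM[OF c(2)] by (intro rmodule_uminus[OF My(2) cy])
          have "\<rho> w = \<rho> ((\<Sum>b\<in>B. c b *s g b) + n)" by (simp add: n_def)
          also have "\<dots> = \<rho> w + \<rho> n" using add[of "\<Sum>b\<in>B. c b *s g b" n] sM[OF c(2)] n My(1) rs c(1) by auto
          finally have "\<rho> n = 0" by simp
          moreover have "w = (\<Sum>b\<in>g ` B. c (the_inv_into B g b) *s b) + n"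
            unfolding re n_def by (simp add: the_inv_into_f_f[OF inj])
          ultimately show "w \<in> ?X" using n c(2) the_inv_into_f_f[OF inj]
            by (intro CollectI exI[of _ "\<lambda>b. c (the_inv_into B g b)"] exI[of _ n]) auto
        qed
      qed
      fix c assume c: "(\<forall>b\<in>g ` B. c b \<in> y) \<and> (\<Sum>b\<in>g ` B. c b *s b) \<in> {v \<in> M y. \<rho> v = 0}"
      then have "(\<Sum>b\<in>B. c (g b) *s b) = 0" using rs[of "\<lambda>b. c (g b)"] unfolding re by auto
      then show "\<forall>b\<in>g ` B. c b = 0" using independentD[OF B(2,1) order.refl, of "\<lambda>b. c (g b)"] by auto
    qed
  qed
  ultimately show "\<exists>U B. zopen k U \<and> x \<in> U \<and> B \<subseteq> (\<Inter>y\<in>U. M y) \<and> (\<forall>y\<in>U. quot_basis y scale (M y) {v \<in> M y. \<rho> v = 0} B)"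
    using xU by (intro exI[of _ U] exI[of _ "g ` B"] conjI ballI)
qed

section \<open>Vector bundles\<close>

lemma vector_bundle_trivialization:
  assumes "vector_bundle k E" "x \<in> points k"
  shows "\<exists>U B. zopen k U \<and> x \<in> U \<and> (\<forall>y\<in>U. quot_basis y (scal E) (stalk E y) {0} B)"
proof -
  have "locally_free k (scal E) (stalk E) (\<lambda>_. {0})" using assms(1) by (simp add: vector_bundle_def)
  from this[unfolded locally_free_def, rule_format, OF assms(2)] show ?thesis by blast
qed

text \<open>A basis over a neighbourhood of any point will do; without points, any finite set that spans.\<close>

lemma vector_bundle_generic_basis:
  assumes "vector_bundle k E"
  shows "\<exists>S0. finite S0 \<and> gen E = Modules.module.span (scal E) S0 \<and> finite {x\<in>points k. stalk E x \<noteq> lspan (scal E) x S0}"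
proof -
  interpret vector_space "scal E" using assms by (simp add: vector_bundle_def)
  show ?thesis
  proof (cases "points k = {}")
    case True
    have "\<exists>B. finite B \<and> gen E = span B" using assms by (simp add: vector_bundle_def)
    then show ?thesis using True by simp
  next
    case False
    then obtain x where x: "x \<in> points k" by blast
    obtain U B where U: "zopen k U" "x \<in> U" "\<And>y. y \<in> U \<Longrightarrow> quot_basis y (scal E) (stalk E y) {0} B"
      using vector_bundle_trivialization[OF assms x] by blast
    have Up: "U \<subseteq> points k" "finite (points k - U)" using U by (auto simp: zopen_def)
    have B: "finite B" "stalk E y = lspan (scal E) y B" if "y \<in> U" for y
      using U(3)[OF that] Up that quot_basis_zero_iff[of y] by (auto simp: points_def)
    have cx: "closed_ring x" using x dvr_closed_ring by (auto simp: points_def)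
    have "gen E = span (stalk E x)" using assms x by (simp add: vector_bundle_def)
    also have "\<dots> = span B" using span_lspan[OF cx B(1)[OF U(2)]] unfolding B(2)[OF U(2)] .
    finally have "gen E = span B" .
    moreover have "finite {x\<in>points k. stalk E x \<noteq> lspan (scal E) x B}"
      by (rule finite_subset[OF _ Up(2)]) (use B in auto)
    ultimately show ?thesis using B(1)[OF U(2)] by blast
  qed
qed

lemma vector_bundle_stalk_basis:
  assumes "vector_bundle k E" "x \<in> points k"
  shows "\<exists>B. finite B \<and> \<not> Modules.module.dependent (scal E) B \<and> stalk E x = lspan (scal E) x B
     \<and> Modules.module.span (scal E) B = gen E"
proof -
  interpret vector_space "scal E" using assms by (simp add: vector_bundle_def)
  have dx: "dvr x" using assms by (simp add: points_def)
  obtain U B where U: "x \<in> U" "\<And>y. y \<in> U \<Longrightarrow> quot_basis y (scal E) (stalk E y) {0} B"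
    using vector_bundle_trivialization[OF assms] by blast
  have B: "finite B" "stalk E x = lspan (scal E) x B" "independent B"
    using U(2)[OF U(1)] quot_basis_zero_iff[OF dx] by auto
  have "gen E = span (stalk E x)" using assms by (simp add: vector_bundle_def)
  also have "\<dots> = span B" using span_lspan[OF dvr_closed_ring[OF dx] B(1)] unfolding B(2) .
  finally show ?thesis using B by blast
qed

lemma vector_bundle_stalk_rmodule:
  assumes "vector_bundle k E" "x \<in> points k"
  shows "rmodule (scal E) x (stalk E x)" "stalk E x \<subseteq> gen E"
proof -
  interpret vector_space "scal E" using assms by (simp add: vector_bundle_def)
  have dx: "dvr x" using assms by (simp add: points_def)
  obtain B where "stalk E x = lspan (scal E) x B" "span B = gen E"
    using vector_bundle_stalk_basis[OF assms] by blast
  then show "rmodule (scal E) x (stalk E x)" "stalk E x \<subseteq> gen E"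
    using lspan_rmodule[OF dvr_closed_ring[OF dx], of B] lspan_mono_span[of x B] by simp_all
qed

lemma vector_bundle_gen_subspace:
  assumes "vector_bundle k E"
  shows "Modules.module.subspace (scal E) (gen E)"
proof -
  interpret vector_space "scal E" using assms by (simp add: vector_bundle_def)
  obtain S0 where "gen E = span S0" using vector_bundle_generic_basis[OF assms] by blast
  then show ?thesis by (simp only: subspace_span)
qed

lemma vector_bundle_generically_regular:
  assumes "curve k" "vector_bundle k E" "v \<in> gen E"
  shows "finite {x\<in>points k. v \<notin> stalk E x}"
proof -
  interpret vector_space "scal E" using assms by (simp add: vector_bundle_def)
  obtain S0 where S0: "finite S0" "gen E = span S0" "finite {x\<in>points k. stalk E x \<noteq> lspan (scal E) x S0}"
    using vector_bundle_generic_basis[OF assms(2)] by blast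
  have "finite {y\<in>points k. \<not> {v} \<subseteq> lspan (scal E) y S0}"
    using assms S0 by (intro lspan_generic_inclusion) auto
  then have "finite ({x\<in>points k. stalk E x \<noteq> lspan (scal E) x S0} \<union> {y\<in>points k. \<not> {v} \<subseteq> lspan (scal E) y S0})"
    using S0 by blast
  moreover have "{x\<in>points k. v \<notin> stalk E x} \<subseteq> {x\<in>points k. stalk E x \<noteq> lspan (scal E) x S0} \<union> {y\<in>points k. \<not> {v} \<subseteq> lspan (scal E) y S0}"
  proof
    fix y assume "y \<in> {x\<in>points k. v \<notin> stalk E x}"
    then show "y \<in> {x\<in>points k. stalk E x \<noteq> lspan (scal E) x S0} \<union> {y\<in>points k. \<not> {v} \<subseteq> lspan (scal E) y S0}"
      by (cases "stalk E y = lspan (scal E) y S0") simp_all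
  qed
  ultimately show ?thesis by (rule finite_subset[rotated])
qed

lemma vector_bundle_denominator:
  assumes "vector_bundle k E" "x \<in> points k" "v \<in> gen E"
  shows "\<exists>a\<in>x. a \<noteq> 0 \<and> scal E a v \<in> stalk E x"
proof -
  interpret vector_space "scal E" using assms by (simp add: vector_bundle_def)
  obtain B where B: "finite B" "stalk E x = lspan (scal E) x B" "span B = gen E"
    using vector_bundle_stalk_basis[OF assms(1,2)] by blast
  have dx: "dvr x" using assms(2) by (simp add: points_def)
  have "v \<in> span B" using assms(3) B(3) by simp
  from scale_into_lspan[OF dx B(1) this] show ?thesis unfolding B(2) .
qed

section \<open>Quotient modules, spans and lengths\<close>

lemma ring_on_simps [simp]:
  "carrier (ring_on S) = S" "\<one>\<^bsub>ring_on S\<^esub> = 1" "\<zero>\<^bsub>ring_on S\<^esub> = 0"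
  "a \<otimes>\<^bsub>ring_on S\<^esub> b = a * b" "a \<oplus>\<^bsub>ring_on S\<^esub> b = a + b"
  by (simp_all add: ring_on_def)

lemma quot_simps [simp]:
  "carrier (quot s M N) = (\<lambda>v. v +o N) ` M" "\<zero>\<^bsub>quot s M N\<^esub> = N"
  "A \<oplus>\<^bsub>quot s M N\<^esub> B = A + B" "a \<odot>\<^bsub>quot s M N\<^esub> A = s a ` A + N"
  by (simp_all add: quot_def)

context vector_space
begin

lemma coset_eq_iff:
  assumes "rmodule scale R N" "closed_ring R"
  shows "v +o N = w +o N \<longleftrightarrow> v - w \<in> N"
proof
  note N = rmoduleD[OF assms(1)] and N' = rmodule_uminus[OF assms]
  assume "v +o N = w +o N"
  moreover have "v \<in> v +o N" using N(1) by (auto simp: elt_set_plus_def)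
  ultimately have "v \<in> w +o N" by simp
  then show "v - w \<in> N" by (auto simp: elt_set_plus_def)
next
  note N = rmoduleD[OF assms(1)] and N' = rmodule_uminus[OF assms]
  assume d: "v - w \<in> N"
  have "v +o N \<subseteq> w +o N" if "v - w \<in> N" for v w
  proof
    fix u assume "u \<in> v +o N"
    then obtain n where n: "u = v + n" "n \<in> N" by (auto simp: elt_set_plus_def)
    have "u = w + ((v - w) + n)" using n by simp
    then show "u \<in> w +o N" using N(2)[OF that n(2)] unfolding elt_set_plus_def by blast
  qed
  moreover have "w - v \<in> N" using N'(1)[OF d] by simp
  ultimately show "v +o N = w +o N" using d by blast
qed

lemma coset_zero_iff:
  assumes "rmodule scale R N" "closed_ring R"
  shows "v +o N = N \<longleftrightarrow> v \<in> N"
  using coset_eq_iff[OF assms, of v 0] by simp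

lemma coset_self: "rmodule scale R N \<Longrightarrow> v \<in> v +o N"
  by (force simp: elt_set_plus_def rmodule_def)

lemma coset_add:
  assumes "rmodule scale R N"
  shows "(v +o N) + (w +o N) = (v + w) +o N"
proof
  note N = rmoduleD[OF assms(1)]
  show "(v +o N) + (w +o N) \<subseteq> (v + w) +o N"
  proof
    fix u assume "u \<in> (v +o N) + (w +o N)"
    then obtain n n' where "u = (v + n) + (w + n')" "n \<in> N" "n' \<in> N" by (auto simp: elt_set_plus_def set_plus_def)
    then show "u \<in> (v + w) +o N" using N(2)[of n n'] by (auto simp: elt_set_plus_def algebra_simps intro!: bexI[of _ "n + n'"])
  qed
  show "(v + w) +o N \<subseteq> (v +o N) + (w +o N)"
  proof
    fix u assume "u \<in> (v + w) +o N"
    then obtain n where n: "u = (v + w) + n" "n \<in> N" by (auto simp: elt_set_plus_def)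
    have "u = (v + n) + (w + 0)" using n by (simp add: algebra_simps)
    moreover have "v + n \<in> v +o N" "w + 0 \<in> w +o N" using n N(1) by (auto simp: elt_set_plus_def)
    ultimately show "u \<in> (v +o N) + (w +o N)" unfolding set_plus_def by blast
  qed
qed

lemma coset_smult:
  assumes "rmodule scale R N" "a \<in> R"
  shows "scale a ` (v +o N) + N = (a *s v) +o N"
proof
  note N = rmoduleD[OF assms(1)]
  show "scale a ` (v +o N) + N \<subseteq> (a *s v) +o N"
  proof
    fix u assume "u \<in> scale a ` (v +o N) + N"
    then obtain n n' where "u = a *s (v + n) + n'" "n \<in> N" "n' \<in> N" by (auto simp: elt_set_plus_def set_plus_def)
    then have "u = a *s v + (a *s n + n')" "a *s n + n' \<in> N"
      using N assms(2) by (auto simp: scale_right_distrib add.assoc)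
    then show "u \<in> (a *s v) +o N" by (auto simp: elt_set_plus_def)
  qed
  show "(a *s v) +o N \<subseteq> scale a ` (v +o N) + N"
  proof
    fix u assume "u \<in> (a *s v) +o N"
    then obtain n where n: "u = a *s v + n" "n \<in> N" by (auto simp: elt_set_plus_def)
    moreover have "a *s v \<in> scale a ` (v +o N)" using coset_self[OF assms(1)] by blast
    ultimately show "u \<in> scale a ` (v +o N) + N" unfolding set_plus_def by blast
  qed
qed

lemma module_quot:
  assumes "closed_ring R" "rmodule scale R M" "rmodule scale R N"
  shows "Module.module (ring_on R) (quot scale M N)"
proof -
  note R = closed_ringD[OF assms(1)]
  note M = rmoduleD[OF assms(2)] and N = rmoduleD[OF assms(3)]
  note simps = coset_add[OF assms(3)] coset_smult[OF assms(3)]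
  have N0: "N = 0 +o N" by simp
  have ag: "abelian_group (quot scale M N)"
  proof (rule abelian_groupI)
    show "\<zero>\<^bsub>quot scale M N\<^esub> \<in> carrier (quot scale M N)"
      using M(1) N0 by (metis quot_simps(1,2) imageI)
    fix A assume "A \<in> carrier (quot scale M N)"
    then obtain v where v: "v \<in> M" "A = v +o N" by auto
    have "0 +o N + (v +o N) = v +o N" by (simp only: simps add_0_left)
    then show "\<zero>\<^bsub>quot scale M N\<^esub> \<oplus>\<^bsub>quot scale M N\<^esub> A = A" using v by simp
    have "- v \<in> M" using rmodule_uminus[OF assms(2,1)] v by blast
    moreover have "(- v +o N) + A = N" unfolding v simps by simp
    ultimately show "\<exists>B\<in>carrier (quot scale M N). B \<oplus>\<^bsub>quot scale M N\<^esub> A = \<zero>\<^bsub>quot scale M N\<^esub>" by auto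
  qed (use M in \<open>auto simp: simps add_ac\<close>)
  have E: "\<exists>v\<in>M. A = v +o N" if "A \<in> carrier (quot scale M N)" for A using that by auto
  have C: "v +o N \<in> carrier (quot scale M N)" if "v \<in> M" for v using that by auto
  have S: "a \<odot>\<^bsub>quot scale M N\<^esub> (v +o N) = (a *s v) +o N" if "a \<in> R" for a v
    using coset_smult[OF assms(3) that] by simp
  have A: "(v +o N) \<oplus>\<^bsub>quot scale M N\<^esub> (w +o N) = (v + w) +o N" for v w
    using coset_add[OF assms(3)] by simp
  show ?thesis
    by (rule Module.moduleI[OF cring_ring_on[OF assms(1)] ag])
      (use M R in \<open>auto dest!: E simp: S A scale_left_distrib scale_right_distrib intro!: C simp del: quot_simps\<close>)
qed

lemma submodule_quotI:
  assumes "closed_ring R" "rmodule scale R M" "rmodule scale R N" "rmodule scale R P" "P \<subseteq> M"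
  shows "submodule ((\<lambda>v. v +o N) ` P) (ring_on R) (quot scale M N)"
proof -
  note R = closed_ringD[OF assms(1)]
  note P = rmoduleD[OF assms(4)]
  note simps = coset_add[OF assms(3)] coset_smult[OF assms(3)]
  interpret Q: Module.module "ring_on R" "quot scale M N" by (rule module_quot[OF assms(1-3)])
  show ?thesis
  proof (rule Q.submoduleI)
    show "(\<lambda>v. v +o N) ` P \<subseteq> carrier (quot scale M N)" using assms(5) by auto
    have "0 +o N \<in> (\<lambda>v. v +o N) ` P" using P(1) by (rule imageI)
    then show "\<zero>\<^bsub>quot scale M N\<^esub> \<in> (\<lambda>v. v +o N) ` P" by simp
    fix A assume "A \<in> (\<lambda>v. v +o N) ` P"
    then obtain v where v: "v \<in> P" "A = v +o N" by auto
    have vm: "- v \<in> P" using rmodule_uminus[OF assms(4,1)] v by blast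
    have "(- v +o N) \<oplus>\<^bsub>quot scale M N\<^esub> A = \<zero>\<^bsub>quot scale M N\<^esub>" unfolding v(2) quot_simps simps by simp
    then have "\<ominus>\<^bsub>quot scale M N\<^esub> A = - v +o N"
      using v vm assms(5) by (intro Q.minus_equality) auto
    then show "\<ominus>\<^bsub>quot scale M N\<^esub> A \<in> (\<lambda>v. v +o N) ` P" using vm by simp
  qed (use P in \<open>auto simp: simps\<close>)
qed

end

lemma submodule_closed:
  assumes "submodule H R M"
  shows "\<zero>\<^bsub>M\<^esub> \<in> H" "u \<in> H \<Longrightarrow> v \<in> H \<Longrightarrow> u \<oplus>\<^bsub>M\<^esub> v \<in> H" "a \<in> carrier R \<Longrightarrow> v \<in> H \<Longrightarrow> a \<odot>\<^bsub>M\<^esub> v \<in> H"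
  using subgroup.one_closed[OF submodule.axioms(1)[OF assms]] subgroup.m_closed[OF submodule.axioms(1)[OF assms]]
    submodule.smult_closed[OF assms] by auto

lemma mod_span_memI: "(\<And>H. submodule H R M \<Longrightarrow> S \<subseteq> H \<Longrightarrow> v \<in> H) \<Longrightarrow> v \<in> mod_span R M S"
  by (auto simp: mod_span_def hull_def)

lemma mod_span_memD: "v \<in> mod_span R M S \<Longrightarrow> submodule H R M \<Longrightarrow> S \<subseteq> H \<Longrightarrow> v \<in> H"
  by (auto simp: mod_span_def hull_def)

lemma mod_span_union_absorb:
  assumes "A \<subseteq> mod_span R M S"
  shows "mod_span R M (A \<union> S) \<subseteq> mod_span R M S"
proof (intro subsetI mod_span_memI)
  fix v H assume v: "v \<in> mod_span R M (A \<union> S)" and H: "submodule H R M" "S \<subseteq> H"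
  have "A \<subseteq> H" using assms mod_span_memD[OF _ H] by blast
  then show "v \<in> H" using mod_span_memD[OF v H(1)] H(2) by blast
qed

text \<open>In a subfamily of least cardinality whose span contains \<open>v\<close>, no member can be
  dropped; so no member repeats another one or lies in the span of the others.\<close>

lemma independent_subfamily_exists:
  assumes "finite T0" "v \<in> mod_span R M (\<Union>(\<psi> ` T0))"
  shows "\<exists>T\<subseteq>T0. v \<in> mod_span R M (\<Union>(\<psi> ` T)) \<and> inj_on \<psi> T \<and> independent_points R M (\<psi> ` T)"
proof -
  define good where "good T \<longleftrightarrow> T \<subseteq> T0 \<and> v \<in> mod_span R M (\<Union>(\<psi> ` T))" for T
  have "good T0" using assms by (simp add: good_def)
  define T where "T = arg_min card good"
  have T: "good T" "\<And>T'. good T' \<Longrightarrow> card T \<le> card T'"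
    using arg_min_natI[of good T0 card] arg_min_nat_le[of good _ card] \<open>good T0\<close> unfolding T_def by auto
  have finT: "finite T" using T(1) assms(1) finite_subset by (auto simp: good_def)
  have min: "\<not> good T'" if "T' \<subset> T" for T'
    using T(2)[of T'] psubset_card_mono[OF finT that] by auto
  have "inj_on \<psi> T"
  proof (rule inj_onI, rule ccontr)
    fix P Q assume PQ: "P \<in> T" "Q \<in> T" "\<psi> P = \<psi> Q" "P \<noteq> Q"
    then have "\<psi> ` (T - {P}) = \<psi> ` T" by (auto simp: image_iff)
    then have "good (T - {P})" using T(1) by (auto simp: good_def)
    then show False using min[of "T - {P}"] PQ(1) by blast
  qed
  moreover have "independent_points R M (\<psi> ` T)"
    unfolding independent_points_def
  proof (intro ballI notI)
    fix L assume L: "L \<in> \<psi> ` T" "L \<subseteq> mod_span R M (\<Union>(\<psi> ` T - {L}))"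
    define T' where "T' = {P\<in>T. \<psi> P \<noteq> L}"
    have im: "\<psi> ` T - {L} = \<psi> ` T'" by (auto simp: T'_def)
    have "\<Union>(\<psi> ` T) = L \<union> \<Union>(\<psi> ` T')" using L(1) im by blast
    then have "v \<in> mod_span R M (\<Union>(\<psi> ` T'))"
      using mod_span_union_absorb[OF L(2)] T(1) unfolding im good_def by auto
    then have "good T'" using T(1) by (auto simp: good_def T'_def)
    moreover have "T' \<subset> T" using L(1) by (auto simp: T'_def)
    ultimately show False using min by blast
  qed
  ultimately show ?thesis using T(1) by (auto simp: good_def)
qed

text \<open>Submodules are vector spaces over \<open>k\<close>, so the cardinality grows at least by the
  factor \<open>card k\<close> in every step of a strict chain.\<close>

lemma mod_length_le_card_power:
  assumes mod: "Module.module (ring_on R) M" and k: "subfield k KR" "k \<subseteq> R" "finite k"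
    and H: "finite H" "card H \<le> card k ^ n"
  shows "mod_length (ring_on R) M H \<le> enat n"
  unfolding mod_length_def
proof (rule Sup_least, clarify)
  interpret Module.module "ring_on R" M by (rule mod)
  fix m :: nat and C :: "nat \<Rightarrow> _ set"
  assume C: "\<forall>i\<le>m. submodule (C i) (ring_on R) M \<and> C i \<subseteq> H" and strict: "\<forall>i<m. C i \<subset> C (Suc i)"
  note k' = closed_ringD[OF subfield_closed_ring(1)[OF k(1)]] subfield_closed_ring(2)[OF k(1)]
  have finC: "finite (C i)" if "i \<le> m" for i using C H(1) that finite_subset by blast
  \<comment> \<open>the elements \<open>a z + c\<close> with \<open>a\<close> in \<open>k\<close> and \<open>c\<close> in \<open>C i\<close> are distinct, for one new element \<open>z\<close>\<close>
  have step: "card k * card (C i) \<le> card (C (Suc i))" if i: "i < m" for i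
  proof -
    obtain z where z: "z \<in> C (Suc i)" "z \<notin> C i" using strict i by blast
    have sub: "submodule (C i) (ring_on R) M" "submodule (C (Suc i)) (ring_on R) M" using C i by auto
    have carr: "C i \<subseteq> carrier M" "C (Suc i) \<subseteq> carrier M" using submoduleE(1) sub by auto
    have inj: "inj_on (\<lambda>(a, c). a \<odot>\<^bsub>M\<^esub> z \<oplus>\<^bsub>M\<^esub> c) (k \<times> C i)"
    proof (rule inj_onI, clarify)
      fix a c a' c' assume ac: "a \<in> k" "c \<in> C i" "a' \<in> k" "c' \<in> C i"
        and eq: "a \<odot>\<^bsub>M\<^esub> z \<oplus>\<^bsub>M\<^esub> c = a' \<odot>\<^bsub>M\<^esub> z \<oplus>\<^bsub>M\<^esub> c'"
      have zc: "z \<in> carrier M" and cc: "c \<in> carrier M" "c' \<in> carrier M" using z(1) ac carr by auto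
      have aR: "a \<in> R" "a' \<in> R" "a - a' \<in> k" "a - a' \<in> R" "inverse (a - a') \<in> R"
        using ac k(2) k' by (auto simp: subset_iff)
      have "a = a'"
      proof (rule ccontr)
        assume "a \<noteq> a'"
        have az: "a \<odot>\<^bsub>M\<^esub> z = (a - a') \<odot>\<^bsub>M\<^esub> z \<oplus>\<^bsub>M\<^esub> a' \<odot>\<^bsub>M\<^esub> z"
          using smult_l_distr[of "a - a'" a' z] aR zc by simp
        have mem: "(a - a') \<odot>\<^bsub>M\<^esub> z \<in> carrier M" "a' \<odot>\<^bsub>M\<^esub> z \<in> carrier M" using aR zc by auto
        have "((a - a') \<odot>\<^bsub>M\<^esub> z \<oplus>\<^bsub>M\<^esub> c) \<oplus>\<^bsub>M\<^esub> a' \<odot>\<^bsub>M\<^esub> z = c' \<oplus>\<^bsub>M\<^esub> a' \<odot>\<^bsub>M\<^esub> z"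
          using eq unfolding az using mem cc by (simp add: M.a_ac)
        then have "(a - a') \<odot>\<^bsub>M\<^esub> z \<oplus>\<^bsub>M\<^esub> c = c'"
          using mem cc by (simp add: M.add.right_cancel)
        then have "(a - a') \<odot>\<^bsub>M\<^esub> z = c' \<oplus>\<^bsub>M\<^esub> (\<ominus>\<^bsub>M\<^esub> c)"
          using mem cc M.add.inv_solve_right by metis
        then have "(a - a') \<odot>\<^bsub>M\<^esub> z \<in> C i"
          using submoduleE(3,5)[OF sub(1)] ac by auto
        then have "inverse (a - a') \<odot>\<^bsub>M\<^esub> ((a - a') \<odot>\<^bsub>M\<^esub> z) \<in> C i"
          using submoduleE(4)[OF sub(1)] aR by auto
        moreover have "inverse (a - a') \<odot>\<^bsub>M\<^esub> ((a - a') \<odot>\<^bsub>M\<^esub> z) = z"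
          using smult_assoc1[of "inverse (a - a')" "a - a'" z] smult_one[OF zc] aR zc \<open>a \<noteq> a'\<close> by simp
        ultimately show False using z(2) by simp
      qed
      moreover have "c = c'"
        using eq \<open>a = a'\<close> cc aR zc M.r_neg1[of "a \<odot>\<^bsub>M\<^esub> z" c] M.r_neg1[of "a \<odot>\<^bsub>M\<^esub> z" c'] by simp
      ultimately show "a = a' \<and> c = c'" by simp
    qed
    have "(\<lambda>(a, c). a \<odot>\<^bsub>M\<^esub> z \<oplus>\<^bsub>M\<^esub> c) ` (k \<times> C i) \<subseteq> C (Suc i)"
      using submoduleE(4,5)[OF sub(2)] z(1) k(2) strict i by fastforce
    from card_inj_on_le[OF inj this finC] i show ?thesis by (simp add: card_cartesian_product)
  qed
  have pow: "card k ^ i \<le> card (C i)" if "i \<le> m" for i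
    using that
  proof (induction i)
    case 0
    have "\<zero>\<^bsub>M\<^esub> \<in> C 0" using submodule_closed(1) C by blast
    then show ?case using finC[of 0] by (simp add: card_gt_0_iff Suc_le_eq) blast
  next
    case (Suc i)
    then have "card k * card k ^ i \<le> card k * card (C i)" by (intro mult_le_mono2) simp
    also have "\<dots> \<le> card (C (Suc i))" using step[of i] Suc by simp
    finally show ?case by simp
  qed
  have "card k ^ m \<le> card H" using pow[of m] C H(1) card_mono[of H "C m"] by auto
  then have "card k ^ m \<le> card k ^ n" using H(2) by simp
  moreover have "card {0::'a, 1} \<le> card k" using k' k(3) by (intro card_mono) auto
  then have "card k > 1" by simp
  ultimately show "enat m \<le> enat n" using power_le_imp_le_exp[of "card k" m n] by simp
qed

section \<open>Principal parts and first cohomology\<close>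

text \<open>The properties of a vector bundle on which the description of principal parts and of the first
  cohomology depends. The bundle of homomorphisms inherits them directly from its two arguments,
  without a choice of local bases for it.\<close>

definition regular_sheaf :: "'k::field set \<Rightarrow> ('k, 'v::ab_group_add) vbundle \<Rightarrow> bool" where
  "regular_sheaf k V \<longleftrightarrow> vector_space (scal V) \<and> rmodule (scal V) UNIV (gen V) \<and>
     (\<forall>x\<in>points k. rmodule (scal V) x (stalk V x) \<and> stalk V x \<subseteq> gen V) \<and>
     (\<forall>v\<in>gen V. finite {x\<in>points k. v \<notin> stalk V x})"

lemma regular_sheafD:
  assumes "regular_sheaf k V"
  shows "vector_space (scal V)" "rmodule (scal V) UNIV (gen V)"
    "x \<in> points k \<Longrightarrow> rmodule (scal V) x (stalk V x)" "x \<in> points k \<Longrightarrow> stalk V x \<subseteq> gen V"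
    "v \<in> gen V \<Longrightarrow> finite {x\<in>points k. v \<notin> stalk V x}"
  using assms by (simp_all add: regular_sheaf_def)

lemma rmodule_mono: "rmodule s R M \<Longrightarrow> R' \<subseteq> R \<Longrightarrow> rmodule s R' M"
  by (auto simp: rmodule_def)

lemma vector_bundle_vector_space: "vector_bundle k E \<Longrightarrow> vector_space (scal E)"
  by (simp add: vector_bundle_def)

lemma vector_bundle_gen_rmodule:
  assumes "vector_bundle k E"
  shows "rmodule (scal E) R (gen E)"
proof -
  interpret vector_space "scal E" by (rule vector_bundle_vector_space[OF assms])
  show ?thesis using vector_bundle_gen_subspace[OF assms]
    unfolding rmodule_def by (auto intro: subspace_0 subspace_add subspace_scale)
qed

lemma points_closed_ring: "x \<in> points k \<Longrightarrow> closed_ring x"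
  by (simp add: points_def dvr_closed_ring)

lemma vector_space_pointwise: "vector_space s \<Longrightarrow> vector_space (\<lambda>a r x. s a (r x))"
proof -
  assume "vector_space s"
  then interpret vector_space s .
  show ?thesis by unfold_locales (auto simp: fun_eq_iff scale_right_distrib scale_left_distrib)
qed

lemma zopen_Int: "zopen k U \<Longrightarrow> zopen k U' \<Longrightarrow> x \<in> U \<Longrightarrow> x \<in> U' \<Longrightarrow> zopen k (U \<inter> U')"
  by (auto simp: zopen_def Diff_Int)

text \<open>Near \<open>x\<close> the family agrees with the constant family \<open>r x\<close>, because
  \<open>r\<close> and the section \<open>r x\<close> are both regular at almost all points.\<close>

lemma prin_repsI_finite:
  assumes V: "regular_sheaf k V"
    and r: "\<And>x. x \<in> points k \<Longrightarrow> r x \<in> gen V" "\<And>x. x \<notin> points k \<Longrightarrow> r x = 0"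
    and fin: "finite {x\<in>points k. r x \<notin> stalk V x}"
  shows "r \<in> prin_reps k V"
  unfolding prin_reps_def
proof (intro CollectI conjI ballI allI impI)
  interpret vector_space "scal V" by (rule regular_sheafD(1)[OF V])
  fix x assume x: "x \<in> points k"
  define U where "U = insert x {y\<in>points k. r y \<in> stalk V y \<and> r x \<in> stalk V y}"
  have "points k - U \<subseteq> {x\<in>points k. r x \<notin> stalk V x} \<union> {y\<in>points k. r x \<notin> stalk V y}"
    unfolding U_def by blast
  then have "finite (points k - U)"
    by (rule finite_subset) (rule finite_UnI[OF fin regular_sheafD(5)[OF V r(1)[OF x]]])
  moreover have "U \<subseteq> points k" using x unfolding U_def by blast
  ultimately have "zopen k U" by (simp add: zopen_def)
  moreover have "r y - r x \<in> stalk V y" if "y \<in> U" for y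
  proof (cases "y = x")
    case True
    then show ?thesis using rmoduleD(1)[OF regular_sheafD(3)[OF V x]] by simp
  next
    case False
    then have y: "y \<in> points k" "r y \<in> stalk V y" "r x \<in> stalk V y" using that by (simp_all add: U_def)
    then show ?thesis by (intro rmodule_uminus(2)[OF regular_sheafD(3)[OF V y(1)] points_closed_ring[OF y(1)]])
  qed
  ultimately show "\<exists>U. \<exists>v\<in>gen V. zopen k U \<and> x \<in> U \<and> (\<forall>y\<in>U. r y - v \<in> stalk V y)"
    by (intro exI[of _ U] bexI[of _ "r x"] conjI ballI r(1)[OF x]) (simp_all add: U_def)
qed (use r in simp_all)

lemma subfield_points_subset: "x \<in> points k \<Longrightarrow> k \<subseteq> x"
  by (simp add: points_def)

lemma prin_repsD:
  assumes "r \<in> prin_reps k V"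
  shows "x \<in> points k \<Longrightarrow> r x \<in> gen V" "x \<notin> points k \<Longrightarrow> r x = 0"
    "x \<in> points k \<Longrightarrow> \<exists>U. \<exists>v\<in>gen V. zopen k U \<and> x \<in> U \<and> (\<forall>y\<in>U. r y - v \<in> stalk V y)"
  using assms unfolding prin_reps_def by simp_all

lemma prin_reps_rmodule:
  assumes V: "regular_sheaf k V" and k: "closed_ring k"
  shows "rmodule (\<lambda>a r x. scal V a (r x)) k (prin_reps k V)"
proof -
  interpret vector_space "scal V" by (rule regular_sheafD(1)[OF V])
  note g = rmoduleD[OF regular_sheafD(2)[OF V]]
  note st = rmoduleD[OF regular_sheafD(3)[OF V]]
  show ?thesis unfolding rmodule_def
  proof (intro conjI ballI)
    have "{x\<in>points k. (0 :: 'a set \<Rightarrow> 'b) x \<notin> stalk V x} = {}" using st(1) by simp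
    then have "finite {x\<in>points k. (0 :: 'a set \<Rightarrow> 'b) x \<notin> stalk V x}" by (simp only: finite.emptyI)
    then show "0 \<in> prin_reps k V" using g(1) by (intro prin_repsI_finite[OF V]) simp_all
  next
    fix r r' assume r: "r \<in> prin_reps k V" and r': "r' \<in> prin_reps k V"
    show "r + r' \<in> prin_reps k V"
      unfolding prin_reps_def
    proof (intro CollectI conjI ballI allI impI)
      fix x assume x: "x \<in> points k"
      obtain U v where U: "v \<in> gen V" "zopen k U" "x \<in> U" "\<forall>y\<in>U. r y - v \<in> stalk V y"
        using prin_repsD(3)[OF r x] by blast
      obtain U' v' where U': "v' \<in> gen V" "zopen k U'" "x \<in> U'" "\<forall>y\<in>U'. r' y - v' \<in> stalk V y"
        using prin_repsD(3)[OF r' x] by blast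
      have "(r + r') y - (v + v') \<in> stalk V y" if "y \<in> U \<inter> U'" for y
      proof -
        have y: "y \<in> points k" using U(2) that by (auto simp: zopen_def)
        have "(r y - v) + (r' y - v') \<in> stalk V y" using U(4) U'(4) that by (intro st(2)[OF y]) auto
        then show ?thesis by (simp add: algebra_simps)
      qed
      then show "\<exists>U. \<exists>v\<in>gen V. zopen k U \<and> x \<in> U \<and> (\<forall>y\<in>U. (r + r') y - v \<in> stalk V y)"
        using zopen_Int[OF U(2) U'(2) U(3) U'(3)] U(3) U'(3)
        by (intro exI[of _ "U \<inter> U'"] bexI[of _ "v + v'"] conjI ballI IntI g(2)[OF U(1) U'(1)])
    qed (use prin_repsD(1,2)[OF r] prin_repsD(1,2)[OF r'] g(2) in simp_all)
  next
    fix a r assume a: "a \<in> k" and r: "r \<in> prin_reps k V"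
    show "(\<lambda>x. scal V a (r x)) \<in> prin_reps k V"
      unfolding prin_reps_def
    proof (intro CollectI conjI ballI allI impI)
      fix x assume x: "x \<in> points k"
      obtain U v where U: "v \<in> gen V" "zopen k U" "x \<in> U" "\<forall>y\<in>U. r y - v \<in> stalk V y"
        using prin_repsD(3)[OF r x] by blast
      have "scal V a (r y) - scal V a v \<in> stalk V y" if "y \<in> U" for y
      proof -
        have y: "y \<in> points k" using U(2) that by (auto simp: zopen_def)
        have "scal V a (r y - v) \<in> stalk V y" using U(4) that a subfield_points_subset[OF y] by (intro st(3)[OF y]) auto
        then show ?thesis by (simp add: scale_right_diff_distrib)
      qed
      then show "\<exists>U. \<exists>w\<in>gen V. zopen k U \<and> x \<in> U \<and> (\<forall>y\<in>U. scal V a (r y) - w \<in> stalk V y)"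
        using U(2,3) by (intro exI[of _ "U"] bexI[of _ "scal V a v"] conjI ballI g(3)[OF UNIV_I U(1)])
    qed (use prin_repsD(1,2)[OF r] g(3) in simp_all)
  qed
qed

lemma rational_repsI:
  assumes "r \<in> prin_reps k V" "v \<in> gen V" "\<And>x. x \<in> points k \<Longrightarrow> r x - v \<in> stalk V x"
  shows "r \<in> rational_reps k V"
  unfolding rational_reps_def using assms by (intro CollectI conjI bexI[of _ v]) simp_all

lemma rational_repsE:
  assumes "r \<in> rational_reps k V"
  obtains v where "r \<in> prin_reps k V" "v \<in> gen V" "\<And>x. x \<in> points k \<Longrightarrow> r x - v \<in> stalk V x"
  using assms unfolding rational_reps_def by blast

lemma rational_reps_rmodule:
  assumes V: "regular_sheaf k V" and k: "closed_ring k"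
  shows "rmodule (\<lambda>a r x. scal V a (r x)) k (rational_reps k V)"
proof -
  interpret vector_space "scal V" by (rule regular_sheafD(1)[OF V])
  note g = rmoduleD[OF regular_sheafD(2)[OF V]]
  note st = rmoduleD[OF regular_sheafD(3)[OF V]]
  note pr = rmoduleD[OF prin_reps_rmodule[OF V k]]
  show ?thesis unfolding rmodule_def
  proof (intro conjI ballI)
    show "0 \<in> rational_reps k V"
      by (rule rational_repsI[OF pr(1) g(1)]) (simp add: st(1))
  next
    fix r r' assume r: "r \<in> rational_reps k V" and r': "r' \<in> rational_reps k V"
    from rational_repsE[OF r] obtain v where v: "r \<in> prin_reps k V" "v \<in> gen V"
      "\<And>x. x \<in> points k \<Longrightarrow> r x - v \<in> stalk V x" by blast
    from rational_repsE[OF r'] obtain v' where v': "r' \<in> prin_reps k V" "v' \<in> gen V"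
      "\<And>x. x \<in> points k \<Longrightarrow> r' x - v' \<in> stalk V x" by blast
    have "(r + r') x - (v + v') \<in> stalk V x" if "x \<in> points k" for x
      using st(2)[OF that v(3)[OF that] v'(3)[OF that]] by (simp add: algebra_simps)
    then show "r + r' \<in> rational_reps k V"
      by (rule rational_repsI[OF pr(2)[OF v(1) v'(1)] g(2)[OF v(2) v'(2)]])
  next
    fix a r assume a: "a \<in> k" and r: "r \<in> rational_reps k V"
    from rational_repsE[OF r] obtain v where v: "r \<in> prin_reps k V" "v \<in> gen V"
      "\<And>x. x \<in> points k \<Longrightarrow> r x - v \<in> stalk V x" by blast
    have "scal V a (r x) - scal V a v \<in> stalk V x" if "x \<in> points k" for x
      using st(3)[OF that subsetD[OF subfield_points_subset[OF that] a] v(3)[OF that]]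
      by (simp add: scale_right_diff_distrib)
    then show "(\<lambda>x. scal V a (r x)) \<in> rational_reps k V"
      by (rule rational_repsI[OF pr(3)[OF a v(1)] g(3)[OF UNIV_I v(2)]])
  qed
qed

lemma pole_part_prin_reps:
  assumes V: "regular_sheaf k V" and "x \<in> points k" "w \<in> gen V"
  shows "pole_part x w \<in> prin_reps k V"
proof (rule prin_repsI_finite[OF V])
  note g = rmoduleD[OF regular_sheafD(2)[OF V]]
  note st = rmoduleD[OF regular_sheafD(3)[OF V]]
  show "finite {y\<in>points k. pole_part x w y \<notin> stalk V y}"
  proof (rule finite_subset)
    show "{y\<in>points k. pole_part x w y \<notin> stalk V y} \<subseteq> {x}"
    proof
      fix y assume "y \<in> {y\<in>points k. pole_part x w y \<notin> stalk V y}"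
      then show "y \<in> {x}" using st(1)[of y] by (cases "y = x") (simp_all add: pole_part_def)
    qed
  qed simp
  show "pole_part x w y \<in> gen V" for y using assms(3) g(1) by (simp add: pole_part_def)
  show "pole_part x w y = 0" if "y \<notin> points k" for y using assms(2) that by (auto simp: pole_part_def)
qed

lemma pole_part_add: "pole_part x (u + v) = pole_part x u + pole_part x v"
  by (auto simp: pole_part_def fun_eq_iff)

text \<open>The maximal ideal is generated by one element \<open>t\<close>, so the products in
  \<open>max_stalk\<close> are the multiples of \<open>t\<close>.\<close>

lemma max_stalk_rmodule:
  assumes V: "vector_space (scal V)" "rmodule (scal V) x (stalk V x)" and x: "dvr x"
  shows "rmodule (scal V) x (max_stalk V x)" "max_stalk V x \<subseteq> stalk V x"
proof -
  interpret vector_space "scal V" by (rule V)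
  note st = rmoduleD[OF V(2)]
  obtain t where t: "t \<in> x" "t \<noteq> 0" "max_ideal x = {t * r | r. r \<in> x}" using max_ideal_uniformizer[OF x] by blast
  have eq: "max_stalk V x = scal V t ` stalk V x"
  proof
    show "max_stalk V x \<subseteq> scal V t ` stalk V x"
    proof
      fix w assume "w \<in> max_stalk V x"
      then obtain r v where "r \<in> x" "v \<in> stalk V x" "w = scal V (t * r) v" unfolding max_stalk_def t(3) by auto
      then have "w = scal V t (scal V r v)" "scal V r v \<in> stalk V x" using st by auto
      then show "w \<in> scal V t ` stalk V x" by blast
    qed
    have "t \<in> max_ideal x" using closed_ringD(2)[OF dvr_closed_ring[OF x]] unfolding t(3) by force
    then show "scal V t ` stalk V x \<subseteq> max_stalk V x" unfolding max_stalk_def by auto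
  qed
  show "max_stalk V x \<subseteq> stalk V x" unfolding eq using st(3) t(1) by auto
  show "rmodule (scal V) x (max_stalk V x)"
    unfolding rmodule_def eq
  proof (intro conjI ballI)
    show "0 \<in> scal V t ` stalk V x" using st(1) by (intro image_eqI[of _ _ 0]) simp_all
    fix u v assume "u \<in> scal V t ` stalk V x" "v \<in> scal V t ` stalk V x"
    then obtain u' v' where "u = scal V t u'" "v = scal V t v'" "u' \<in> stalk V x" "v' \<in> stalk V x" by blast
    then show "u + v \<in> scal V t ` stalk V x" using st(2)[of u' v']
      by (intro image_eqI[of _ _ "u' + v'"]) (simp_all add: scale_right_distrib)
  next
    fix a v assume "a \<in> x" "v \<in> scal V t ` stalk V x"
    then obtain v' where "v = scal V t v'" "v' \<in> stalk V x" by blast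
    then show "scal V a v \<in> scal V t ` stalk V x" using st(3)[of a v'] \<open>a \<in> x\<close>
      by (intro image_eqI[of _ _ "scal V a v'"]) (simp_all add: mult.commute)
  qed
qed

lemma pole_part_zero: "pole_part x 0 = 0"
  by (auto simp: pole_part_def fun_eq_iff)

text \<open>Representatives of the line in the fibre of \<open>V(x)\<close> that corresponds to the point
  \<open>P\<close> of the projective bundle.\<close>

definition pole_vectors :: "('k::field, 'v::ab_group_add) vbundle \<Rightarrow> 'k set \<times> 'v set set \<Rightarrow> 'v set" where
  "pole_vectors V P = {scal V a v | a v. (\<forall>b\<in>max_ideal (fst P). a * b \<in> fst P) \<and> v \<in> \<Union>(snd P)}"

lemma psi_eq: "psi k V P = (\<lambda>u. pole_part (fst P) u +o rational_reps k V) ` pole_vectors V P"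
  by (auto simp: psi_def pole_vectors_def split: prod.splits)

text \<open>At a rational point every function is a constant in \<open>k\<close> plus a multiple of the
  uniformizer \<open>t\<close>, so up to regular sections the representatives form the line over
  \<open>k\<close> spanned by \<open>f / t\<close>.\<close>

lemma pole_vectors_line:
  assumes V: "vector_space (scal V)" "rmodule (scal V) x (stalk V x)" and x: "rational_point k x"
    and k: "closed_ring k"
    and t: "t \<in> x" "t \<noteq> 0" "max_ideal x = {t * r | r. r \<in> x}" and f: "f \<in> stalk V x"
  shows "pole_vectors V (x, proj_point (ring_on x) (fibre V x) (f +o max_stalk V x)) =
    {scal V (c / t) f + w | c w. c \<in> k \<and> w \<in> stalk V x}"
proof -
  interpret vector_space "scal V" by (rule V)
  note st = rmoduleD[OF V(2)]
  have dx: "dvr x" and kx: "k \<subseteq> x" using x by (auto simp: rational_point_def points_def)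
  note cx = dvr_closed_ring[OF dx]
  note X = closed_ringD[OF cx]
  note ms = max_stalk_rmodule[OF V dx]
  have L: "proj_point (ring_on x) (fibre V x) (f +o max_stalk V x) = (\<lambda>c. scal V c f +o max_stalk V x) ` x"
    unfolding proj_point_def fibre_def quot_simps ring_on_simps using coset_smult[OF ms(1)] by auto
  show ?thesis
  proof
    show "{scal V (c / t) f + w | c w. c \<in> k \<and> w \<in> stalk V x} \<subseteq>
      pole_vectors V (x, proj_point (ring_on x) (fibre V x) (f +o max_stalk V x))"
    proof
      fix u assume "u \<in> {scal V (c / t) f + w | c w. c \<in> k \<and> w \<in> stalk V x}"
      then obtain c w where c: "u = scal V (c / t) f + w" "c \<in> k" "w \<in> stalk V x" by blast
      have "u = scal V (inverse t) (scal V c f + scal V t w)"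
        using t(2) by (simp add: c scale_right_distrib divide_inverse mult.commute)
      moreover have "\<forall>b\<in>max_ideal x. inverse t * b \<in> x" unfolding t(3) using t(2) by (auto simp flip: mult.assoc)
      moreover have "t \<in> max_ideal x" unfolding t(3) using X(2) by force
      then have "scal V t w \<in> max_stalk V x" unfolding max_stalk_def using c by blast
      then have "scal V c f + scal V t w \<in> scal V c f +o max_stalk V x" by (auto simp: elt_set_plus_def)
      then have "scal V c f + scal V t w \<in> \<Union>(proj_point (ring_on x) (fibre V x) (f +o max_stalk V x))"
        unfolding L using c kx by blast
      ultimately show "u \<in> pole_vectors V (x, proj_point (ring_on x) (fibre V x) (f +o max_stalk V x))"
        unfolding pole_vectors_def fst_conv snd_conv by blast
    qed
    show "pole_vectors V (x, proj_point (ring_on x) (fibre V x) (f +o max_stalk V x)) \<subseteq>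
      {scal V (c / t) f + w | c w. c \<in> k \<and> w \<in> stalk V x}"
    proof
      fix u assume "u \<in> pole_vectors V (x, proj_point (ring_on x) (fibre V x) (f +o max_stalk V x))"
      then obtain a v where a: "u = scal V a v" "\<forall>b\<in>max_ideal x. a * b \<in> x"
        "v \<in> \<Union>(proj_point (ring_on x) (fibre V x) (f +o max_stalk V x))"
        unfolding pole_vectors_def by auto
      then obtain c m where c: "c \<in> x" "m \<in> max_stalk V x" "v = scal V c f + m"
        unfolding L by (auto simp: elt_set_plus_def)
      obtain b v' where b: "m = scal V b v'" "b \<in> max_ideal x" "v' \<in> stalk V x"
        using c(2) unfolding max_stalk_def by blast
      have "t \<in> max_ideal x" unfolding t(3) using X(2) by force
      then have at: "a * t \<in> x" using a(2) by blast
      then have "a * t * c \<in> x" using X c by blast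
      \<comment> \<open>only the residue \<open>c0\<close> matters up to regular sections\<close>
      then obtain c0 where c0: "c0 \<in> k" "a * t * c - c0 \<in> max_ideal x" using x unfolding rational_point_def by blast
      then obtain r where r: "a * t * c - c0 = t * r" "r \<in> x" unfolding t(3) by blast
      have "a * t * c = c0 + t * r" using r(1) by (simp add: algebra_simps)
      then have "t * (a * c) = t * (c0 / t + r)" using t(2) by (simp add: algebra_simps)
      then have "a * c = c0 / t + r" using t(2) by simp
      then have "u = scal V (c0 / t) f + (scal V r f + scal V (a * b) v')"
        by (simp add: a c b scale_right_distrib scale_left_distrib add.assoc)
      moreover have "scal V r f + scal V (a * b) v' \<in> stalk V x"
        using st f r(2) b a(2) by blast
      ultimately show "u \<in> {scal V (c / t) f + w | c w. c \<in> k \<and> w \<in> stalk V x}" using c0 by blast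
    qed
  qed
qed

lemma H1_closed:
  assumes V: "regular_sheaf k V" and k: "closed_ring k" and H: "submodule H (ring_on k) (H1 k V)"
  shows "rational_reps k V \<in> H"
    "p +o rational_reps k V \<in> H \<Longrightarrow> q +o rational_reps k V \<in> H \<Longrightarrow> (p + q) +o rational_reps k V \<in> H"
proof -
  interpret F: vector_space "\<lambda>a r x. scal V a (r x)" by (rule vector_space_pointwise[OF regular_sheafD(1)[OF V]])
  show "rational_reps k V \<in> H" using submodule_closed(1)[OF H] by (simp add: H1_def)
  show "p +o rational_reps k V \<in> H \<Longrightarrow> q +o rational_reps k V \<in> H \<Longrightarrow> (p + q) +o rational_reps k V \<in> H"
    using submodule_closed(2)[OF H, of "p +o rational_reps k V" "q +o rational_reps k V"]
    by (simp add: H1_def F.coset_add[OF rational_reps_rmodule[OF V k]])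
qed

lemma sum_pole_parts_in_span:
  assumes V: "regular_sheaf k V" and k: "closed_ring k"
    and "\<And>i. i \<in> I \<Longrightarrow> pole_part (x i) (u i) +o rational_reps k V \<in> S"
  shows "(\<Sum>i\<in>I. pole_part (x i) (u i)) +o rational_reps k V \<in> mod_span (ring_on k) (H1 k V) S"
proof (rule mod_span_memI)
  fix H assume H: "submodule H (ring_on k) (H1 k V)" "S \<subseteq> H"
  show "(\<Sum>i\<in>I. pole_part (x i) (u i)) +o rational_reps k V \<in> H"
    using assms(3)
  proof (induction I rule: infinite_finite_induct)
    case (insert i I)
    have "pole_part (x i) (u i) +o rational_reps k V \<in> H" using insert.prems[of i] H(2) by blast
    moreover have "(\<Sum>i\<in>I. pole_part (x i) (u i)) +o rational_reps k V \<in> H" using insert by blast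
    ultimately show ?case unfolding sum.insert[OF insert.hyps(1,2)] by (rule H1_closed(2)[OF V k H(1)])
  qed (use H1_closed(1)[OF V k H(1)] in simp_all)
qed

text \<open>The sums of poles at the points of \<open>T\<close> with coefficients in the corresponding lines
  form a submodule that contains the image of each point; so it contains their span.\<close>

lemma span_of_poles:
  assumes V: "regular_sheaf k V" and k: "closed_ring k"
    and T: "\<And>P. P \<in> T \<Longrightarrow> fst P \<in> points k \<and> rmodule (scal V) k (pole_vectors V P) \<and> pole_vectors V P \<subseteq> gen V"
    and \<delta>: "\<delta> \<in> mod_span (ring_on k) (H1 k V) (\<Union>(psi k V ` T))" and finT: "finite T"
  shows "\<exists>g. (\<forall>P\<in>T. g P \<in> pole_vectors V P) \<and> \<delta> = (\<Sum>P\<in>T. pole_part (fst P) (g P)) +o rational_reps k V"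
proof -
  interpret vector_space "scal V" by (rule regular_sheafD(1)[OF V])
  interpret F: vector_space "\<lambda>a r x. scal V a (r x)" by (rule vector_space_pointwise[OF regular_sheafD(1)[OF V]])
  define Q where "Q = {(\<Sum>P\<in>T. pole_part (fst P) (g P)) | g. \<forall>P\<in>T. g P \<in> pole_vectors V P}"
  note pv = rmoduleD[OF T[THEN conjunct2, THEN conjunct1]]
  have Qm: "rmodule (\<lambda>a r x. scal V a (r x)) k Q"
    unfolding rmodule_def
  proof (intro conjI ballI)
    have "(\<Sum>P\<in>T. pole_part (fst P) (0 :: 'b)) = 0" by (intro sum.neutral ballI pole_part_zero)
    then show "0 \<in> Q" unfolding Q_def using pv(1) by (intro CollectI exI[of _ "\<lambda>_. 0"]) simp
    fix r r' assume "r \<in> Q" "r' \<in> Q"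
    then obtain g g' where g: "r = (\<Sum>P\<in>T. pole_part (fst P) (g P))" "\<forall>P\<in>T. g P \<in> pole_vectors V P"
      "r' = (\<Sum>P\<in>T. pole_part (fst P) (g' P))" "\<forall>P\<in>T. g' P \<in> pole_vectors V P" unfolding Q_def by blast
    then have "r + r' = (\<Sum>P\<in>T. pole_part (fst P) (g P + g' P))" by (simp add: pole_part_add sum.distrib)
    then show "r + r' \<in> Q" unfolding Q_def using pv(2) g by (intro CollectI exI[of _ "\<lambda>P. g P + g' P"]) simp
  next
    fix a r assume a: "a \<in> k" "r \<in> Q"
    then obtain g where g: "r = (\<Sum>P\<in>T. pole_part (fst P) (g P))" "\<forall>P\<in>T. g P \<in> pole_vectors V P" unfolding Q_def by blast
    have "(\<lambda>x. scal V a (r x)) = (\<Sum>P\<in>T. (\<lambda>x. scal V a (pole_part (fst P) (g P) x)))"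
      unfolding g(1) by (rule F.scale_sum_right)
    moreover have "(\<lambda>x. scal V a (pole_part (fst P) (g P) x)) = pole_part (fst P) (scal V a (g P))" for P
      by (auto simp: pole_part_def)
    ultimately have "(\<lambda>x. scal V a (r x)) = (\<Sum>P\<in>T. pole_part (fst P) (scal V a (g P)))" by simp
    then show "(\<lambda>x. scal V a (r x)) \<in> Q" unfolding Q_def using pv(3) g a
      by (intro CollectI exI[of _ "\<lambda>P. scal V a (g P)"]) simp
  qed
  note pr = prin_reps_rmodule[OF V k]
  have QP: "Q \<subseteq> prin_reps k V"
  proof
    fix r assume "r \<in> Q"
    then obtain g where g: "r = (\<Sum>P\<in>T. pole_part (fst P) (g P))" "\<forall>P\<in>T. g P \<in> pole_vectors V P" unfolding Q_def by blast
    show "r \<in> prin_reps k V" unfolding g(1)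
      using g(2) T by (intro rmodule_sum[OF pr] pole_part_prin_reps[OF V]) auto
  qed
  define H where "H = (\<lambda>r. r +o rational_reps k V) ` Q"
  have Hs: "submodule H (ring_on k) (H1 k V)"
    unfolding H_def H1_def by (rule F.submodule_quotI[OF k pr rational_reps_rmodule[OF V k] Qm QP])
  have "\<Union>(psi k V ` T) \<subseteq> H"
  proof
    fix A assume "A \<in> \<Union>(psi k V ` T)"
    then obtain P u where P: "P \<in> T" "u \<in> pole_vectors V P" "A = pole_part (fst P) u +o rational_reps k V"
      unfolding psi_eq by auto
    define g where "g P' = (if P' = P then u else 0)" for P'
    have "\<forall>P\<in>T. g P \<in> pole_vectors V P" using P(2) pv(1) by (simp add: g_def)
    moreover have "(\<Sum>P\<in>T. pole_part (fst P) (g P)) = (\<Sum>P'\<in>T. if P' = P then pole_part (fst P) u else 0)"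
      by (intro sum.cong) (auto simp: g_def pole_part_def fun_eq_iff)
    then have "(\<Sum>P\<in>T. pole_part (fst P) (g P)) = pole_part (fst P) u" using P(1) finT by simp
    ultimately show "A \<in> H" unfolding H_def Q_def P(3) by (intro image_eqI[OF refl] CollectI exI[of _ g]) simp
  qed
  then have "\<delta> \<in> H" using mod_span_memD[OF \<delta> Hs] by blast
  then show ?thesis unfolding H_def Q_def by blast
qed

section \<open>Homomorphism bundles\<close>

lemma gen_linearD:
  assumes "gen_linear E F f"
  shows "v \<in> gen E \<Longrightarrow> f v \<in> gen F" "v \<in> gen E \<Longrightarrow> w \<in> gen E \<Longrightarrow> f (v + w) = f v + f w"
    "v \<in> gen E \<Longrightarrow> f (scal E a v) = scal F a (f v)"
  using assms unfolding gen_linear_def by simp_all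

lemma gen_linear_sum:
  assumes E: "vector_bundle k E" and F: "vector_bundle k F" and f: "gen_linear E F f"
    and "\<And>i. i \<in> I \<Longrightarrow> v i \<in> gen E"
  shows "f (\<Sum>i\<in>I. scal E (c i) (v i)) = (\<Sum>i\<in>I. scal F (c i) (f (v i)))"
proof -
  interpret E: vector_space "scal E" by (rule vector_bundle_vector_space[OF E])
  interpret F: vector_space "scal F" by (rule vector_bundle_vector_space[OF F])
  note g = rmoduleD[OF vector_bundle_gen_rmodule[OF E, of UNIV]]
  note gE = vector_bundle_gen_rmodule[OF E, of UNIV]
  have z: "f 0 = 0" using gen_linearD(3)[OF f g(1), of 0] by simp
  show ?thesis using assms(4)
  proof (induction I rule: infinite_finite_induct)
    case (insert i I)
    have "scal E (c i) (v i) \<in> gen E" "(\<Sum>i\<in>I. scal E (c i) (v i)) \<in> gen E"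
      using insert.prems by (auto intro!: g(3) rmodule_sum[OF gE])
    then show ?case using insert gen_linearD[OF f] by simp
  qed (simp_all add: z)
qed

lemma gen_linear_zero:
  assumes E: "vector_bundle k E" and F: "vector_bundle k F" and f: "gen_linear E F f"
  shows "f 0 = 0"
  using gen_linear_sum[OF E F f, of "{}"] by simp

lemma gen_linear_diff:
  assumes E: "vector_bundle k E" and f: "gen_linear E F f" and "v \<in> gen E" "w \<in> gen E"
  shows "f (v - w) = f v - f w"
proof -
  interpret E: vector_space "scal E" by (rule vector_bundle_vector_space[OF E])
  have "v - w \<in> gen E"
    using E.rmodule_uminus(2)[OF vector_bundle_gen_rmodule[OF E, of UNIV]] assms(3,4) by (simp add: closed_ring_def)
  then have "f (v - w + w) = f (v - w) + f w" using gen_linearD(2)[OF f] assms by blast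
  then show ?thesis by simp
qed

lemma gen_linear_image_rmodule:
  assumes E: "vector_bundle k E" and F: "vector_bundle k F" and f: "gen_linear E F f"
    and M: "rmodule (scal E) R M" "M \<subseteq> gen E"
  shows "rmodule (scal F) R (f ` M)"
  unfolding rmodule_def
proof (intro conjI ballI)
  show "0 \<in> f ` M" using rmoduleD(1)[OF M(1)] gen_linear_zero[OF E F f] by (intro image_eqI[of _ _ 0]) simp_all
  fix u v assume "u \<in> f ` M" "v \<in> f ` M"
  then obtain u' v' where u: "u = f u'" "u' \<in> M" and v: "v = f v'" "v' \<in> M" by blast
  have "u + v = f (u' + v')" using u v gen_linearD(2)[OF f subsetD[OF M(2) u(2)] subsetD[OF M(2) v(2)]] by simp
  then show "u + v \<in> f ` M" using rmoduleD(2)[OF M(1) u(2) v(2)] by (rule image_eqI)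
next
  fix a v assume "a \<in> R" "v \<in> f ` M"
  then obtain v' where v: "v = f v'" "v' \<in> M" by blast
  have "scal F a v = f (scal E a v')" using v gen_linearD(3)[OF f subsetD[OF M(2) v(2)], of a] by simp
  then show "scal F a v \<in> f ` M" using rmoduleD(3)[OF M(1) \<open>a \<in> R\<close> v(2)] by (rule image_eqI)
qed

text \<open>A rational homomorphism is regular wherever the images of a generic basis are regular.\<close>

lemma gen_linear_stalk_finite:
  assumes cu: "curve k" and E: "vector_bundle k E" and F: "vector_bundle k F" and f: "gen_linear E F f"
  shows "finite {x\<in>points k. \<not> f ` stalk E x \<subseteq> stalk F x}"
proof -
  interpret E: vector_space "scal E" by (rule vector_bundle_vector_space[OF E])
  obtain S0 where S0: "finite S0" "gen E = E.span S0" "finite {x\<in>points k. stalk E x \<noteq> lspan (scal E) x S0}"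
    using vector_bundle_generic_basis[OF E] by blast
  have S0g: "S0 \<subseteq> gen E" unfolding S0(2) by (rule E.span_superset)
  let ?X = "{x\<in>points k. stalk E x \<noteq> lspan (scal E) x S0} \<union> (\<Union>b\<in>S0. {x\<in>points k. f b \<notin> stalk F x})"
  have fin: "finite {x\<in>points k. f b \<notin> stalk F x}" if b: "b \<in> S0" for b
    by (rule vector_bundle_generically_regular[OF cu F gen_linearD(1)[OF f subsetD[OF S0g b]]])
  have "finite ?X" by (intro finite_UnI finite_UN_I S0 fin)
  moreover have "{x\<in>points k. \<not> f ` stalk E x \<subseteq> stalk F x} \<subseteq> ?X"
  proof
    fix x assume "x \<in> {x\<in>points k. \<not> f ` stalk E x \<subseteq> stalk F x}"
    then have x: "x \<in> points k" "\<not> f ` stalk E x \<subseteq> stalk F x" by simp_all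
    show "x \<in> ?X"
    proof (rule ccontr)
      assume "x \<notin> ?X"
      then have s: "stalk E x = lspan (scal E) x S0" and fb: "\<And>b. b \<in> S0 \<Longrightarrow> f b \<in> stalk F x" using x(1) by auto
      note st = vector_bundle_stalk_rmodule(1)[OF F x(1)]
      have "f u \<in> stalk F x" if u: "u \<in> stalk E x" for u
      proof -
        obtain c where c: "u = (\<Sum>b\<in>S0. scal E (c b) b)" "\<And>b. b \<in> S0 \<Longrightarrow> c b \<in> x"
          using lspanE[OF u[unfolded s]] by blast
        have "f u = (\<Sum>b\<in>S0. scal F (c b) (f b))" unfolding c(1)
          by (rule gen_linear_sum[OF E F f]) (use S0g in blast)
        then show ?thesis using c(2) fb by (simp only:, intro rmodule_sum[OF st] rmoduleD(3)[OF st]) auto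
      qed
      then show False using x(2) by blast
    qed
  qed
  ultimately show ?thesis by (rule finite_subset[rotated])
qed

lemma hom_bundle_simps:
  "scal (hom_bundle E F) = (\<lambda>a f v. scal F a (f v))"
  "f \<in> gen (hom_bundle E F) \<longleftrightarrow> gen_linear E F f \<and> (\<forall>v. v \<notin> gen E \<longrightarrow> f v = 0)"
  "f \<in> stalk (hom_bundle E F) x \<longleftrightarrow> gen_linear E F f \<and> (\<forall>v. v \<notin> gen E \<longrightarrow> f v = 0) \<and> f ` stalk E x \<subseteq> stalk F x"
  by (simp_all add: hom_bundle_def)

lemma hom_bundle_regular_sheaf:
  assumes cu: "curve k" and E: "vector_bundle k E" and F: "vector_bundle k F"
  shows "regular_sheaf k (hom_bundle E F)"
proof -
  interpret F: vector_space "scal F" by (rule vector_bundle_vector_space[OF F])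
  note g = rmoduleD[OF vector_bundle_gen_rmodule[OF F, of UNIV]]
  have z: "gen_linear E F 0" using g(1) by (simp add: gen_linear_def)
  have a: "gen_linear E F (f + f')" if "gen_linear E F f" "gen_linear E F f'" for f f'
    using gen_linearD[OF that(1)] gen_linearD[OF that(2)] g(2)
    by (simp add: gen_linear_def F.scale_right_distrib add_ac)
  have s: "gen_linear E F (\<lambda>v. scal F a (f v))" if "gen_linear E F f" for a f
    using gen_linearD[OF that(1)] g(3)
    by (simp add: gen_linear_def F.scale_right_distrib mult.commute)
  have "rmodule (scal (hom_bundle E F)) UNIV (gen (hom_bundle E F))"
    unfolding rmodule_def using z a s by (simp add: hom_bundle_simps Ball_def)
  moreover have "rmodule (scal (hom_bundle E F)) x (stalk (hom_bundle E F) x)" if x: "x \<in> points k" for x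
  proof -
    note st = rmoduleD[OF vector_bundle_stalk_rmodule(1)[OF F x]]
    show ?thesis
      unfolding rmodule_def hom_bundle_simps
    proof (intro conjI ballI)
      fix f f' assume "f \<in> stalk (hom_bundle E F) x" "f' \<in> stalk (hom_bundle E F) x"
      then have f: "gen_linear E F f" "\<forall>v. v \<notin> gen E \<longrightarrow> f v = 0" "f ` stalk E x \<subseteq> stalk F x"
        "gen_linear E F f'" "\<forall>v. v \<notin> gen E \<longrightarrow> f' v = 0" "f' ` stalk E x \<subseteq> stalk F x" by (simp_all add: hom_bundle_simps)
      show "gen_linear E F (f + f')" using a f by blast
      show "\<forall>v. v \<notin> gen E \<longrightarrow> (f + f') v = 0" using f by simp
      show "(f + f') ` stalk E x \<subseteq> stalk F x" using f(3,6) st(2) by (simp add: image_subset_iff)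
    next
      fix a f assume a: "a \<in> x" and "f \<in> stalk (hom_bundle E F) x"
      then have f: "gen_linear E F f" "\<forall>v. v \<notin> gen E \<longrightarrow> f v = 0" "f ` stalk E x \<subseteq> stalk F x" by (simp_all add: hom_bundle_simps)
      show "gen_linear E F (\<lambda>v. scal F a (f v))" using s f by blast
      show "\<forall>v. v \<notin> gen E \<longrightarrow> scal F a (f v) = 0" using f by simp
      show "(\<lambda>v. scal F a (f v)) ` stalk E x \<subseteq> stalk F x" using f(3) st(3)[OF a] by (simp add: image_subset_iff)
    qed (use z st(1) in \<open>simp_all add: image_subset_iff\<close>)
  qed
  moreover have "stalk (hom_bundle E F) x \<subseteq> gen (hom_bundle E F)" for x by (auto simp: hom_bundle_simps)
  moreover have "finite {x\<in>points k. f \<notin> stalk (hom_bundle E F) x}" if "f \<in> gen (hom_bundle E F)" for f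
  proof -
    have f: "gen_linear E F f" "\<forall>v. v \<notin> gen E \<longrightarrow> f v = 0" using that by (simp_all add: hom_bundle_simps)
    show ?thesis using gen_linear_stalk_finite[OF cu E F f(1)] f by (simp add: hom_bundle_simps)
  qed
  moreover have "vector_space (scal (hom_bundle E F))"
    unfolding hom_bundle_simps by (rule vector_space_pointwise[OF vector_bundle_vector_space[OF F]])
  ultimately show ?thesis unfolding regular_sheaf_def by blast
qed

section \<open>Extensions\<close>

text \<open>Exactness of the extension is stated for stalks, and passes to rational sections by clearing
  denominators at some point of the curve; hence the condition that there is a point.\<close>

locale curve_extension =
  fixes k :: "'k::field set"
    and F1 :: "('k, 'a::ab_group_add) vbundle" and W :: "('k, 'w::ab_group_add) vbundle" and F2 :: "('k, 'b::ab_group_add) vbundle"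
    and \<iota> :: "'a \<Rightarrow> 'w" and \<pi> :: "'w \<Rightarrow> 'b"
  assumes cu: "curve k" and ext: "extension k F1 W F2 \<iota> \<pi>" and pts: "points k \<noteq> {}"
begin

abbreviation "V \<equiv> hom_bundle F2 F1"

lemma bundles: "vector_bundle k F1" "vector_bundle k W" "vector_bundle k F2"
  using ext by (simp_all add: extension_def)

sublocale A: vector_space "scal F1" by (rule vector_bundle_vector_space[OF bundles(1)])
sublocale B: vector_space "scal W" by (rule vector_bundle_vector_space[OF bundles(2)])
sublocale C: vector_space "scal F2" by (rule vector_bundle_vector_space[OF bundles(3)])

lemma hom_regular: "regular_sheaf k V"
  by (rule hom_bundle_regular_sheaf[OF cu bundles(3,1)])

lemma ground_field: "subfield k KR" "finite k" using cu by (simp_all add: curve_def)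

lemma ground_ring: "closed_ring k" by (rule subfield_closed_ring(1)[OF ground_field(1)])

lemma maps: "gen_linear F1 W \<iota>" "gen_linear W F2 \<pi>"
  "x \<in> points k \<Longrightarrow> v \<in> stalk F1 x \<Longrightarrow> \<iota> v \<in> stalk W x"
  "x \<in> points k \<Longrightarrow> w \<in> stalk W x \<Longrightarrow> \<pi> w \<in> stalk F2 x"
proof -
  have b: "bundle_map k F1 W \<iota>" "bundle_map k W F2 \<pi>" using ext by (simp_all add: extension_def)
  then show "gen_linear F1 W \<iota>" "gen_linear W F2 \<pi>" by (simp_all add: bundle_map_def)
  show "x \<in> points k \<Longrightarrow> v \<in> stalk F1 x \<Longrightarrow> \<iota> v \<in> stalk W x"
    using b(1) by (simp add: bundle_map_def image_subset_iff)
  show "x \<in> points k \<Longrightarrow> w \<in> stalk W x \<Longrightarrow> \<pi> w \<in> stalk F2 x"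
    using b(2) by (simp add: bundle_map_def image_subset_iff)
qed

lemma exact:
  assumes "x \<in> points k"
  shows "inj_on \<iota> (stalk F1 x)" "\<iota> ` stalk F1 x = {w\<in>stalk W x. \<pi> w = 0}" "\<pi> ` stalk W x = stalk F2 x"
  using ext assms by (simp_all add: extension_def)

lemma iota_inj:
  assumes "v \<in> gen F1" "\<iota> v = 0"
  shows "v = 0"
proof -
  obtain x where x: "x \<in> points k" using pts by blast
  obtain a where a: "a \<in> x" "a \<noteq> 0" "scal F1 a v \<in> stalk F1 x"
    using vector_bundle_denominator[OF bundles(1) x assms(1)] by blast
  have "\<iota> (scal F1 a v) = 0" using gen_linearD(3)[OF maps(1) assms(1), of a] assms(2) by simp
  moreover have "\<iota> 0 = 0" by (rule gen_linear_zero[OF bundles(1,2) maps(1)])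
  moreover have "0 \<in> stalk F1 x" by (rule rmoduleD(1)[OF vector_bundle_stalk_rmodule(1)[OF bundles(1) x]])
  ultimately have "scal F1 a v = 0" using inj_onD[OF exact(1)[OF x] _ a(3)] by simp
  then show ?thesis using a(2) by simp
qed

lemma pi_iota:
  assumes "v \<in> gen F1"
  shows "\<pi> (\<iota> v) = 0"
proof -
  obtain x where x: "x \<in> points k" using pts by blast
  obtain a where a: "a \<in> x" "a \<noteq> 0" "scal F1 a v \<in> stalk F1 x"
    using vector_bundle_denominator[OF bundles(1) x assms(1)] by blast
  have "\<iota> (scal F1 a v) \<in> {w\<in>stalk W x. \<pi> w = 0}" using exact(2)[OF x] a(3) by (metis imageI)
  then have "\<pi> (\<iota> (scal F1 a v)) = 0" by simp
  then have "scal F2 a (\<pi> (\<iota> v)) = 0"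
    using gen_linearD[OF maps(1)] gen_linearD[OF maps(2)] assms by simp
  then show ?thesis using a(2) by simp
qed

lemma pi_kernel:
  assumes "w \<in> gen W" "\<pi> w = 0"
  shows "\<exists>v\<in>gen F1. \<iota> v = w"
proof -
  obtain x where x: "x \<in> points k" using pts by blast
  obtain a where a: "a \<in> x" "a \<noteq> 0" "scal W a w \<in> stalk W x"
    using vector_bundle_denominator[OF bundles(2) x assms(1)] by blast
  have "\<pi> (scal W a w) = 0" using gen_linearD(3)[OF maps(2) assms(1), of a] assms(2) by simp
  then have "scal W a w \<in> \<iota> ` stalk F1 x" using exact(2)[OF x] a(3) by simp
  then obtain v where v: "v \<in> stalk F1 x" "scal W a w = \<iota> v" by blast
  have vg: "v \<in> gen F1" using v(1) vector_bundle_stalk_rmodule(2)[OF bundles(1) x] by blast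
  have "\<iota> (scal F1 (inverse a) v) = scal W (inverse a) (scal W a w)"
    using gen_linearD(3)[OF maps(1) vg] v(2) by simp
  also have "\<dots> = w" using a(2) by simp
  finally show ?thesis using rmoduleD(3)[OF vector_bundle_gen_rmodule[OF bundles(1), of UNIV] UNIV_I vg] by blast
qed

text \<open>\<open>F1\<close> is saturated in \<open>W\<close>, being the kernel of \<open>\<pi>\<close>.\<close>

lemma iota_stalk_reflect:
  assumes x: "x \<in> points k" and v: "v \<in> gen F1" "\<iota> v \<in> stalk W x"
  shows "v \<in> stalk F1 x"
proof -
  have "\<iota> v \<in> \<iota> ` stalk F1 x" using exact(2)[OF x] v pi_iota by simp
  then obtain u where u: "u \<in> stalk F1 x" "\<iota> v = \<iota> u" by blast
  have ug: "u \<in> gen F1" using u(1) vector_bundle_stalk_rmodule(2)[OF bundles(1) x] by blast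
  have "\<iota> (v - u) = 0" using gen_linear_diff[OF bundles(1) maps(1) v(1) ug] u(2) by simp
  moreover have "v - u \<in> gen F1"
    using A.rmodule_uminus(2)[OF vector_bundle_gen_rmodule[OF bundles(1)] ground_ring v(1) ug] .
  ultimately have "v - u = 0" using iota_inj by blast
  then show ?thesis using u(1) by simp
qed

lemma stalk_gen: "x \<in> points k \<Longrightarrow> v \<in> stalk F1 x \<Longrightarrow> v \<in> gen F1"
  "x \<in> points k \<Longrightarrow> w \<in> stalk W x \<Longrightarrow> w \<in> gen W"
  "x \<in> points k \<Longrightarrow> u \<in> stalk F2 x \<Longrightarrow> u \<in> gen F2"
  using vector_bundle_stalk_rmodule(2)[OF bundles(1)] vector_bundle_stalk_rmodule(2)[OF bundles(2)]
    vector_bundle_stalk_rmodule(2)[OF bundles(3)] by blast+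

lemmas st1 = vector_bundle_stalk_rmodule(1)[OF bundles(1)]
lemmas stW = vector_bundle_stalk_rmodule(1)[OF bundles(2)]
lemmas st2 = vector_bundle_stalk_rmodule(1)[OF bundles(3)]

text \<open>The rational section \<open>s\<close> of \<open>\<pi>\<close> has polar part \<open>p\<close>.\<close>

definition splits_with_poles :: "('b \<Rightarrow> 'w) \<Rightarrow> ('k set \<Rightarrow> 'b \<Rightarrow> 'a) \<Rightarrow> bool" where
  "splits_with_poles s p \<longleftrightarrow> gen_linear F2 W s \<and> (\<forall>v\<in>gen F2. \<pi> (s v) = v) \<and>
    (\<forall>x\<in>points k. \<forall>u\<in>stalk F2 x. s u - \<iota> (p x u) \<in> stalk W x)"

lemma prin_reps_hom: "p \<in> prin_reps k V \<Longrightarrow> x \<in> points k \<Longrightarrow> gen_linear F2 F1 (p x)"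
  "p \<in> prin_reps k V \<Longrightarrow> x \<in> points k \<Longrightarrow> v \<notin> gen F2 \<Longrightarrow> p x v = 0"
  using prin_repsD(1)[of p k V x] by (simp_all add: hom_bundle_simps)

lemma ext_class_splits:
  assumes "p \<in> ext_class k F1 W F2 \<iota> \<pi>"
  shows "p \<in> prin_reps k V" "\<exists>s. splits_with_poles s p"
proof -
  show "p \<in> prin_reps k V" using assms by (simp add: ext_class_def)
  obtain s where s: "s \<in> gen (hom_bundle F2 W)" "\<forall>v\<in>gen F2. \<pi> (s v) = v"
    "\<forall>x\<in>points k. (\<lambda>v. s v - \<iota> (p x v)) \<in> stalk (hom_bundle F2 W) x"
    using assms unfolding ext_class_def by blast
  have "splits_with_poles s p"
    unfolding splits_with_poles_def using s by (simp add: hom_bundle_simps image_subset_iff)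
  then show "\<exists>s. splits_with_poles s p" by blast
qed

text \<open>Adding the principal part of a rational homomorphism \<open>v\<close> to \<open>p\<close>
  corresponds to adding \<open>\<iota> v\<close> to \<open>s\<close>.\<close>

lemma splits_translate:
  assumes s: "splits_with_poles s p" and p: "p \<in> prin_reps k V" and n: "n \<in> rational_reps k V"
  shows "\<exists>s'. splits_with_poles s' (p + n)"
proof -
  obtain v where v: "n \<in> prin_reps k V" "v \<in> gen V" "\<And>x. x \<in> points k \<Longrightarrow> n x - v \<in> stalk V x"
    using rational_repsE[OF n] by blast
  have vl: "gen_linear F2 F1 v" using v(2) by (simp add: hom_bundle_simps)
  note S = s[unfolded splits_with_poles_def]
  define s' where "s' u = s u + \<iota> (v u)" for u
  have sl: "gen_linear F2 W s" using S by simp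
  note gW = rmoduleD[OF vector_bundle_gen_rmodule[OF bundles(2), of UNIV]]
  have "gen_linear F2 W s'"
    unfolding gen_linear_def s'_def
    using gen_linearD[OF sl] gen_linearD[OF vl] gen_linearD[OF maps(1)] gW(2)
    by (simp add: B.scale_right_distrib add_ac)
  moreover have "\<pi> (s' u) = u" if "u \<in> gen F2" for u
    unfolding s'_def using gen_linearD[OF sl] gen_linearD[OF vl] gen_linearD[OF maps(1)] gen_linearD(2)[OF maps(2)] S that pi_iota
    by simp
  moreover have "s' u - \<iota> ((p + n) x u) \<in> stalk W x" if x: "x \<in> points k" and u: "u \<in> stalk F2 x" for x u
  proof -
    have ug: "u \<in> gen F2" using stalk_gen x u by blast
    have 1: "s u - \<iota> (p x u) \<in> stalk W x" using S x u by blast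
    have "n x u - v u \<in> stalk F1 x" using v(3)[OF x] u by (simp add: hom_bundle_simps image_subset_iff)
    then have 2: "\<iota> (n x u - v u) \<in> stalk W x" by (rule maps(3)[OF x])
    have g: "n x u \<in> gen F1" "v u \<in> gen F1" "p x u \<in> gen F1"
      using gen_linearD(1)[OF prin_reps_hom(1)[OF v(1) x] ug] gen_linearD(1)[OF vl ug] gen_linearD(1)[OF prin_reps_hom(1)[OF p x] ug] .
    have "s' u - \<iota> ((p + n) x u) = (s u - \<iota> (p x u)) - \<iota> (n x u - v u)"
      unfolding s'_def using gen_linear_diff[OF bundles(1) maps(1) g(1,2)] gen_linearD(2)[OF maps(1) g(3,1)]
      by (simp add: algebra_simps)
    then show ?thesis using B.rmodule_uminus(2)[OF stW[OF x] points_closed_ring[OF x] 1 2] by simp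
  qed
  ultimately show ?thesis unfolding splits_with_poles_def by blast
qed

end

section \<open>From a rational splitting to a subbundle\<close>

lemma sum_enat: "(\<Sum>x\<in>A. enat (f x)) = enat (\<Sum>x\<in>A. f x)"
  by (induction A rule: infinite_finite_induct) (simp_all add: zero_enat_def)

lemma locally_free_cong:
  assumes "\<And>x. x \<in> points k \<Longrightarrow> N x = N' x" "locally_free k s M N"
  shows "locally_free k s M N'"
  unfolding locally_free_def
proof
  fix x assume "x \<in> points k"
  then obtain U B where U: "zopen k U" "x \<in> U" "B \<subseteq> (\<Inter>y\<in>U. M y)" "\<forall>y\<in>U. quot_basis y s (M y) (N y) B"
    using assms(2) unfolding locally_free_def by blast
  have "U \<subseteq> points k" using U(1) by (simp add: zopen_def)
  then have "\<forall>y\<in>U. quot_basis y s (M y) (N' y) B" using U(4) assms(1) by (simp add: subset_iff)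
  then show "\<exists>U B. zopen k U \<and> x \<in> U \<and> B \<subseteq> (\<Inter>y\<in>U. M y) \<and> (\<forall>y\<in>U. quot_basis y s (M y) (N' y) B)"
    using U by blast
qed

text \<open>A submodule between a lattice and its multiple by the uniformizer \<open>t\<close> is generated
  by the multiples of a basis by \<open>t\<close> together with the vectors in it that have
  coordinates in the finite field \<open>k\<close>, since at a rational point \<open>k\<close>
  represents all residue classes.\<close>

lemma (in vector_space) sublattice_finitely_generated:
  assumes k: "closed_ring k" "finite k" and x: "rational_point k x"
    and B: "finite B" and G: "rmodule scale x G" "G \<subseteq> lspan scale x B"
    and mG: "\<And>a b. a \<in> max_ideal x \<Longrightarrow> b \<in> B \<Longrightarrow> a *s b \<in> G"
  shows "\<exists>S. finite S \<and> G = lspan scale x S \<and> span S = span B"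
proof -
  have dx: "dvr x" and kx: "k \<subseteq> x" using x by (simp_all add: rational_point_def points_def)
  note cx = dvr_closed_ring[OF dx]
  obtain t where t: "t \<in> x" "t \<noteq> 0" "max_ideal x = {t * r | r. r \<in> x}" using max_ideal_uniformizer[OF dx] by blast
  have tm: "t \<in> max_ideal x" using closed_ringD(2)[OF cx] unfolding t(3) by force
  define reps where "reps = (\<lambda>c. \<Sum>b\<in>B. c b *s b) ` (PiE B (\<lambda>_. k))"
  have fin: "finite reps" unfolding reps_def using B k(2) by (intro finite_imageI finite_PiE) auto
  define S where "S = scale t ` B \<union> (reps \<inter> G)"
  have finS: "finite S" using B fin by (simp add: S_def)
  have SG: "S \<subseteq> G" using mG[OF tm] unfolding S_def by blast
  note M = lspan_rmodule[OF cx, of S]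
  have SM: "S \<subseteq> lspan scale x S" by (rule lspan_superset[OF cx finS])
  have "G \<subseteq> lspan scale x S"
  proof
    fix u assume u: "u \<in> G"
    obtain c where c: "u = (\<Sum>b\<in>B. c b *s b)" "\<And>b. b \<in> B \<Longrightarrow> c b \<in> x"
      using lspanE[OF subsetD[OF G(2) u]] by blast
    have "\<forall>b\<in>B. \<exists>c0 r. c0 \<in> k \<and> r \<in> x \<and> c b = c0 + t * r"
    proof
      fix b assume b: "b \<in> B"
      obtain c0 where c0: "c0 \<in> k" "c b - c0 \<in> max_ideal x"
        using x c(2)[OF b] unfolding rational_point_def by blast
      then obtain r where r: "r \<in> x" "c b - c0 = t * r" unfolding t(3) by blast
      have "c b = c0 + t * r" using r(2) by (simp add: algebra_simps)
      then show "\<exists>c0 r. c0 \<in> k \<and> r \<in> x \<and> c b = c0 + t * r" using c0(1) r(1) by blast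
    qed
    then obtain c0 r where cr: "\<forall>b\<in>B. c0 b \<in> k \<and> r b \<in> x \<and> c b = c0 b + t * r b" by metis
    define v where "v = (\<Sum>b\<in>B. restrict c0 B b *s b)"
    have v: "v \<in> reps" unfolding v_def reps_def using cr by (intro imageI) (auto simp: PiE_iff extensional_def)
    define w where "w = (\<Sum>b\<in>B. r b *s (t *s b))"
    have "u = (\<Sum>b\<in>B. c0 b *s b + r b *s (t *s b))"
      unfolding c(1) by (rule sum.cong[OF refl]) (use cr in \<open>simp add: scale_left_distrib mult.commute\<close>)
    then have uvw: "u = v + w" by (simp add: v_def w_def sum.distrib)
    have "t *s b \<in> S" if "b \<in> B" for b using that unfolding S_def by blast
    then have "r b *s (t *s b) \<in> lspan scale x S" "r b *s (t *s b) \<in> G" if "b \<in> B" for b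
      using that cr SM SG rmoduleD(3)[OF M, of "r b" "t *s b"] rmoduleD(3)[OF G(1), of "r b" "t *s b"] by blast+
    then have wS: "w \<in> lspan scale x S" and wG: "w \<in> G"
      unfolding w_def by - (rule rmodule_sum[OF M], blast, rule rmodule_sum[OF G(1)], blast)
    have "v = u - w" using uvw by simp
    then have "v \<in> G" using rmodule_uminus(2)[OF G(1) cx u wG] by simp
    then have "v \<in> lspan scale x S" using v SM unfolding S_def by blast
    then show "u \<in> lspan scale x S" unfolding uvw using wS by (rule rmoduleD(2)[OF M])
  qed
  moreover have "lspan scale x S \<subseteq> G" by (rule lspan_minimal[OF G(1) SG])
  moreover have "span S = span B"
  proof
    have "S \<subseteq> span B" using SG G(2) lspan_mono_span[of x B] by blast
    then show "span S \<subseteq> span B" by (intro span_minimal subspace_span)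
    have "b \<in> span S" if "b \<in> B" for b
    proof -
      have "t *s b \<in> span S" by (rule span_base) (use that in \<open>unfold S_def, blast\<close>)
      then have "inverse t *s (t *s b) \<in> span S" by (rule span_scale)
      then show ?thesis using t(2) by simp
    qed
    then show "span B \<subseteq> span S" by (intro span_minimal subspace_span) blast
  qed
  ultimately show ?thesis using finS by blast
qed

context curve_extension
begin

text \<open>The elementary transformation is the kernel \<open>g\<close> of the map from \<open>F2\<close>
  to principal parts of \<open>F1\<close> defined by \<open>p\<close>, and \<open>\<tau>\<close>
  is its image. At \<open>x\<close> the section \<open>s\<close> maps \<open>g x\<close> onto the
  kernel of \<open>w \<mapsto> w - s (\<pi> w)\<close> in the stalk of \<open>W\<close>, so the
  quotient is torsion free.\<close>

lemma splitting_gives_subbundle: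
  assumes s: "splits_with_poles s p" and p: "p \<in> prin_reps k V"
    and D: "finite D" "\<forall>x\<in>D. rational_point k x"
    and supp: "\<And>x. x \<in> points k - D \<Longrightarrow> p x = 0"
    and simple: "\<And>x a u. x \<in> D \<Longrightarrow> a \<in> max_ideal x \<Longrightarrow> u \<in> stalk F2 x \<Longrightarrow> scal F1 a (p x u) \<in> stalk F1 x"
    and count: "\<And>x. x \<in> D \<Longrightarrow> finite ((\<lambda>u. p x u +o stalk F1 x) ` stalk F2 x) \<and>
      card ((\<lambda>u. p x u +o stalk F1 x) ` stalk F2 x) \<le> card k ^ n x"
    and h: "(\<Sum>x\<in>D. n x) \<le> h"
  shows "\<exists>G \<tau>. elementary_transformation k F2 G \<and> lifts_to_subbundle k W \<pi> G \<and>
            quotient_sequence k G F2 F1 \<tau> \<and> prin_subsheaf k F1 \<tau> \<and>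
            simple_poles_on k F1 D \<tau> \<and> skyscraper_length F1 D \<tau> \<le> enat h"
proof -
  have Dp: "D \<subseteq> points k" using D(2) by (auto simp: rational_point_def)
  note S = s[unfolded splits_with_poles_def]
  have sl: "gen_linear F2 W s" and ps: "\<And>v. v \<in> gen F2 \<Longrightarrow> \<pi> (s v) = v" using S by blast+
  have sp: "s u - \<iota> (p x u) \<in> stalk W x" if "x \<in> points k" "u \<in> stalk F2 x" for x u using S that by blast
  note pl = prin_reps_hom(1)[OF p]
  have pg: "p x u \<in> gen F1" if "x \<in> points k" "u \<in> stalk F2 x" for x u
    using gen_linearD(1)[OF pl[OF that(1)]] stalk_gen(3) that by blast
  \<comment> \<open>equivalently, \<open>s u\<close> is a regular section of \<open>W\<close>\<close>
  define g where "g x = {u\<in>stalk F2 x. p x u \<in> stalk F1 x}" for x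
  define G where "G = F2\<lparr>stalk := g\<rparr>"
  have Gs: "scal G = scal F2" "gen G = gen F2" "stalk G = g" by (simp_all add: G_def)
  have gmod: "rmodule (scal F2) x (g x)" if x: "x \<in> points k" for x
    unfolding rmodule_def
  proof (intro conjI ballI)
    note a = rmoduleD[OF st1[OF x]] and c = rmoduleD[OF st2[OF x]]
    show "0 \<in> g x" using a(1) c(1) gen_linear_zero[OF bundles(3,1) pl[OF x]] by (simp add: g_def)
    fix u v assume "u \<in> g x" "v \<in> g x"
    then have uv: "u \<in> stalk F2 x" "v \<in> stalk F2 x" "p x u \<in> stalk F1 x" "p x v \<in> stalk F1 x" by (simp_all add: g_def)
    show "u + v \<in> g x" using uv a(2) c(2) gen_linearD(2)[OF pl[OF x] stalk_gen(3)[OF x] stalk_gen(3)[OF x], of u v]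
      by (simp add: g_def)
  next
    note a = rmoduleD[OF st1[OF x]] and c = rmoduleD[OF st2[OF x]]
    fix r u assume r: "r \<in> x" and "u \<in> g x"
    then have uv: "u \<in> stalk F2 x" "p x u \<in> stalk F1 x" by (simp_all add: g_def)
    show "scal F2 r u \<in> g x" using uv r a(3) c(3) gen_linearD(3)[OF pl[OF x] stalk_gen(3)[OF x uv(1)], of r]
      by (simp add: g_def)
  qed
  have gsub: "g x \<subseteq> stalk F2 x" for x by (auto simp: g_def)
  have g_off: "g x = stalk F2 x" if "x \<in> points k - D" for x
    using supp[OF that] rmoduleD(1)[OF st1[of x]] that by (simp add: g_def)
  obtain S0 where S0: "finite S0" "gen F2 = C.span S0" "finite {x\<in>points k. stalk F2 x \<noteq> lspan (scal F2) x S0}"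
    using vector_bundle_generic_basis[OF bundles(3)] by blast
  have gfg: "\<exists>S. finite S \<and> g x = lspan (scal F2) x S \<and> C.span S = C.span S0" if x: "x \<in> points k" for x
  proof -
    obtain B where B: "finite B" "stalk F2 x = lspan (scal F2) x B" "C.span B = gen F2"
      using vector_bundle_stalk_basis[OF bundles(3) x] by blast
    show ?thesis
    proof (cases "x \<in> D")
      case False
      have "g x = lspan (scal F2) x B" using g_off[of x] x False B(2) by simp
      then show ?thesis using B(1,3) S0(2) by (intro exI[of _ B]) simp
    next
      case True
      have BB: "B \<subseteq> stalk F2 x" unfolding B(2) by (rule C.lspan_superset[OF points_closed_ring[OF x] B(1)])
      have "scal F2 a b \<in> g x" if ab: "a \<in> max_ideal x" "b \<in> B" for a b
      proof -
        have b: "b \<in> stalk F2 x" using BB ab(2) by blast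
        have ax: "a \<in> x" using ab(1) max_ideal_subset by blast
        have "p x (scal F2 a b) = scal F1 a (p x b)" by (rule gen_linearD(3)[OF pl[OF x] stalk_gen(3)[OF x b]])
        then show ?thesis using simple[OF True ab(1) b] rmoduleD(3)[OF st2[OF x] ax b] by (simp add: g_def)
      qed
      then have "\<exists>S. finite S \<and> g x = lspan (scal F2) x S \<and> C.span S = C.span B"
        using C.sublattice_finitely_generated[OF ground_ring ground_field(2) D(2)[rule_format, OF True] B(1) gmod[OF x] gsub[of x, unfolded B(2)]] by blast
      then show ?thesis unfolding B(3) S0(2) .
    qed
  qed
  have gfin: "finite {x\<in>points k. g x \<noteq> lspan (scal F2) x S0}"
  proof (rule finite_subset)
    show "{x\<in>points k. g x \<noteq> lspan (scal F2) x S0} \<subseteq> D \<union> {x\<in>points k. stalk F2 x \<noteq> lspan (scal F2) x S0}"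
    proof
      fix x assume "x \<in> {x\<in>points k. g x \<noteq> lspan (scal F2) x S0}"
      then show "x \<in> D \<union> {x\<in>points k. stalk F2 x \<noteq> lspan (scal F2) x S0}"
        using g_off[of x] by (cases "x \<in> D") simp_all
    qed
    show "finite (D \<union> {x\<in>points k. stalk F2 x \<noteq> lspan (scal F2) x S0})" using D(1) S0(3) by blast
  qed
  have gspan: "gen F2 = C.span (g x)" if x: "x \<in> points k" for x
  proof -
    obtain S where S: "finite S" "g x = lspan (scal F2) x S" "C.span S = C.span S0" using gfg[OF x] by blast
    show ?thesis using C.span_lspan[OF points_closed_ring[OF x] S(1)] S(3) unfolding S(2) S0(2) by simp
  qed
  have vbG: "vector_bundle k G"
    unfolding vector_bundle_def Gs
  proof (intro conjI ballI)
    show "vector_space (scal F2)" by (rule vector_bundle_vector_space[OF bundles(3)])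
    show "\<exists>B. finite B \<and> gen F2 = C.span B" using S0 by blast
    show "gen F2 = C.span (g x)" if "x \<in> points k" for x by (rule gspan[OF that])
    show "locally_free k (scal F2) g (\<lambda>_. {0})" by (rule C.locally_freeI[OF cu S0(1) gfin gfg])
  qed
  have "rank G = rank F2" by (simp add: rank_def Gs)
  then have el: "elementary_transformation k F2 G"
    unfolding elementary_transformation_def using vbG gsub by (simp add: Gs)
  have sg: "s u \<in> stalk W x" if x: "x \<in> points k" and u: "u \<in> g x" for x u
  proof -
    have u': "u \<in> stalk F2 x" "p x u \<in> stalk F1 x" using u by (simp_all add: g_def)
    have "(s u - \<iota> (p x u)) + \<iota> (p x u) \<in> stalk W x"
      by (rule rmoduleD(2)[OF stW[OF x] sp[OF x u'(1)] maps(3)[OF x u'(2)]])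
    then show ?thesis by simp
  qed
  have saturated: "s ` g x = {w \<in> stalk W x. w - s (\<pi> w) = 0}" if x: "x \<in> points k" for x
  proof
    show "s ` g x \<subseteq> {w \<in> stalk W x. w - s (\<pi> w) = 0}"
    proof
      fix w assume "w \<in> s ` g x"
      then obtain u where u: "w = s u" "u \<in> g x" by blast
      have "u \<in> gen F2" using stalk_gen(3)[OF x] gsub u(2) by blast
      then show "w \<in> {w \<in> stalk W x. w - s (\<pi> w) = 0}" using sg[OF x u(2)] ps u(1) by simp
    qed
    show "{w \<in> stalk W x. w - s (\<pi> w) = 0} \<subseteq> s ` g x"
    proof
      fix w assume "w \<in> {w \<in> stalk W x. w - s (\<pi> w) = 0}"
      then have w: "w \<in> stalk W x" "w = s (\<pi> w)" by simp_all
      define u where "u = \<pi> w"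
      have u: "u \<in> stalk F2 x" unfolding u_def by (rule maps(4)[OF x w(1)])
      have "s u \<in> stalk W x" using w u_def by simp
      then have "s u - (s u - \<iota> (p x u)) \<in> stalk W x"
        by (rule B.rmodule_uminus(2)[OF stW[OF x] points_closed_ring[OF x] _ sp[OF x u]])
      then have "p x u \<in> stalk F1 x" using iota_stalk_reflect[OF x pg[OF x u]] by simp
      then have "u \<in> g x" using u by (simp add: g_def)
      then show "w \<in> s ` g x" using w(2) u_def by blast
    qed
  qed
  obtain SW where SW: "finite SW" "gen W = B.span SW" "finite {x\<in>points k. stalk W x \<noteq> lspan (scal W) x SW}"
    using vector_bundle_generic_basis[OF bundles(2)] by blast
  have "locally_free k (scal W) (stalk W) (\<lambda>x. {w \<in> stalk W x. w - s (\<pi> w) = 0})"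
  proof (rule B.locally_free_quotientI[OF cu SW(1,3)])
    show "\<exists>S. finite S \<and> stalk W x = lspan (scal W) x S \<and> B.span S = B.span SW" if x: "x \<in> points k" for x
      using vector_bundle_stalk_basis[OF bundles(2) x] unfolding SW(2) by blast
    show "u + v - s (\<pi> (u + v)) = u - s (\<pi> u) + (v - s (\<pi> v))" if "u \<in> B.span SW" "v \<in> B.span SW" for u v
      using gen_linearD[OF maps(2)] gen_linearD[OF sl] that unfolding SW(2)[symmetric] by simp
    show "scal W a v - s (\<pi> (scal W a v)) = scal W a (v - s (\<pi> v))" if "v \<in> B.span SW" for a v
      using gen_linearD[OF maps(2)] gen_linearD[OF sl] that unfolding SW(2)[symmetric]
      by (simp add: B.scale_right_diff_distrib)
  qed
  then have lf: "locally_free k (scal W) (stalk W) (\<lambda>x. s ` g x)"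
    by (rule locally_free_cong[rotated]) (simp add: saturated)
  have "bundle_map k G W s"
    unfolding bundle_map_def Gs using sl sg by (simp add: gen_linear_def Gs image_subset_iff)
  then have lift: "lifts_to_subbundle k W \<pi> G"
    unfolding lifts_to_subbundle_def using ps lf by (intro exI[of _ s]) (simp add: Gs)
  define q where "q x u = p x u +o stalk F1 x" for x u
  define \<tau> where "\<tau> x = q x ` stalk F2 x" for x
  have "quotient_sequence k G F2 F1 \<tau>"
    unfolding quotient_sequence_def
  proof (intro exI[of _ q] ballI conjI)
    fix x assume x: "x \<in> points k"
    show "q x ` stalk F2 x = \<tau> x" by (simp add: \<tau>_def)
    show "{v \<in> stalk F2 x. q x v = \<zero>\<^bsub>prin_stalk F1 x\<^esub>} = stalk G x"
      by (simp add: q_def prin_stalk_def Gs g_def A.coset_zero_iff[OF st1[OF x] points_closed_ring[OF x]])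
    show "q x (v + w) = q x v \<oplus>\<^bsub>prin_stalk F1 x\<^esub> q x w" if "v \<in> stalk F2 x" "w \<in> stalk F2 x" for v w
      using gen_linearD(2)[OF pl[OF x] stalk_gen(3)[OF x that(1)] stalk_gen(3)[OF x that(2)]]
      by (simp add: q_def prin_stalk_def A.coset_add[OF st1[OF x]])
    show "q x (scal F2 a v) = a \<odot>\<^bsub>prin_stalk F1 x\<^esub> q x v" if "a \<in> x" "v \<in> stalk F2 x" for a v
      using gen_linearD(3)[OF pl[OF x] stalk_gen(3)[OF x that(2)]]
      by (simp add: q_def prin_stalk_def A.coset_smult[OF st1[OF x] that(1)])
  qed
  moreover have "prin_subsheaf k F1 \<tau>"
    unfolding prin_subsheaf_def
  proof
    fix x assume x: "x \<in> points k"
    have "rmodule (scal F1) x (p x ` stalk F2 x)"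
      by (rule gen_linear_image_rmodule[OF bundles(3,1) pl[OF x] st2[OF x]]) (use stalk_gen(3)[OF x] in blast)
    then have "submodule ((\<lambda>v. v +o stalk F1 x) ` (p x ` stalk F2 x)) (ring_on x) (prin_stalk F1 x)"
      unfolding prin_stalk_def
      by (rule A.submodule_quotI[OF points_closed_ring[OF x] vector_bundle_gen_rmodule[OF bundles(1)] st1[OF x]])
        (use pg[OF x] in blast)
    then show "submodule (\<tau> x) (ring_on x) (prin_stalk F1 x)" by (simp add: \<tau>_def q_def image_image)
  qed
  moreover have "simple_poles_on k F1 D \<tau>"
    unfolding simple_poles_on_def
  proof
    fix x assume x: "x \<in> points k"
    have "p x u \<in> stalk (twist F1 D) x" if u: "u \<in> stalk F2 x" for u
    proof (cases "x \<in> D")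
      case True
      then show ?thesis using pg[OF x u] simple[OF True _ u] by (simp add: twist_def)
    next
      case False
      then show ?thesis using supp[of x] x rmoduleD(1)[OF st1[OF x]] by (simp add: twist_def)
    qed
    then show "\<tau> x \<subseteq> carrier (quot (scal F1) (stalk (twist F1 D) x) (stalk F1 x))"
      unfolding \<tau>_def q_def by auto
  qed
  moreover have "skyscraper_length F1 D \<tau> \<le> enat h"
  proof -
    have "mod_length (ring_on x) (prin_stalk F1 x) (\<tau> x) \<le> enat (n x)" if xD: "x \<in> D" for x
    proof -
      have x: "x \<in> points k" using xD Dp by blast
      have m: "Module.module (ring_on x) (prin_stalk F1 x)"
        unfolding prin_stalk_def
        by (rule A.module_quot[OF points_closed_ring[OF x] vector_bundle_gen_rmodule[OF bundles(1)] st1[OF x]])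
      show ?thesis
        by (rule mod_length_le_card_power[OF m ground_field(1) subfield_points_subset[OF x] ground_field(2)])
          (use count[OF xD] in \<open>simp_all add: \<tau>_def q_def\<close>)
    qed
    then have "skyscraper_length F1 D \<tau> \<le> (\<Sum>x\<in>D. enat (n x))"
      unfolding skyscraper_length_def by (rule sum_mono)
    also have "\<dots> = enat (\<Sum>x\<in>D. n x)" by (rule sum_enat)
    also have "\<dots> \<le> enat h" using h by simp
    finally show ?thesis .
  qed
  ultimately show ?thesis using el lift by blast
qed

section \<open>From the span to a subbundle\<close>

text \<open>The vector \<open>y\<close> lifts a generator of the image line in the fibre.\<close>

lemma rank_one_image:
  assumes x: "x \<in> points k" and f: "f \<in> stalk V x" and r1: "fibre_rank_one F2 F1 x f"
  shows "\<exists>y\<in>stalk F1 x. \<forall>u\<in>stalk F2 x. \<exists>a\<in>x. f u - scal F1 a y \<in> max_stalk F1 x"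
proof -
  have dx: "dvr x" using x by (simp add: points_def)
  note cx = points_closed_ring[OF x]
  note ms = max_stalk_rmodule(1)[OF vector_bundle_vector_space[OF bundles(1)] st1[OF x] dx]
  obtain w where w: "w \<in> carrier (fibre F1 x)"
    "(\<lambda>v. f v +o max_stalk F1 x) ` stalk F2 x = proj_point (ring_on x) (fibre F1 x) w"
    using r1 unfolding fibre_rank_one_def by blast
  obtain y where y: "y \<in> stalk F1 x" "w = y +o max_stalk F1 x" using w(1) by (auto simp: fibre_def)
  have "\<exists>a\<in>x. f u - scal F1 a y \<in> max_stalk F1 x" if u: "u \<in> stalk F2 x" for u
  proof -
    have "f u +o max_stalk F1 x \<in> proj_point (ring_on x) (fibre F1 x) w" using w(2) u by blast
    then obtain a where a: "a \<in> x" "f u +o max_stalk F1 x = a \<odot>\<^bsub>fibre F1 x\<^esub> w"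
      unfolding proj_point_def ring_on_simps by blast
    have "a \<odot>\<^bsub>fibre F1 x\<^esub> w = scal F1 a y +o max_stalk F1 x"
      unfolding y(2) fibre_def quot_simps by (rule A.coset_smult[OF ms a(1)])
    then have "f u +o max_stalk F1 x = scal F1 a y +o max_stalk F1 x" using a(2) by simp
    then show ?thesis using A.coset_eq_iff[OF ms cx] a(1) by blast
  qed
  then show ?thesis using y(1) by blast
qed

text \<open>The values of \<open>f\<close> are multiples of one vector \<open>y\<close> up to the maximal
  ideal, and of a coefficient of \<open>y / t\<close> only the residue in \<open>k\<close> matters
  up to regular sections.\<close>

lemma rank_one_pole_values:
  assumes x: "rational_point k x" and t: "t \<in> x" "t \<noteq> 0" "max_ideal x = {t * r | r. r \<in> x}"
    and f: "f \<in> stalk V x" and r1: "fibre_rank_one F2 F1 x f"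
    and g: "g = scal V (c / t) f + w" "c \<in> k" "w \<in> stalk V x"
  shows "\<exists>y\<in>stalk F1 x. \<forall>u\<in>stalk F2 x. \<exists>c0\<in>k. g u - scal F1 (c0 / t) y \<in> stalk F1 x"
proof -
  have xp: "x \<in> points k" using x by (simp add: rational_point_def)
  note a1 = rmoduleD[OF st1[OF xp]]
  note X = closed_ringD[OF points_closed_ring[OF xp]]
  obtain y where y: "y \<in> stalk F1 x" "\<And>u. u \<in> stalk F2 x \<Longrightarrow> \<exists>a\<in>x. f u - scal F1 a y \<in> max_stalk F1 x"
    using rank_one_image[OF xp f r1] by blast
  have "\<exists>c0\<in>k. g u - scal F1 (c0 / t) y \<in> stalk F1 x" if u: "u \<in> stalk F2 x" for u
  proof -
    obtain a where a: "a \<in> x" "f u - scal F1 a y \<in> max_stalk F1 x" using y(2)[OF u] by blast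
    obtain m v where m: "m \<in> max_ideal x" "v \<in> stalk F1 x" "f u - scal F1 a y = scal F1 m v"
      using a(2) unfolding max_stalk_def by blast
    obtain r where r: "m = t * r" "r \<in> x" using m(1) unfolding t(3) by blast
    have cx: "c \<in> x" using g(2) subfield_points_subset[OF xp] by blast
    have "c * a \<in> x" using cx a(1) by (rule X(4))
    then obtain c0 where c0: "c0 \<in> k" "c * a - c0 \<in> max_ideal x" using x unfolding rational_point_def by blast
    then obtain r' where r': "c * a - c0 = t * r'" "r' \<in> x" unfolding t(3) by blast
    have ca: "c / t * a = c0 / t + r'" using r'(1) t(2) by (simp add: field_simps)
    have mt: "c / t * m = c * r" using r(1) t(2) by simp
    have fu: "f u = scal F1 a y + scal F1 m v" using m(3) by (simp add: algebra_simps)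
    have "g u = scal F1 (c / t) (f u) + w u" by (simp add: g(1) hom_bundle_simps)
    also have "\<dots> = scal F1 (c0 / t) y + (scal F1 r' y + scal F1 (c * r) v + w u)"
      unfolding fu A.scale_right_distrib A.scale_scale ca mt A.scale_left_distrib by (simp add: add_ac)
    finally have "g u - scal F1 (c0 / t) y = scal F1 r' y + scal F1 (c * r) v + w u" by simp
    moreover have "w u \<in> stalk F1 x" using g(3) u by (simp add: hom_bundle_simps image_subset_iff)
    moreover have "scal F1 r' y + scal F1 (c * r) v \<in> stalk F1 x"
      using y(1) m(2) r' r cx by (intro a1(2) a1(3) X(4))
    ultimately have "g u - scal F1 (c0 / t) y \<in> stalk F1 x" using a1(2) by metis
    then show ?thesis using c0(1) by blast
  qed
  then show ?thesis using y(1) by blast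
qed

lemma sum_pole_parts_apply:
  assumes "finite T"
  shows "(\<Sum>P\<in>T. pole_part (fst P) (g P)) x = (\<Sum>P\<in>{P\<in>T. fst P = x}. g P)"
  using assms
proof (induction T rule: finite_induct)
  case (insert Q T)
  have "{P\<in>insert Q T. fst P = x} = (if fst Q = x then insert Q {P\<in>T. fst P = x} else {P\<in>T. fst P = x})" by auto
  then show ?case using insert by (simp add: pole_part_def)
qed simp

lemma sum_fun_apply: "(\<Sum>i\<in>I. f i) u = (\<Sum>i\<in>I. f i u)"
  by (induction I rule: infinite_finite_induct) simp_all

text \<open>The class is represented by a sum \<open>p\<close> of poles at the points of \<open>T\<close>.
  At \<open>x\<close> the values of \<open>p\<close> are combinations over \<open>k\<close> of as
  many principal parts as there are points of \<open>T\<close> over \<open>x\<close>, which bounds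
  their number.\<close>

lemma class_in_span_gives_subbundle:
  assumes D: "finite D" "\<forall>x\<in>D. rational_point k x"
    and T: "T \<subseteq> Delta_on F2 F1 D" "finite T" "card T \<le> h"
    and span: "proj_point (ring_on k) (H1 k V) (ext_class k F1 W F2 \<iota> \<pi>) \<subseteq> mod_span (ring_on k) (H1 k V) (\<Union>(psi k V ` T))"
  shows "\<exists>G \<tau>. elementary_transformation k F2 G \<and> lifts_to_subbundle k W \<pi> G \<and>
            quotient_sequence k G F2 F1 \<tau> \<and> prin_subsheaf k F1 \<tau> \<and>
            simple_poles_on k F1 D \<tau> \<and> skyscraper_length F1 D \<tau> \<le> enat h"
proof -
  interpret F: vector_space "\<lambda>a r x. scal V a (r x)" by (rule vector_space_pointwise[OF regular_sheafD(1)[OF hom_regular]])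
  interpret HV: vector_space "scal V" by (rule regular_sheafD(1)[OF hom_regular])
  note N = rational_reps_rmodule[OF hom_regular ground_ring]
  have Dp: "D \<subseteq> points k" using D(2) by (auto simp: rational_point_def)
  define t where "t = (uniformizer :: 'k set \<Rightarrow> 'k)"
  have t: "t x \<in> x \<and> t x \<noteq> 0 \<and> max_ideal x = {t x * r | r. r \<in> x}" if "x \<in> points k" for x
    unfolding t_def by (rule uniformizer) (use that in \<open>simp add: points_def\<close>)
  define good where "good P f \<longleftrightarrow> f \<in> stalk V (fst P) \<and> fibre_rank_one F2 F1 (fst P) f \<and> fst P \<in> D \<and>
     pole_vectors V P = {scal V (c / t (fst P)) f + w | c w. c \<in> k \<and> w \<in> stalk V (fst P)}" for P f
  have PT: "\<exists>f. good P f" if P: "P \<in> T" for P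
  proof -
    obtain x f where f: "P = (x, proj_point (ring_on x) (fibre V x) (f +o max_stalk V x))" "x \<in> D"
      "f \<in> stalk V x" "fibre_rank_one F2 F1 x f" using T(1) P unfolding Delta_on_def by blast
    have xp: "x \<in> points k" using f(2) Dp by blast
    note tx = t[OF xp]
    have "pole_vectors V P = {scal V (c / t x) f + w | c w. c \<in> k \<and> w \<in> stalk V x}"
      unfolding f(1) by (rule pole_vectors_line[OF regular_sheafD(1)[OF hom_regular] regular_sheafD(3)[OF hom_regular xp] D(2)[rule_format, OF f(2)] ground_ring
        tx[THEN conjunct1] tx[THEN conjunct2, THEN conjunct1] tx[THEN conjunct2, THEN conjunct2] f(3)])
    then show ?thesis unfolding good_def using f by (intro exI[of _ f]) simp
  qed
  then obtain f where "\<And>P. P \<in> T \<Longrightarrow> good P (f P)" by metis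
  note gf = this[unfolded good_def]
  note f = gf[THEN conjunct1] gf[THEN conjunct2, THEN conjunct1] gf[THEN conjunct2, THEN conjunct2, THEN conjunct1]
    gf[THEN conjunct2, THEN conjunct2, THEN conjunct2]
  have pv: "fst P \<in> points k \<and> rmodule (scal V) k (pole_vectors V P) \<and> pole_vectors V P \<subseteq> gen V" if P: "P \<in> T" for P
  proof (intro conjI)
    show xp: "fst P \<in> points k" using f(3)[OF P] Dp by blast
    note s = rmoduleD[OF regular_sheafD(3)[OF hom_regular xp]]
    note gm = rmoduleD[OF regular_sheafD(2)[OF hom_regular]]
    have fg: "f P \<in> gen V" "\<And>w. w \<in> stalk V (fst P) \<Longrightarrow> w \<in> gen V" using regular_sheafD(4)[OF hom_regular xp] f(1)[OF P] by blast+
    show "pole_vectors V P \<subseteq> gen V"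
    proof
      fix g assume "g \<in> pole_vectors V P"
      then obtain c w where c: "g = scal V (c / t (fst P)) (f P) + w" "w \<in> stalk V (fst P)" unfolding f(4)[OF P] by blast
      show "g \<in> gen V" unfolding c(1) by (intro gm(2) gm(3) fg c(2)) simp
    qed
    show "rmodule (scal V) k (pole_vectors V P)"
      unfolding rmodule_def f(4)[OF P]
    proof (intro conjI ballI)
      show "0 \<in> {scal V (c / t (fst P)) (f P) + w | c w. c \<in> k \<and> w \<in> stalk V (fst P)}"
        using s(1) closed_ringD(1)[OF ground_ring] by (intro CollectI exI[of _ 0]) simp
      fix g g' assume "g \<in> {scal V (c / t (fst P)) (f P) + w | c w. c \<in> k \<and> w \<in> stalk V (fst P)}"
        "g' \<in> {scal V (c / t (fst P)) (f P) + w | c w. c \<in> k \<and> w \<in> stalk V (fst P)}"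
      then obtain c w c' w' where c: "g = scal V (c / t (fst P)) (f P) + w" "c \<in> k" "w \<in> stalk V (fst P)"
        "g' = scal V (c' / t (fst P)) (f P) + w'" "c' \<in> k" "w' \<in> stalk V (fst P)" by blast
      have "g + g' = scal V ((c + c') / t (fst P)) (f P) + (w + w')"
        unfolding c add_divide_distrib HV.scale_left_distrib by (simp only: add_ac)
      then show "g + g' \<in> {scal V (c / t (fst P)) (f P) + w | c w. c \<in> k \<and> w \<in> stalk V (fst P)}"
        using closed_ringD(3)[OF ground_ring c(2,5)] s(2)[OF c(3,6)] by blast
    next
      fix a g assume a: "a \<in> k" "g \<in> {scal V (c / t (fst P)) (f P) + w | c w. c \<in> k \<and> w \<in> stalk V (fst P)}"
      then obtain c w where c: "g = scal V (c / t (fst P)) (f P) + w" "c \<in> k" "w \<in> stalk V (fst P)" by blast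
      have "scal V a g = scal V ((a * c) / t (fst P)) (f P) + scal V a w"
        unfolding c HV.scale_right_distrib HV.scale_scale by simp
      then show "scal V a g \<in> {scal V (c / t (fst P)) (f P) + w | c w. c \<in> k \<and> w \<in> stalk V (fst P)}"
        using closed_ringD(4)[OF ground_ring a(1) c(2)] s(3)[OF subsetD[OF subfield_points_subset[OF xp] a(1)] c(3)] by blast
    qed
  qed
  \<comment> \<open>in the cokernel the multiple of \<open>E\<close> by 1 is \<open>E + rational_reps k V\<close>; this is the coset of \<open>p\<close>, so \<open>p\<close> differs from an element of \<open>E\<close> by a rational principal part\<close>
  define E where "E = ext_class k F1 W F2 \<iota> \<pi>"
  have "(1 \<odot>\<^bsub>H1 k V\<^esub> E) \<in> proj_point (ring_on k) (H1 k V) E"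
    unfolding proj_point_def ring_on_simps using closed_ringD(2)[OF ground_ring] by blast
  then have "(1 \<odot>\<^bsub>H1 k V\<^esub> E) \<in> mod_span (ring_on k) (H1 k V) (\<Union>(psi k V ` T))" using span E_def by blast
  then obtain g where g: "\<And>P. P \<in> T \<Longrightarrow> g P \<in> pole_vectors V P"
    "1 \<odot>\<^bsub>H1 k V\<^esub> E = (\<Sum>P\<in>T. pole_part (fst P) (g P)) +o rational_reps k V"
    using span_of_poles[OF hom_regular ground_ring pv _ T(2)] by blast
  define p where "p = (\<Sum>P\<in>T. pole_part (fst P) (g P))"
  have px: "p x = (\<Sum>P\<in>{P\<in>T. fst P = x}. g P)" for x
    unfolding p_def by (rule sum_pole_parts_apply[OF T(2)])
  have pp: "p \<in> prin_reps k V" unfolding p_def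
    using pv g(1) by (intro rmodule_sum[OF prin_reps_rmodule[OF hom_regular ground_ring]] pole_part_prin_reps[OF hom_regular]) blast+
  have "1 \<odot>\<^bsub>H1 k V\<^esub> E = E + rational_reps k V" by (simp add: H1_def)
  then have "p \<in> E + rational_reps k V" using g(2) F.coset_self[OF N, of p] by (simp add: p_def)
  then obtain p' n where p': "p' \<in> E" "n \<in> rational_reps k V" "p = p' + n" by (auto simp: set_plus_def)
  obtain s where "splits_with_poles s p"
    using ext_class_splits[of p'] splits_translate[of _ p' n] p' unfolding E_def by blast
  have pole_values: "\<exists>y\<in>stalk F1 (fst P). \<forall>u\<in>stalk F2 (fst P). \<exists>c0\<in>k. g P u - scal F1 (c0 / t (fst P)) y \<in> stalk F1 (fst P)"
    if P: "P \<in> T" for P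
  proof -
    note tx = t[OF pv[OF P, THEN conjunct1]]
    obtain c w where c: "g P = scal V (c / t (fst P)) (f P) + w" "c \<in> k" "w \<in> stalk V (fst P)"
      using g(1)[OF P] unfolding f(4)[OF P] by blast
    show ?thesis
      by (rule rank_one_pole_values[OF D(2)[rule_format, OF f(3)[OF P]] tx[THEN conjunct1] tx[THEN conjunct2, THEN conjunct1]
        tx[THEN conjunct2, THEN conjunct2] f(1)[OF P] f(2)[OF P] c])
  qed
  then obtain y where y: "\<And>P. P \<in> T \<Longrightarrow> y P \<in> stalk F1 (fst P)"
    "\<And>P u. P \<in> T \<Longrightarrow> u \<in> stalk F2 (fst P) \<Longrightarrow> \<exists>c0\<in>k. g P u - scal F1 (c0 / t (fst P)) (y P) \<in> stalk F1 (fst P)" by metis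
  define Tx where "Tx x = {P\<in>T. fst P = x}" for x
  have vals: "\<exists>c. (\<forall>P\<in>Tx x. c P \<in> k) \<and> p x u - (\<Sum>P\<in>Tx x. scal F1 (c P / t x) (y P)) \<in> stalk F1 x"
    if x: "x \<in> D" and u: "u \<in> stalk F2 x" for x u
  proof -
    have xp: "x \<in> points k" using x Dp by blast
    have "\<forall>P\<in>Tx x. \<exists>c0. c0 \<in> k \<and> g P u - scal F1 (c0 / t x) (y P) \<in> stalk F1 x"
      using y(2) u unfolding Tx_def by blast
    then obtain c where c: "\<forall>P\<in>Tx x. c P \<in> k \<and> g P u - scal F1 (c P / t x) (y P) \<in> stalk F1 x" by metis
    have "p x u - (\<Sum>P\<in>Tx x. scal F1 (c P / t x) (y P)) = (\<Sum>P\<in>Tx x. g P u - scal F1 (c P / t x) (y P))"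
      unfolding px Tx_def sum_fun_apply by (rule sum_subtractf[symmetric])
    also have "\<dots> \<in> stalk F1 x" using c by (intro rmodule_sum[OF st1[OF xp]]) blast
    finally show ?thesis using c by blast
  qed
  show ?thesis
  proof (rule splitting_gives_subbundle[OF \<open>splits_with_poles s p\<close> pp D])
    show "p x = 0" if "x \<in> points k - D" for x
    proof -
      have "{P\<in>T. fst P = x} = {}" using f(3) that by blast
      then show ?thesis unfolding px by (simp only: sum.empty)
    qed
    show "scal F1 a (p x u) \<in> stalk F1 x" if x: "x \<in> D" and a: "a \<in> max_ideal x" and u: "u \<in> stalk F2 x" for x a u
    proof -
      have xp: "x \<in> points k" using x Dp by blast
      note a1 = rmoduleD[OF st1[OF xp]]
      note tx = t[OF xp]
      obtain r where r: "a = t x * r" "r \<in> x" using a tx by blast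
      have ax: "a \<in> x" using a max_ideal_subset by blast
      obtain c where c: "\<And>P. P \<in> Tx x \<Longrightarrow> c P \<in> k" "p x u - (\<Sum>P\<in>Tx x. scal F1 (c P / t x) (y P)) \<in> stalk F1 x"
        using vals[OF x u] by blast
      have "scal F1 a (p x u) = scal F1 a (p x u - (\<Sum>P\<in>Tx x. scal F1 (c P / t x) (y P))) + (\<Sum>P\<in>Tx x. scal F1 (r * c P) (y P))"
        using tx r(1) by (simp add: A.scale_right_diff_distrib A.scale_sum_right)
      also have "\<dots> \<in> stalk F1 x"
      proof (intro a1(2) a1(3)[OF ax c(2)] rmodule_sum[OF st1[OF xp]] a1(3))
        fix P assume P: "P \<in> Tx x"
        show "r * c P \<in> x"
          using r(2) c(1)[OF P] subfield_points_subset[OF xp] by (intro closed_ringD(4)[OF points_closed_ring[OF xp]]) auto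
        show "y P \<in> stalk F1 x" using y(1)[of P] P unfolding Tx_def by blast
      qed
      finally show ?thesis .
    qed
    show "finite ((\<lambda>u. p x u +o stalk F1 x) ` stalk F2 x) \<and>
      card ((\<lambda>u. p x u +o stalk F1 x) ` stalk F2 x) \<le> card k ^ card (Tx x)" if x: "x \<in> D" for x
    proof -
      have xp: "x \<in> points k" using x Dp by blast
      have finT: "finite (Tx x)" using T(2) by (simp add: Tx_def)
      let ?Y = "(\<lambda>c. (\<Sum>P\<in>Tx x. scal F1 (c P / t x) (y P)) +o stalk F1 x) ` (PiE (Tx x) (\<lambda>_. k))"
      have finP: "finite (PiE (Tx x) (\<lambda>_. k))" using finT ground_field(2) by (intro finite_PiE) auto
      have sub: "(\<lambda>u. p x u +o stalk F1 x) ` stalk F2 x \<subseteq> ?Y"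
      proof
        fix A assume "A \<in> (\<lambda>u. p x u +o stalk F1 x) ` stalk F2 x"
        then obtain u where u: "A = p x u +o stalk F1 x" "u \<in> stalk F2 x" by blast
        obtain c where c: "\<forall>P\<in>Tx x. c P \<in> k" "p x u - (\<Sum>P\<in>Tx x. scal F1 (c P / t x) (y P)) \<in> stalk F1 x"
          using vals[OF x u(2)] by blast
        have "A = (\<Sum>P\<in>Tx x. scal F1 (c P / t x) (y P)) +o stalk F1 x"
          unfolding u(1) using A.coset_eq_iff[OF st1[OF xp] points_closed_ring[OF xp]] c(2) by blast
        also have "(\<Sum>P\<in>Tx x. scal F1 (c P / t x) (y P)) = (\<Sum>P\<in>Tx x. scal F1 (restrict c (Tx x) P / t x) (y P))"
          by (rule sum.cong) simp_all
        finally have A: "A = (\<Sum>P\<in>Tx x. scal F1 (restrict c (Tx x) P / t x) (y P)) +o stalk F1 x" .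
        have "restrict c (Tx x) \<in> PiE (Tx x) (\<lambda>_. k)" using c(1) by (auto simp: PiE_iff extensional_def)
        then show "A \<in> ?Y" using A by (intro image_eqI[where x = "restrict c (Tx x)"])
      qed
      have "card ?Y \<le> card (PiE (Tx x) (\<lambda>_. k))" by (rule card_image_le[OF finP])
      also have "\<dots> = card k ^ card (Tx x)" using finT by (simp add: card_PiE)
      finally have cY: "card ?Y \<le> card k ^ card (Tx x)" .
      have fY: "finite ?Y" using finP by (rule finite_imageI)
      show ?thesis by (rule conjI[OF finite_subset[OF sub fY] order_trans[OF card_mono[OF fY sub] cY]])
    qed
    have "(\<Sum>x\<in>D. card (Tx x)) = card T"
      using sum.group[OF T(2) D(1), of fst "\<lambda>_. 1::nat"] f(3) unfolding Tx_def by (simp add: image_subset_iff)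
    then show "(\<Sum>x\<in>D. card (Tx x)) \<le> h" using T(3) by simp
  qed
qed

end

section \<open>From a subbundle to the span\<close>

text \<open>Choose a basis with as few elements as possible outside the kernel \<open>K\<close> of
  \<open>q\<close>. The images of these elements generate a strictly increasing chain of
  submodules: if the image of one of them lay in the module generated by the images of the
  preceding ones, then a combination of the preceding elements could be subtracted from it to
  obtain a basis with one more element in \<open>K\<close>.\<close>

lemma (in vector_space) basis_adapted_to_kernel:
  fixes M :: "('a, 'm, 'z) module_scheme"
  assumes R: "dvr R" and M: "Module.module (ring_on R) M"
    and B0: "finite B0" "independent B0"
    and qadd: "\<And>u v. u \<in> lspan scale R B0 \<Longrightarrow> v \<in> lspan scale R B0 \<Longrightarrow> q (u + v) = q u \<oplus>\<^bsub>M\<^esub> q v"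
    and qscale: "\<And>a v. a \<in> R \<Longrightarrow> v \<in> lspan scale R B0 \<Longrightarrow> q (a *s v) = a \<odot>\<^bsub>M\<^esub> q v"
    and qim: "q ` lspan scale R B0 = \<tau>" "\<tau> \<subseteq> carrier M"
    and ker: "{v \<in> lspan scale R B0. q v = \<zero>\<^bsub>M\<^esub>} = K"
  shows "\<exists>B. finite B \<and> independent B \<and> lspan scale R B = lspan scale R B0 \<and>
    enat (card (B - K)) \<le> mod_length (ring_on R) M \<tau>"
proof -
  interpret M: Module.module "ring_on R" M by (rule M)
  note cR = dvr_closed_ring[OF R]
  note R' = closed_ringD[OF cR]
  define L where "L = lspan scale R B0"
  note Lm = lspan_rmodule[OF cR, of B0, folded L_def]
  define good where "good B \<longleftrightarrow> finite B \<and> independent B \<and> lspan scale R B = L" for B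
  have "good B0" using B0 by (simp add: good_def L_def)
  define B where "B = arg_min (\<lambda>B. card (B - K)) good"
  have B: "good B" and min: "\<And>B'. good B' \<Longrightarrow> card (B - K) \<le> card (B' - K)"
    using arg_min_natI[of good B0 "\<lambda>B. card (B - K)"] arg_min_nat_le[of good _ "\<lambda>B. card (B - K)"] \<open>good B0\<close>
    unfolding B_def by auto
  have Bf: "finite B" "independent B" and BL: "lspan scale R B = L" using B by (simp_all add: good_def)
  have BsubL: "B \<subseteq> L" using lspan_superset[OF cR Bf(1)] BL by simp
  define J where "J = B - K"
  define n where "n = card J"
  have finJ: "finite J" using Bf by (simp add: J_def)
  obtain j where j: "bij_betw j {0..<n} J" using ex_bij_betw_nat_finite[OF finJ] unfolding n_def by blast
  have jJ: "j i \<in> J" if "i < n" for i using bij_betwE[OF j] that by simp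
  have jinj: "j i = j i' \<longleftrightarrow> i = i'" if "i < n" "i' < n" for i i'
    using bij_betw_imp_inj_on[OF j] that by (simp add: inj_on_eq_iff)
  define P where "P i = lspan scale R (j ` {..<i})" for i
  have Pm: "rmodule scale R (P i)" for i unfolding P_def by (rule lspan_rmodule[OF cR])
  have jsub: "j ` {..<i} \<subseteq> J" if "i \<le> n" for i using jJ that by auto
  have PL: "P i \<subseteq> L" if "i \<le> n" for i
    unfolding P_def using jsub[OF that] BsubL by (intro lspan_minimal[OF Lm]) (auto simp: J_def)
  have qc: "q v \<in> carrier M" if "v \<in> L" for v using qim that unfolding L_def by blast
  have qz: "q 0 = \<zero>\<^bsub>M\<^esub>"
    using qscale[OF R'(1) rmoduleD(1)[OF Lm[unfolded L_def]]] M.smult_l_null[OF qc[OF rmoduleD(1)[OF Lm]]] by simp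
  have sub: "submodule (q ` P i) (ring_on R) M" if i: "i \<le> n" for i
  proof (rule M.submoduleI)
    note Pi = rmoduleD[OF Pm[of i]]
    show "q ` P i \<subseteq> carrier M" using qc PL[OF i] by blast
    show "\<zero>\<^bsub>M\<^esub> \<in> q ` P i" using Pi(1) qz by (metis imageI)
    show "a \<oplus>\<^bsub>M\<^esub> b \<in> q ` P i" if ab: "a \<in> q ` P i" "b \<in> q ` P i" for a b
    proof -
      obtain u v where u: "a = q u" "u \<in> P i" and v: "b = q v" "v \<in> P i" using ab by blast
      have "a \<oplus>\<^bsub>M\<^esub> b = q (u + v)" unfolding u v
        by (rule qadd[symmetric]) (use u v PL[OF i] in \<open>unfold L_def, blast+\<close>)
      then show ?thesis using Pi(2)[OF u(2) v(2)] by (metis imageI)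
    qed
    show sm: "c \<odot>\<^bsub>M\<^esub> a \<in> q ` P i" if ab: "c \<in> carrier (ring_on R)" "a \<in> q ` P i" for c a
    proof -
      obtain u where u: "a = q u" "u \<in> P i" using ab by blast
      have "c \<odot>\<^bsub>M\<^esub> a = q (c *s u)" unfolding u
        by (rule qscale[symmetric]) (use ab u PL[OF i] in \<open>unfold L_def, auto\<close>)
      then show ?thesis using Pi(3)[of c u] ab(1) u(2) by (metis imageI ring_on_simps(1))
    qed
    show "\<ominus>\<^bsub>M\<^esub> a \<in> q ` P i" if a: "a \<in> q ` P i" for a
    proof -
      obtain u where u: "a = q u" "u \<in> P i" using a by blast
      have uL: "u \<in> L" using u PL[OF i] by blast
      have mu: "- u \<in> P i" by (rule rmodule_uminus(1)[OF Pm cR u(2)])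
      then have muL: "- u \<in> L" using PL[OF i] by blast
      have "q (- u) \<oplus>\<^bsub>M\<^esub> q u = q (- u + u)" using qadd[of "- u" u] muL uL unfolding L_def by simp
      then have "q (- u) \<oplus>\<^bsub>M\<^esub> a = \<zero>\<^bsub>M\<^esub>" using qz u(1) by simp
      then have "\<ominus>\<^bsub>M\<^esub> a = q (- u)" using u(1) qc[OF uL] qc[OF muL] by (intro M.minus_equality) simp_all
      then show ?thesis using mu by (metis imageI)
    qed
  qed
  have strict: "q ` P i \<subset> q ` P (Suc i)" if i: "i < n" for i
  proof
    have "P i \<subseteq> P (Suc i)"
      unfolding P_def using lspan_superset[OF cR, of "j ` {..<Suc i}"]
      by (intro lspan_minimal lspan_rmodule[OF cR]) (auto simp: lessThan_Suc)
    then show "q ` P i \<subseteq> q ` P (Suc i)" by blast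
    have "j i \<in> P (Suc i)" unfolding P_def using lspan_superset[OF cR, of "j ` {..<Suc i}"] by auto
    moreover have "q (j i) \<notin> q ` P i"
    proof
      assume "q (j i) \<in> q ` P i"
      then obtain w where w: "w \<in> P i" "q (j i) = q w" by blast
      have wL: "w \<in> L" using w(1) PL[of i] i by auto
      have jB: "j i \<in> B" "j i \<notin> K" using jJ[OF i] by (simp_all add: J_def)
      have jL: "j i \<in> L" using jB(1) BsubL by blast
      define b where "b = j i - w"
      have bL: "b \<in> L" unfolding b_def by (rule rmodule_uminus(2)[OF Lm cR jL wL])
      have "q (b + w) = q b \<oplus>\<^bsub>M\<^esub> q w" using qadd[of b w] bL wL unfolding L_def by simp
      then have "q b \<oplus>\<^bsub>M\<^esub> q w = q w" using w(2) by (simp add: b_def)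
      then have "q b = \<zero>\<^bsub>M\<^esub>" using qc[OF bL] qc[OF wL] by simp
      then have bK: "b \<in> K" using bL ker unfolding L_def by blast
      define B' where "B' = insert b (B - {j i})"
      have finB': "finite B'" using Bf by (simp add: B'_def)
      note B'l = lspan_superset[OF cR finB']
      have "j ` {..<i} \<subseteq> B - {j i}"
      proof
        fix c assume "c \<in> j ` {..<i}"
        then obtain l where l: "l < i" "c = j l" by blast
        then show "c \<in> B - {j i}" using jJ[of l] jinj[of l i] i by (simp add: J_def)
      qed
      then have Psub: "P i \<subseteq> lspan scale R B'" and Pspan: "P i \<subseteq> span (B - {j i})"
        using B'l lspan_mono_span[of R "j ` {..<i}"] span_mono[of "j ` {..<i}" "B - {j i}"]
        unfolding P_def B'_def by (intro lspan_minimal lspan_rmodule[OF cR], blast, blast)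
      have bB': "b \<in> B'" by (simp add: B'_def)
      then have "b + w \<in> lspan scale R B'"
        using B'l Psub w(1) by (intro rmoduleD(2)[OF lspan_rmodule[OF cR]]) blast+
      then have jl: "j i \<in> lspan scale R B'" by (simp add: b_def)
      have "lspan scale R B' = L"
      proof
        show "lspan scale R B' \<subseteq> L" using bL BsubL by (intro lspan_minimal[OF Lm]) (auto simp: B'_def)
        have "B \<subseteq> lspan scale R B'" using jl B'l by (auto simp: B'_def)
        then show "L \<subseteq> lspan scale R B'" unfolding BL[symmetric] by (intro lspan_minimal lspan_rmodule[OF cR])
      qed
      moreover have "independent B'"
      proof -
        have "b \<notin> span (B - {j i})"
        proof
          assume "b \<in> span (B - {j i})"
          then have "b + w \<in> span (B - {j i})" using Pspan w(1) by (intro span_add) blast+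
          then have "j i \<in> span (B - {j i})" by (simp add: b_def)
          then show False using Bf(2) jB(1) by (auto simp: dependent_def)
        qed
        then show ?thesis unfolding B'_def by (intro independent_insertI independent_mono[OF Bf(2)]) auto
      qed
      ultimately have "good B'" using finB' by (simp add: good_def)
      then have "card (B - K) \<le> card (B' - K)" by (rule min)
      moreover have "B' - K = (B - K) - {j i}" using bK by (auto simp: B'_def)
      moreover have "card ((B - K) - {j i}) < card (B - K)"
        using jB Bf(1) by (intro card_Diff1_less) auto
      ultimately show False by simp
    qed
    ultimately show "q ` P i \<noteq> q ` P (Suc i)" by blast
  qed
  have "enat n \<le> mod_length (ring_on R) M \<tau>"
    unfolding mod_length_def
  proof (rule Sup_upper, intro CollectI exI[of _ n] conjI exI[of _ "\<lambda>i. q ` P i"] allI impI refl)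
    show "submodule (q ` P i) (ring_on R) M" if "i \<le> n" for i by (rule sub[OF that])
    show "q ` P i \<subseteq> \<tau>" if "i \<le> n" for i using PL[OF that] unfolding qim(1)[symmetric] L_def by blast
    show "q ` P i \<subset> q ` P (Suc i)" if "i < n" for i by (rule strict[OF that])
  qed
  then show ?thesis using Bf BL unfolding n_def J_def L_def by blast
qed

lemma (in vector_space) subspace_eq_if_dim_eq:
  assumes "subspace U" "U \<subseteq> span S" "finite S" "dim U = dim (span S)"
  shows "U = span S"
proof -
  obtain B where B: "B \<subseteq> U" "independent B" "U \<subseteq> span B" "card B = dim U" by (rule basis_exists)
  have finB: "finite B" using independent_span_bound[OF assms(3) B(2)] B(1) assms(2) by blast
  have spB: "span B = U" using B(1,3) span_minimal[OF B(1) assms(1)] by blast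
  show ?thesis
  proof (rule ccontr)
    assume "U \<noteq> span S"
    then obtain v where v: "v \<in> span S" "v \<notin> span B" using assms(2) spB by blast
    then have ind: "independent (insert v B)" using B(2) by (intro independent_insertI)
    have "dim (insert v B) = card (insert v B)" by (rule dim_eq_card_independent[OF ind])
    moreover have "v \<notin> B" using v(2) span_base by blast
    ultimately have d: "dim (insert v B) = Suc (dim U)" using finB B(4) by simp
    obtain C where C: "C \<subseteq> span S" "independent C" "span S \<subseteq> span C" "card C = dim (span S)" by (rule basis_exists)
    have finC: "finite C" using independent_span_bound[OF assms(3) C(2) C(1)] by blast
    have "insert v B \<subseteq> span C" using v(1) B(1) assms(2) C(3) by blast
    then have "dim (insert v B) \<le> card C" by (rule dim_le_card[OF _ finC])
    then show False using d C(4) assms(4) by simp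
  qed
qed

context curve_extension
begin

text \<open>Two rational splittings differ by \<open>\<iota> d\<close> for a rational homomorphism
  \<open>d\<close>, and their polar parts then differ by \<open>d\<close> up to regular
  homomorphisms.\<close>

lemma ext_class_coset:
  assumes p: "p \<in> ext_class k F1 W F2 \<iota> \<pi>"
  shows "ext_class k F1 W F2 \<iota> \<pi> \<subseteq> p +o rational_reps k V"
proof
  interpret F: vector_space "\<lambda>a r x. scal V a (r x)" by (rule vector_space_pointwise[OF regular_sheafD(1)[OF hom_regular]])
  fix p' assume p': "p' \<in> ext_class k F1 W F2 \<iota> \<pi>"
  note pr = ext_class_splits(1)[OF p] and pr' = ext_class_splits(1)[OF p']
  obtain s where s: "s \<in> gen (hom_bundle F2 W)" "\<forall>v\<in>gen F2. \<pi> (s v) = v"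
    "\<forall>x\<in>points k. (\<lambda>v. s v - \<iota> (p x v)) \<in> stalk (hom_bundle F2 W) x"
    using p unfolding ext_class_def by blast
  obtain s' where s': "s' \<in> gen (hom_bundle F2 W)" "\<forall>v\<in>gen F2. \<pi> (s' v) = v"
    "\<forall>x\<in>points k. (\<lambda>v. s' v - \<iota> (p' x v)) \<in> stalk (hom_bundle F2 W) x"
    using p' unfolding ext_class_def by blast
  have sl: "gen_linear F2 W s" "gen_linear F2 W s'" using s s' by (simp_all add: hom_bundle_simps)
  \<comment> \<open>two rational splittings differ by a rational section of Hom(F2, F1)\<close>
  have "\<exists>v. v \<in> gen F1 \<and> \<iota> v = s' u - s u" if u: "u \<in> gen F2" for u
  proof -
    have g: "s' u \<in> gen W" "s u \<in> gen W" using gen_linearD(1)[OF sl(1) u] gen_linearD(1)[OF sl(2) u] by simp_all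
    have "s' u - s u \<in> gen W"
      by (rule B.rmodule_uminus(2)[OF vector_bundle_gen_rmodule[OF bundles(2)] ground_ring g])
    moreover have "\<pi> (s' u - s u) = 0" using gen_linear_diff[OF bundles(2) maps(2) g] s s' u by simp
    ultimately show ?thesis using pi_kernel by blast
  qed
  then obtain d0 where d0: "\<And>u. u \<in> gen F2 \<Longrightarrow> d0 u \<in> gen F1 \<and> \<iota> (d0 u) = s' u - s u" by metis
  define d where "d u = (if u \<in> gen F2 then d0 u else 0)" for u
  have d: "d u \<in> gen F1" "\<iota> (d u) = s' u - s u" if "u \<in> gen F2" for u using d0[OF that] that by (simp_all add: d_def)
  have inj: "a = b" if "a \<in> gen F1" "b \<in> gen F1" "\<iota> a = \<iota> b" for a b
  proof -
    have "a - b \<in> gen F1" by (rule A.rmodule_uminus(2)[OF vector_bundle_gen_rmodule[OF bundles(1)] ground_ring that(1,2)])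
    moreover have "\<iota> (a - b) = 0" using gen_linear_diff[OF bundles(1) maps(1) that(1,2)] that(3) by simp
    ultimately show ?thesis using iota_inj by fastforce
  qed
  note g1 = rmoduleD[OF vector_bundle_gen_rmodule[OF bundles(1), of UNIV]]
  note g2 = rmoduleD[OF vector_bundle_gen_rmodule[OF bundles(3), of UNIV]]
  have dl: "gen_linear F2 F1 d"
    unfolding gen_linear_def
  proof (intro conjI ballI allI)
    show "d v \<in> gen F1" if "v \<in> gen F2" for v by (rule d(1)[OF that])
    show "d (v + w) = d v + d w" if v: "v \<in> gen F2" and w: "w \<in> gen F2" for v w
    proof (rule inj)
      show "d (v + w) \<in> gen F1" "d v + d w \<in> gen F1" using d(1) g1(2) g2(2) v w by simp_all
      show "\<iota> (d (v + w)) = \<iota> (d v + d w)"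
        using gen_linearD(2)[OF maps(1) d(1)[OF v] d(1)[OF w]] d(2)[OF v] d(2)[OF w] d(2)[OF g2(2)[OF v w]]
          gen_linearD(2)[OF sl(1) v w] gen_linearD(2)[OF sl(2) v w] by simp
    qed
    show "d (scal F2 a v) = scal F1 a (d v)" if v: "v \<in> gen F2" for a v
    proof (rule inj)
      show "d (scal F2 a v) \<in> gen F1" "scal F1 a (d v) \<in> gen F1" using d(1) g1(3) g2(3) v by simp_all
      show "\<iota> (d (scal F2 a v)) = \<iota> (scal F1 a (d v))"
        using gen_linearD(3)[OF maps(1) d(1)[OF v], of a] d(2)[OF v] d(2)[OF g2(3)[OF UNIV_I v], of a]
          gen_linearD(3)[OF sl(1) v, of a] gen_linearD(3)[OF sl(2) v, of a]
        by (simp add: B.scale_right_diff_distrib)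
    qed
  qed
  have dV: "d \<in> gen V" using dl by (simp add: hom_bundle_simps d_def)
  have prd: "p' - p \<in> prin_reps k V"
    using F.rmodule_uminus(2)[OF prin_reps_rmodule[OF hom_regular ground_ring] ground_ring pr' pr] .
  have "(p' - p) x - d \<in> stalk V x" if x: "x \<in> points k" for x
  proof -
    have gm: "(p' - p) x - d \<in> gen V"
    proof -
      interpret HV: vector_space "scal V" by (rule regular_sheafD(1)[OF hom_regular])
      show ?thesis using HV.rmodule_uminus(2)[OF rmodule_mono[OF regular_sheafD(2)[OF hom_regular] subset_UNIV] ground_ring prin_repsD(1)[OF prd x] dV] .
    qed
    moreover have "((p' - p) x - d) u \<in> stalk F1 x" if u: "u \<in> stalk F2 x" for u
    proof (rule iota_stalk_reflect[OF x])
      have ug: "u \<in> gen F2" by (rule stalk_gen(3)[OF x u])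
      have g: "p' x u \<in> gen F1" "p x u \<in> gen F1"
        using gen_linearD(1)[OF prin_reps_hom(1)[OF pr' x] ug] gen_linearD(1)[OF prin_reps_hom(1)[OF pr x] ug] by simp_all
      have g': "p' x u - p x u \<in> gen F1"
        by (rule A.rmodule_uminus(2)[OF vector_bundle_gen_rmodule[OF bundles(1)] ground_ring g])
      show "((p' - p) x - d) u \<in> gen F1"
        using A.rmodule_uminus(2)[OF vector_bundle_gen_rmodule[OF bundles(1)] ground_ring g' d(1)[OF ug]] by simp
      have 1: "s u - \<iota> (p x u) \<in> stalk W x" "s' u - \<iota> (p' x u) \<in> stalk W x"
        using s(3) s'(3) x u by (simp_all add: hom_bundle_simps image_subset_iff)
      have "\<iota> (((p' - p) x - d) u) = (s u - \<iota> (p x u)) - (s' u - \<iota> (p' x u))"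
        using gen_linear_diff[OF bundles(1) maps(1) g' d(1)[OF ug]] gen_linear_diff[OF bundles(1) maps(1) g] d(2)[OF ug]
        by simp
      then show "\<iota> (((p' - p) x - d) u) \<in> stalk W x"
        using B.rmodule_uminus(2)[OF stW[OF x] points_closed_ring[OF x] 1] by simp
    qed
    ultimately show ?thesis by (simp add: hom_bundle_simps image_subset_iff)
  qed
  then have n: "p' - p \<in> rational_reps k V" by (rule rational_repsI[OF prd dV])
  have "p' = p + (p' - p)" by simp
  then show "p' \<in> p +o rational_reps k V" using n unfolding elt_set_plus_def by blast
qed

text \<open>The definition of the class asks for sections normalised to vanish outside \<open>gen
  F2\<close>; cutting off \<open>s\<close> achieves this.\<close>

lemma ext_class_memI:
  assumes s: "splits_with_poles s p" and p: "p \<in> prin_reps k V"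
  shows "p \<in> ext_class k F1 W F2 \<iota> \<pi>"
proof -
  note S = s[unfolded splits_with_poles_def]
  define s' where "s' v = (if v \<in> gen F2 then s v else 0)" for v
  note g2 = rmoduleD[OF vector_bundle_gen_rmodule[OF bundles(3), of UNIV]]
  have sl: "gen_linear F2 W s" using S by blast
  have sl': "gen_linear F2 W s'"
    using gen_linearD[OF sl] g2 by (simp add: gen_linear_def s'_def)
  have gs: "s' \<in> gen (hom_bundle F2 W)" using sl' by (simp add: hom_bundle_simps s'_def)
  have ps: "\<forall>v\<in>gen F2. \<pi> (s' v) = v" using S by (simp add: s'_def)
  have reg: "(\<lambda>v. s' v - \<iota> (p x v)) \<in> stalk (hom_bundle F2 W) x" if x: "x \<in> points k" for x
  proof -
    note pl = prin_reps_hom[OF p x]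
    note gW = vector_bundle_gen_rmodule[OF bundles(2), of k]
    have "gen_linear F2 W (\<lambda>v. s' v - \<iota> (p x v))"
      unfolding gen_linear_def
    proof (intro conjI ballI allI)
      show "s' v - \<iota> (p x v) \<in> gen W" if "v \<in> gen F2" for v
        by (rule B.rmodule_uminus(2)[OF gW ground_ring gen_linearD(1)[OF sl' that]
          gen_linearD(1)[OF maps(1) gen_linearD(1)[OF pl(1) that]]])
      show "s' (v + w) - \<iota> (p x (v + w)) = s' v - \<iota> (p x v) + (s' w - \<iota> (p x w))"
        if v: "v \<in> gen F2" and w: "w \<in> gen F2" for v w
        using gen_linearD(2)[OF sl' v w] gen_linearD(2)[OF pl(1) v w]
          gen_linearD(2)[OF maps(1) gen_linearD(1)[OF pl(1) v] gen_linearD(1)[OF pl(1) w]] by simp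
      show "s' (scal F2 a v) - \<iota> (p x (scal F2 a v)) = scal W a (s' v - \<iota> (p x v))" if v: "v \<in> gen F2" for a v
        using gen_linearD(3)[OF sl' v, of a] gen_linearD(3)[OF pl(1) v, of a]
          gen_linearD(3)[OF maps(1) gen_linearD(1)[OF pl(1) v], of a] by (simp add: B.scale_right_diff_distrib)
    qed
    moreover have "s' v - \<iota> (p x v) = 0" if "v \<notin> gen F2" for v
      using pl(2)[OF that] that gen_linear_zero[OF bundles(1,2) maps(1)] by (simp add: s'_def)
    moreover have "s' v - \<iota> (p x v) \<in> stalk W x" if "v \<in> stalk F2 x" for v
      using S x that stalk_gen(3)[OF x that] by (simp add: s'_def)
    ultimately show ?thesis by (simp add: hom_bundle_simps image_subset_iff)
  qed
  show ?thesis unfolding ext_class_def using p gs ps reg by blast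
qed

text \<open>The homomorphism that multiplies the coordinate at \<open>b\<close> with the vector
  \<open>e\<close>. Coordinates with respect to a basis vanish by convention outside its span, as
  required of elements of \<open>hom_bundle\<close>.\<close>

lemma coordinate_hom:
  assumes x: "x \<in> points k" and B: "finite B" "C.independent B" "stalk F2 x = lspan (scal F2) x B" "C.span B = gen F2"
    and e: "e \<in> gen F1"
  shows "(\<lambda>v. scal F1 (C.representation B v b) e) \<in> gen V"
    "e \<in> stalk F1 x \<Longrightarrow> (\<lambda>v. scal F1 (C.representation B v b) e) \<in> stalk V x"
    "v \<in> stalk F2 x \<Longrightarrow> C.representation B v b \<in> x"
proof -
  note g1 = rmoduleD[OF vector_bundle_gen_rmodule[OF bundles(1), of UNIV]]
  have rep: "C.representation B v b \<in> x" if v: "v \<in> stalk F2 x" for v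
  proof -
    obtain c where c: "v = (\<Sum>b\<in>B. scal F2 (c b) b)" "\<And>b. b \<in> B \<Longrightarrow> c b \<in> x"
      using lspanE[OF v[unfolded B(3)]] by blast
    have vB: "v \<in> C.span B" using stalk_gen(3)[OF x v] B(4) by simp
    have "(\<Sum>b'\<in>B. scal F2 (c b' - C.representation B v b') b') = v - v"
      using C.sum_representation_eq[OF B(2) vB B(1)] c(1)
      by (simp add: C.scale_left_diff_distrib sum_subtractf)
    then have "(\<Sum>b'\<in>B. scal F2 (c b' - C.representation B v b') b') = 0" by simp
    then have eq: "c b - C.representation B v b = 0" if "b \<in> B" by (rule C.independentD[OF B(2,1) order.refl _ that])
    show ?thesis
    proof (cases "b \<in> B")
      case True then show ?thesis using c(2)[OF True] eq[OF True] by simp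
    next
      case False
      then have "C.representation B v b = 0" using C.representation_ne_zero by blast
      then show ?thesis using closed_ringD(1)[OF points_closed_ring[OF x]] by simp
    qed
  qed
  then show "v \<in> stalk F2 x \<Longrightarrow> C.representation B v b \<in> x" .
  have lin: "gen_linear F2 F1 (\<lambda>v. scal F1 (C.representation B v b) e)"
    unfolding gen_linear_def using g1(3)[OF UNIV_I e]
    by (simp add: B(4)[symmetric] C.representation_add[OF B(2)] C.representation_scale[OF B(2)] A.scale_left_distrib)
  moreover have out: "\<forall>v. v \<notin> gen F2 \<longrightarrow> scal F1 (C.representation B v b) e = 0"
    by (simp add: B(4)[symmetric] C.representation_def)
  ultimately show "(\<lambda>v. scal F1 (C.representation B v b) e) \<in> gen V" by (simp add: hom_bundle_simps)
  show "(\<lambda>v. scal F1 (C.representation B v b) e) \<in> stalk V x" if "e \<in> stalk F1 x"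
    using lin out rep rmoduleD(3)[OF st1[OF x] _ that] by (simp add: hom_bundle_simps image_subset_iff)
qed

text \<open>The coordinate at a basis vector takes all values in the local ring, so the image in the fibre
  is the line of \<open>w\<close>.\<close>

lemma rank_one_coordinate:
  assumes x: "x \<in> points k" and B: "finite B" "C.independent B" "stalk F2 x = lspan (scal F2) x B" "C.span B = gen F2"
    and b: "b \<in> B" and w: "w \<in> stalk F1 x" "w \<notin> max_stalk F1 x"
  shows "fibre_rank_one F2 F1 x (\<lambda>v. scal F1 (C.representation B v b) w)"
  unfolding fibre_rank_one_def
proof (rule bexI[of _ "w +o max_stalk F1 x"])
  have dx: "dvr x" using x by (simp add: points_def)
  note cx = points_closed_ring[OF x]
  note ms = max_stalk_rmodule(1)[OF vector_bundle_vector_space[OF bundles(1)] st1[OF x] dx]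
  show "w +o max_stalk F1 x \<in> carrier (fibre F1 x) - {\<zero>\<^bsub>fibre F1 x\<^esub>}"
    unfolding fibre_def quot_simps using w A.coset_zero_iff[OF ms cx, of w] by simp
  have pp: "proj_point (ring_on x) (fibre F1 x) (w +o max_stalk F1 x) = (\<lambda>a. scal F1 a w +o max_stalk F1 x) ` x"
    unfolding proj_point_def fibre_def quot_simps ring_on_simps using A.coset_smult[OF ms] by auto
  have bs: "b \<in> stalk F2 x" unfolding B(3) using C.lspan_superset[OF cx B(1)] b by blast
  show "(\<lambda>v. scal F1 (C.representation B v b) w +o max_stalk F1 x) ` stalk F2 x =
    proj_point (ring_on x) (fibre F1 x) (w +o max_stalk F1 x)"
    unfolding pp
  proof
    show "(\<lambda>v. scal F1 (C.representation B v b) w +o max_stalk F1 x) ` stalk F2 x \<subseteq> (\<lambda>a. scal F1 a w +o max_stalk F1 x) ` x"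
      using coordinate_hom(3)[OF x B, of 0] rmoduleD(1)[OF vector_bundle_gen_rmodule[OF bundles(1)]] by blast
    show "(\<lambda>a. scal F1 a w +o max_stalk F1 x) ` x \<subseteq> (\<lambda>v. scal F1 (C.representation B v b) w +o max_stalk F1 x) ` stalk F2 x"
    proof
      fix A assume "A \<in> (\<lambda>a. scal F1 a w +o max_stalk F1 x) ` x"
      then obtain a where a: "a \<in> x" "A = scal F1 a w +o max_stalk F1 x" by blast
      have "C.representation B (scal F2 a b) b = a"
        using C.representation_scale[OF B(2) C.span_base[OF b]] C.representation_basis[OF B(2) b] by simp
      moreover have "scal F2 a b \<in> stalk F2 x" by (rule rmoduleD(3)[OF st2[OF x] a(1) bs])
      ultimately show "A \<in> (\<lambda>v. scal F1 (C.representation B v b) w +o max_stalk F1 x) ` stalk F2 x"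
        unfolding a(2) by (intro image_eqI[where x = "scal F2 a b"]) simp_all
    qed
  qed
qed

text \<open>At a point of \<open>D\<close> the polar part of \<open>\<sigma>\<close> is determined by its
  values \<open>e x b\<close> on a basis. It vanishes on the basis elements in \<open>G\<close>,
  and each of the other ones contributes at most a simple pole in a rank one direction.\<close>

lemma subbundle_gives_class_in_span:
  assumes D: "finite D" "\<forall>x\<in>D. rational_point k x"
    and \<sigma>: "gen_linear F2 W \<sigma>" "\<And>v. v \<in> gen F2 \<Longrightarrow> \<pi> (\<sigma> v) = v"
      "\<And>x u. x \<in> points k \<Longrightarrow> u \<in> stalk G x \<Longrightarrow> \<sigma> u \<in> stalk W x"
    and q: "quotient_sequence k G F2 F1 \<tau>" and sub: "prin_subsheaf k F1 \<tau>"
    and simple: "simple_poles_on k F1 D \<tau>" and len: "skyscraper_length F1 D \<tau> \<le> enat h"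
  shows "\<exists>T0. finite T0 \<and> card T0 \<le> h \<and> T0 \<subseteq> Delta_on F2 F1 D \<and>
    ext_class k F1 W F2 \<iota> \<pi> \<noteq> {} \<and>
    (\<forall>p\<in>ext_class k F1 W F2 \<iota> \<pi>. p +o rational_reps k V \<in> mod_span (ring_on k) (H1 k V) (\<Union>(psi k V ` T0)))"
proof -
  interpret HV: vector_space "scal V" by (rule regular_sheafD(1)[OF hom_regular])
  interpret F: vector_space "\<lambda>a r x. scal V a (r x)" by (rule vector_space_pointwise[OF regular_sheafD(1)[OF hom_regular]])
  have Dp: "x \<in> points k" if "x \<in> D" for x using D(2) that by (simp add: rational_point_def)
  obtain qq where qq0: "\<forall>x\<in>points k.
     (\<forall>v\<in>stalk F2 x. \<forall>w\<in>stalk F2 x. qq x (v + w) = qq x v \<oplus>\<^bsub>prin_stalk F1 x\<^esub> qq x w) \<and>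
     (\<forall>a\<in>x. \<forall>v\<in>stalk F2 x. qq x (scal F2 a v) = a \<odot>\<^bsub>prin_stalk F1 x\<^esub> qq x v) \<and>
     qq x ` stalk F2 x = \<tau> x \<and>
     {v\<in>stalk F2 x. qq x v = \<zero>\<^bsub>prin_stalk F1 x\<^esub>} = stalk G x"
    using q unfolding quotient_sequence_def by (elim exE)
  have qq: "x \<in> points k \<Longrightarrow> v \<in> stalk F2 x \<Longrightarrow> w \<in> stalk F2 x \<Longrightarrow>
      qq x (v + w) = qq x v \<oplus>\<^bsub>prin_stalk F1 x\<^esub> qq x w"
    "x \<in> points k \<Longrightarrow> a \<in> x \<Longrightarrow> v \<in> stalk F2 x \<Longrightarrow> qq x (scal F2 a v) = a \<odot>\<^bsub>prin_stalk F1 x\<^esub> qq x v"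
    "x \<in> points k \<Longrightarrow> qq x ` stalk F2 x = \<tau> x"
    "x \<in> points k \<Longrightarrow> {v\<in>stalk F2 x. qq x v = \<zero>\<^bsub>prin_stalk F1 x\<^esub>} = stalk G x" for x v w a
    using qq0 by simp_all
  have pm: "Module.module (ring_on x) (prin_stalk F1 x)" if x: "x \<in> points k" for x
    unfolding prin_stalk_def
    by (rule A.module_quot[OF points_closed_ring[OF x] vector_bundle_gen_rmodule[OF bundles(1)] st1[OF x]])
  have \<tau>c: "\<tau> x \<subseteq> carrier (prin_stalk F1 x)" if x: "x \<in> points k" for x
    using sub x Module.module.submoduleE(1)[OF pm[OF x]] unfolding prin_subsheaf_def by blast
  have Goff: "stalk G x = stalk F2 x" if x: "x \<in> points k" "x \<notin> D" for x
  proof -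
    have "stalk (twist F1 D) x = stalk F1 x" using x(2) by (simp add: twist_def)
    moreover have "\<tau> x \<subseteq> (\<lambda>v. v +o stalk F1 x) ` stalk (twist F1 D) x"
      using simple x(1) unfolding simple_poles_on_def by simp
    ultimately have t: "\<tau> x \<subseteq> (\<lambda>v. v +o stalk F1 x) ` stalk F1 x" by simp
    have "qq x u = \<zero>\<^bsub>prin_stalk F1 x\<^esub>" if u: "u \<in> stalk F2 x" for u
    proof -
      obtain v where v: "qq x u = v +o stalk F1 x" "v \<in> stalk F1 x" using t qq(3)[OF x(1)] u by blast
      then show ?thesis
        using A.coset_zero_iff[OF st1[OF x(1)] points_closed_ring[OF x(1)], of v] by (simp add: prin_stalk_def)
    qed
    then show ?thesis using qq(4)[OF x(1)] by auto
  qed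
  \<comment> \<open>sections of F2 vanishing at a point of D lie in G\<close>
  have Gmax: "scal F2 a u \<in> stalk G x" if x: "x \<in> D" and a: "a \<in> max_ideal x" and u: "u \<in> stalk F2 x" for x a u
  proof -
    note xp = Dp[OF x]
    have ax: "a \<in> x" using a max_ideal_subset by blast
    have "\<tau> x \<subseteq> (\<lambda>v. v +o stalk F1 x) ` stalk (twist F1 D) x" using simple xp unfolding simple_poles_on_def by simp
    then obtain v where v: "qq x u = v +o stalk F1 x" "v \<in> stalk (twist F1 D) x" using qq(3)[OF xp] u by blast
    have av: "scal F1 a v \<in> stalk F1 x" using v(2) a x by (simp add: twist_def)
    have "qq x (scal F2 a u) = scal F1 a v +o stalk F1 x"
      using qq(2)[OF xp ax u] A.coset_smult[OF st1[OF xp] ax, of v] by (simp add: v(1) prin_stalk_def)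
    then have "qq x (scal F2 a u) = \<zero>\<^bsub>prin_stalk F1 x\<^esub>"
      using av A.coset_zero_iff[OF st1[OF xp] points_closed_ring[OF xp]] by (simp add: prin_stalk_def)
    then show ?thesis unfolding qq(4)[OF xp, symmetric] using rmoduleD(3)[OF st2[OF xp] ax u] by blast
  qed
  have "\<exists>B. finite B \<and> C.independent B \<and> lspan (scal F2) x B = stalk F2 x \<and>
      enat (card (B - stalk G x)) \<le> mod_length (ring_on x) (prin_stalk F1 x) (\<tau> x)" if x: "x \<in> D" for x
  proof -
    note xp = Dp[OF x]
    have dx: "dvr x" using xp by (simp add: points_def)
    obtain B0 where B0: "finite B0" "C.independent B0" "stalk F2 x = lspan (scal F2) x B0"
      using vector_bundle_stalk_basis[OF bundles(3) xp] by blast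
    show ?thesis unfolding B0(3)
      by (rule C.basis_adapted_to_kernel[OF dx pm[OF xp] B0(1,2) qq(1)[OF xp, unfolded B0(3)] qq(2)[OF xp, unfolded B0(3)]
          qq(3)[OF xp, unfolded B0(3)] \<tau>c[OF xp] qq(4)[OF xp, unfolded B0(3)]])
  qed
  then obtain B where B0: "\<And>x. x \<in> D \<Longrightarrow> finite (B x) \<and> C.independent (B x) \<and> lspan (scal F2) x (B x) = stalk F2 x \<and>
      enat (card (B x - stalk G x)) \<le> mod_length (ring_on x) (prin_stalk F1 x) (\<tau> x)" by metis
  have Bb: "finite (B x)" "C.independent (B x)" "stalk F2 x = lspan (scal F2) x (B x)" "C.span (B x) = gen F2" if x: "x \<in> D" for x
  proof -
    show B: "finite (B x)" "C.independent (B x)" "stalk F2 x = lspan (scal F2) x (B x)" using B0[OF x] by simp_all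
    have "gen F2 = C.span (stalk F2 x)" using bundles(3) Dp[OF x] by (simp add: vector_bundle_def)
    then show "C.span (B x) = gen F2" using C.span_lspan[OF points_closed_ring[OF Dp[OF x]] B(1)] B(3) by simp
  qed
  have Bs: "b \<in> stalk F2 x" if "x \<in> D" "b \<in> B x" for x b
    unfolding Bb(3)[OF that(1)]
    by (rule subsetD[OF C.lspan_superset[OF points_closed_ring[OF Dp[OF that(1)]] Bb(1)[OF that(1)]] that(2)])
  have "\<exists>e. e \<in> gen F1 \<and> \<sigma> b - \<iota> e \<in> stalk W x" if x: "x \<in> D" and b: "b \<in> B x" for x b
  proof -
    note xp = Dp[OF x]
    have bs: "b \<in> stalk F2 x" by (rule Bs[OF x b])
    then have "b \<in> \<pi> ` stalk W x" using exact(3)[OF xp] by simp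
    then obtain w where w: "w \<in> stalk W x" "\<pi> w = b" by blast
    have bg: "b \<in> gen F2" by (rule stalk_gen(3)[OF xp bs])
    have wg: "w \<in> gen W" "\<sigma> b \<in> gen W" using stalk_gen(2)[OF xp w(1)] gen_linearD(1)[OF \<sigma>(1) bg] by simp_all
    have "\<pi> (\<sigma> b - w) = 0" using gen_linear_diff[OF bundles(2) maps(2) wg(2,1)] \<sigma>(2)[OF bg] w(2) by simp
    moreover have "\<sigma> b - w \<in> gen W"
      by (rule B.rmodule_uminus(2)[OF vector_bundle_gen_rmodule[OF bundles(2)] ground_ring wg(2,1)])
    ultimately obtain e where e: "e \<in> gen F1" "\<iota> e = \<sigma> b - w" using pi_kernel by blast
    then show ?thesis using w(1) by (intro exI[of _ e]) simp
  qed
  then obtain e where e: "\<And>x b. x \<in> D \<Longrightarrow> b \<in> B x \<Longrightarrow> e x b \<in> gen F1 \<and> \<sigma> b - \<iota> (e x b) \<in> stalk W x" by metis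
  define t where "t = (uniformizer :: 'k set \<Rightarrow> 'k)"
  have t: "t x \<in> x \<and> t x \<noteq> 0 \<and> max_ideal x = {t x * r | r. r \<in> x}" if "x \<in> points k" for x
    unfolding t_def by (rule uniformizer) (use that in \<open>simp add: points_def\<close>)
  \<comment> \<open>the poles are simple because \<open>t x\<close> times a basis element lies in \<open>G\<close>\<close>
  have te: "scal F1 (t x) (e x b) \<in> stalk F1 x" if x: "x \<in> D" and b: "b \<in> B x" for x b
  proof (rule iota_stalk_reflect[OF Dp[OF x]])
    note xp = Dp[OF x]
    have tm: "t x \<in> max_ideal x"
      unfolding t[OF xp, THEN conjunct2, THEN conjunct2] using closed_ringD(2)[OF points_closed_ring[OF xp]] by force
    show "scal F1 (t x) (e x b) \<in> gen F1"
      using e[OF x b] rmoduleD(3)[OF vector_bundle_gen_rmodule[OF bundles(1), of UNIV] UNIV_I] by blast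
    have "\<sigma> (scal F2 (t x) b) \<in> stalk W x" by (rule \<sigma>(3)[OF xp Gmax[OF x tm Bs[OF x b]]])
    then have 1: "scal W (t x) (\<sigma> b) \<in> stalk W x"
      using gen_linearD(3)[OF \<sigma>(1) stalk_gen(3)[OF xp Bs[OF x b]]] by simp
    have 2: "scal W (t x) (\<sigma> b - \<iota> (e x b)) \<in> stalk W x"
      using e[OF x b] t[OF xp, THEN conjunct1] rmoduleD(3)[OF stW[OF xp]] by blast
    have "scal W (t x) (\<sigma> b) - scal W (t x) (\<sigma> b - \<iota> (e x b)) \<in> stalk W x"
      by (rule B.rmodule_uminus(2)[OF stW[OF xp] points_closed_ring[OF xp] 1 2])
    then show "\<iota> (scal F1 (t x) (e x b)) \<in> stalk W x"
      using gen_linearD(3)[OF maps(1), of "e x b" "t x"] e[OF x b] by (simp add: B.scale_right_diff_distrib)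
  qed
  \<comment> \<open>a basis element with regular \<open>e x b\<close> would not give a map of rank one, and contributes nothing to the polar part\<close>
  define J where "J x = {b \<in> B x - stalk G x. e x b \<notin> stalk F1 x}" for x
  have Jf: "finite (J x)" "J x \<subseteq> B x" if "x \<in> D" for x using Bb(1)[OF that] by (auto simp: J_def)
  define I where "I = Sigma D J"
  have finI: "finite I" unfolding I_def using D(1) Jf by (intro finite_SigmaI)
  \<comment> \<open>the pole contributed by one basis element, and the corresponding point of the decomposable locus\<close>
  define ph where "ph i v = scal F1 (C.representation (B (fst i)) v (snd i)) (e (fst i) (snd i))" for i v
  define P where "P i = (fst i, proj_point (ring_on (fst i)) (fibre V (fst i)) (scal V (t (fst i)) (ph i) +o max_stalk V (fst i)))" for i
  define p where "p = (\<Sum>i\<in>I. pole_part (fst i) (ph i))"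
  have Ii: "fst i \<in> D" "snd i \<in> J (fst i)" "snd i \<in> B (fst i)" "fst i \<in> points k" if "i \<in> I" for i
  proof -
    show 1: "fst i \<in> D" "snd i \<in> J (fst i)" using that unfolding I_def by auto
    show "snd i \<in> B (fst i)" using Jf(2)[OF 1(1)] 1(2) by blast
    show "fst i \<in> points k" by (rule Dp[OF 1(1)])
  qed
  have phg: "ph i \<in> gen V" if i: "i \<in> I" for i
    unfolding ph_def using coordinate_hom(1)[OF Ii(4)[OF i] Bb[OF Ii(1)[OF i]]] e[OF Ii(1,3)[OF i]] by blast
  have tph: "scal V (t (fst i)) (ph i) = (\<lambda>v. scal F1 (C.representation (B (fst i)) v (snd i)) (scal F1 (t (fst i)) (e (fst i) (snd i))))" for i
    by (simp add: hom_bundle_simps ph_def mult.commute)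
  have tphs: "scal V (t (fst i)) (ph i) \<in> stalk V (fst i)" if i: "i \<in> I" for i
    unfolding tph using te[OF Ii(1,3)[OF i]] stalk_gen(1)[OF Ii(4)[OF i]]
    by (intro coordinate_hom(2)[OF Ii(4)[OF i] Bb[OF Ii(1)[OF i]]]) blast+
  have r1: "fibre_rank_one F2 F1 (fst i) (scal V (t (fst i)) (ph i))" if i: "i \<in> I" for i
    unfolding tph
  proof (rule rank_one_coordinate[OF Ii(4)[OF i] Bb[OF Ii(1)[OF i]] Ii(3)[OF i] te[OF Ii(1,3)[OF i]]])
    show "scal F1 (t (fst i)) (e (fst i) (snd i)) \<notin> max_stalk F1 (fst i)"
    proof
      note xp = Ii(4)[OF i]
      assume "scal F1 (t (fst i)) (e (fst i) (snd i)) \<in> max_stalk F1 (fst i)"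
      then obtain a v where a: "a \<in> max_ideal (fst i)" "v \<in> stalk F1 (fst i)"
        "scal F1 (t (fst i)) (e (fst i) (snd i)) = scal F1 a v" unfolding max_stalk_def by blast
      obtain r where r: "a = t (fst i) * r" "r \<in> fst i" using a(1) unfolding t[OF xp, THEN conjunct2, THEN conjunct2] by blast
      have "scal F1 (t (fst i)) (e (fst i) (snd i)) = scal F1 (t (fst i)) (scal F1 r v)" using a(3) r(1) by simp
      then have "e (fst i) (snd i) = scal F1 r v" using A.scale_left_imp_eq[OF t[OF xp, THEN conjunct2, THEN conjunct1]] by blast
      then have "e (fst i) (snd i) \<in> stalk F1 (fst i)" using rmoduleD(3)[OF st1[OF xp] r(2) a(2)] by simp
      then show False using Ii(2)[OF i] by (simp add: J_def)
    qed
  qed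
  have PD: "P i \<in> Delta_on F2 F1 D" if i: "i \<in> I" for i
    unfolding Delta_on_def P_def using Ii(1)[OF i] tphs[OF i] r1[OF i] by blast
  have psiP: "pole_part (fst i) (ph i) +o rational_reps k V \<in> psi k V (P i)" if i: "i \<in> I" for i
  proof -
    note xp = Ii(4)[OF i]
    note tx = t[OF xp]
    have "pole_vectors V (P i) = {scal V (c / t (fst i)) (scal V (t (fst i)) (ph i)) + w | c w. c \<in> k \<and> w \<in> stalk V (fst i)}"
      unfolding P_def by (rule pole_vectors_line[OF regular_sheafD(1)[OF hom_regular] regular_sheafD(3)[OF hom_regular xp] D(2)[rule_format, OF Ii(1)[OF i]] ground_ring
        tx[THEN conjunct1] tx[THEN conjunct2, THEN conjunct1] tx[THEN conjunct2, THEN conjunct2] tphs[OF i]])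
    moreover have "ph i = scal V (1 / t (fst i)) (scal V (t (fst i)) (ph i)) + 0"
      using tx by simp
    moreover have "0 \<in> stalk V (fst i)" by (rule rmoduleD(1)[OF regular_sheafD(3)[OF hom_regular xp]])
    ultimately have "ph i \<in> pole_vectors V (P i)" using closed_ringD(2)[OF ground_ring] by blast
    then show ?thesis unfolding psi_eq P_def fst_conv by (rule imageI)
  qed
  have pp: "p \<in> prin_reps k V" unfolding p_def
    using phg Ii(4) by (intro rmodule_sum[OF prin_reps_rmodule[OF hom_regular ground_ring]] pole_part_prin_reps[OF hom_regular])
  have pxu: "p x u = (\<Sum>b\<in>J x. scal F1 (C.representation (B x) u b) (e x b))" if x: "x \<in> D" for x u
  proof -
    have fib: "{i\<in>I. fst i = x} = Pair x ` J x" using x by (auto simp: I_def)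
    have "p x = (\<Sum>i\<in>Pair x ` J x. ph i)" unfolding p_def sum_pole_parts_apply[OF finI] fib by (rule refl)
    then have "p x u = (\<Sum>i\<in>Pair x ` J x. ph i u)" by (simp only: sum_fun_apply)
    also have "\<dots> = (\<Sum>b\<in>J x. ph (x, b) u)" by (subst sum.reindex) (auto simp: inj_on_def)
    finally show ?thesis by (simp add: ph_def)
  qed
  have "splits_with_poles \<sigma> p"
    unfolding splits_with_poles_def
  proof (intro conjI ballI \<sigma>(1))
    show "\<pi> (\<sigma> v) = v" if "v \<in> gen F2" for v by (rule \<sigma>(2)[OF that])
    show "\<sigma> u - \<iota> (p x u) \<in> stalk W x" if xp: "x \<in> points k" and u: "u \<in> stalk F2 x" for x u
    proof (cases "x \<in> D")
      case False
      then have "{i\<in>I. fst i = x} = {}" by (auto simp: I_def)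
      then have "p x = 0" unfolding p_def sum_pole_parts_apply[OF finI] by (simp only: sum.empty)
      then have "\<sigma> u - \<iota> (p x u) = \<sigma> u" using gen_linear_zero[OF bundles(1,2) maps(1)] by simp
      then show ?thesis using \<sigma>(3)[OF xp] Goff[OF xp False] u by simp
    next
      case True
      note x = True
      have uB: "u \<in> C.span (B x)" using stalk_gen(3)[OF xp u] Bb(4)[OF x] by simp
      define r where "r b = C.representation (B x) u b" for b
      have rx: "r b \<in> x" for b
        unfolding r_def by (rule coordinate_hom(3)[OF xp Bb[OF x] rmoduleD(1)[OF vector_bundle_gen_rmodule[OF bundles(1), of UNIV]] u])
      have ueq: "(\<Sum>b\<in>B x. scal F2 (r b) b) = u"
        unfolding r_def by (rule C.sum_representation_eq[OF Bb(2)[OF x] uB Bb(1)[OF x] order.refl])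
      have su: "\<sigma> u = (\<Sum>b\<in>B x. scal W (r b) (\<sigma> b))"
        unfolding ueq[symmetric] by (rule gen_linear_sum[OF bundles(3,2) \<sigma>(1)]) (rule stalk_gen(3)[OF xp Bs[OF x]])
      have ip: "\<iota> (p x u) = (\<Sum>b\<in>J x. scal W (r b) (\<iota> (e x b)))"
        unfolding pxu[OF x] r_def by (rule gen_linear_sum[OF bundles(1,2) maps(1)]) (use e[OF x] Jf(2)[OF x] in blast)
      have "\<sigma> u = (\<Sum>b\<in>B x - J x. scal W (r b) (\<sigma> b)) + (\<Sum>b\<in>J x. scal W (r b) (\<sigma> b))"
        unfolding su by (rule sum.subset_diff[OF Jf(2)[OF x] Bb(1)[OF x]])
      then have eq: "\<sigma> u - \<iota> (p x u) = (\<Sum>b\<in>B x - J x. scal W (r b) (\<sigma> b)) + (\<Sum>b\<in>J x. scal W (r b) (\<sigma> b - \<iota> (e x b)))"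
        unfolding ip by (simp add: B.scale_right_diff_distrib sum_subtractf)
      have sb: "\<sigma> b \<in> stalk W x" if b: "b \<in> B x - J x" for b
      proof (cases "b \<in> stalk G x")
        case True
        then show ?thesis by (rule \<sigma>(3)[OF xp])
      next
        case False
        then have "e x b \<in> stalk F1 x" using b by (simp add: J_def)
        then have "\<iota> (e x b) \<in> stalk W x" by (rule maps(3)[OF xp])
        moreover have "\<sigma> b - \<iota> (e x b) \<in> stalk W x" using e[OF x] b by blast
        ultimately have "(\<sigma> b - \<iota> (e x b)) + \<iota> (e x b) \<in> stalk W x" by (intro rmoduleD(2)[OF stW[OF xp]])
        then show ?thesis by simp
      qed
      have je: "\<sigma> b - \<iota> (e x b) \<in> stalk W x" if b: "b \<in> J x" for b
        using e[OF x subsetD[OF Jf(2)[OF x] b]] by blast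
      show ?thesis unfolding eq
        by (intro rmoduleD(2)[OF stW[OF xp]] rmodule_sum[OF stW[OF xp]] rmoduleD(3)[OF stW[OF xp]] rx sb je)
    qed
  qed
  then have pe: "p \<in> ext_class k F1 W F2 \<iota> \<pi>" by (rule ext_class_memI[OF _ pp])
  have pspan: "p +o rational_reps k V \<in> mod_span (ring_on k) (H1 k V) (\<Union>(psi k V ` P ` I))"
    unfolding p_def using psiP by (intro sum_pole_parts_in_span[OF hom_regular ground_ring]) blast
  have same: "p' +o rational_reps k V = p +o rational_reps k V" if "p' \<in> ext_class k F1 W F2 \<iota> \<pi>" for p'
  proof -
    have "p' \<in> p +o rational_reps k V" using ext_class_coset[OF pe] that by blast
    then have "p' - p \<in> rational_reps k V" by (auto simp: elt_set_plus_def)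
    then show ?thesis using F.coset_eq_iff[OF rational_reps_rmodule[OF hom_regular ground_ring] ground_ring] by blast
  qed
  have cardP: "card (P ` I) \<le> h"
  proof -
    have "card (P ` I) \<le> card I" by (rule card_image_le[OF finI])
    also have "\<dots> = (\<Sum>x\<in>D. card (J x))" unfolding I_def using Jf by (simp add: card_SigmaI[OF D(1)])
    finally have "enat (card (P ` I)) \<le> enat (\<Sum>x\<in>D. card (J x))" by simp
    also have "\<dots> = (\<Sum>x\<in>D. enat (card (J x)))" by (rule sum_enat[symmetric])
    also have "\<dots> \<le> skyscraper_length F1 D \<tau>"
      unfolding skyscraper_length_def
    proof (rule sum_mono)
      fix x assume x: "x \<in> D"
      have "card (J x) \<le> card (B x - stalk G x)" using Bb(1)[OF x] by (intro card_mono) (auto simp: J_def)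
      then have "enat (card (J x)) \<le> enat (card (B x - stalk G x))" by simp
      also have "\<dots> \<le> mod_length (ring_on x) (prin_stalk F1 x) (\<tau> x)" using B0[OF x] by blast
      finally show "enat (card (J x)) \<le> mod_length (ring_on x) (prin_stalk F1 x) (\<tau> x)" .
    qed
    also have "\<dots> \<le> enat h" by (rule len)
    finally show ?thesis by simp
  qed
  show ?thesis
  proof (intro exI[of _ "P ` I"] conjI ballI)
    show "finite (P ` I)" using finI by (rule finite_imageI)
    show "card (P ` I) \<le> h" by (rule cardP)
    show "P ` I \<subseteq> Delta_on F2 F1 D" using PD by blast
    show "ext_class k F1 W F2 \<iota> \<pi> \<noteq> {}" using pe by blast
    show "p' +o rational_reps k V \<in> mod_span (ring_on k) (H1 k V) (\<Union>(psi k V ` P ` I))"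
      if "p' \<in> ext_class k F1 W F2 \<iota> \<pi>" for p' unfolding same[OF that] by (rule pspan)
  qed
qed

end

text \<open>The composite \<open>\<pi> \<sigma>\<close> is the identity and \<open>\<pi>\<close> has values
  in \<open>gen F2\<close>, so \<open>gen G\<close> is a subspace of \<open>gen F2\<close>, of the
  same dimension.\<close>

lemma lift_generic_splitting:
  assumes F2: "vector_bundle k F2" and \<pi>: "gen_linear W F2 \<pi>"
    and el: "elementary_transformation k F2 G" and lift: "lifts_to_subbundle k W \<pi> G"
  shows "gen G = gen F2" "\<exists>\<sigma>. gen_linear F2 W \<sigma> \<and> (\<forall>v\<in>gen F2. \<pi> (\<sigma> v) = v) \<and>
    (\<forall>x\<in>points k. \<forall>u\<in>stalk G x. \<sigma> u \<in> stalk W x)"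
proof -
  interpret C: vector_space "scal F2" by (rule vector_bundle_vector_space[OF F2])
  have G: "vector_bundle k G" "scal G = scal F2" "rank G = rank F2"
    using el by (simp_all add: elementary_transformation_def)
  obtain \<sigma> where \<sigma>: "bundle_map k G W \<sigma>" "\<forall>v\<in>gen G. \<pi> (\<sigma> v) = v"
    using lift unfolding lifts_to_subbundle_def by blast
  have \<sigma>l: "gen_linear G W \<sigma>" using \<sigma>(1) by (simp add: bundle_map_def)
  have sub: "gen G \<subseteq> gen F2"
  proof
    fix v assume v: "v \<in> gen G"
    have "\<pi> (\<sigma> v) \<in> gen F2" by (rule gen_linearD(1)[OF \<pi> gen_linearD(1)[OF \<sigma>l v]])
    then show "v \<in> gen F2" using \<sigma>(2) v by simp
  qed
  obtain S0 where S0: "finite S0" "gen F2 = C.span S0" using vector_bundle_generic_basis[OF F2] by blast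
  have "C.subspace (gen G)" using vector_bundle_gen_subspace[OF G(1)] unfolding G(2) .
  then show eq: "gen G = gen F2"
    using C.subspace_eq_if_dim_eq[of "gen G" S0] sub S0 G(2,3) by (simp add: rank_def)
  show "\<exists>\<sigma>. gen_linear F2 W \<sigma> \<and> (\<forall>v\<in>gen F2. \<pi> (\<sigma> v) = v) \<and> (\<forall>x\<in>points k. \<forall>u\<in>stalk G x. \<sigma> u \<in> stalk W x)"
    using \<sigma>l \<sigma> G(2) unfolding eq
    by (intro exI[of _ \<sigma>]) (simp add: gen_linear_def eq bundle_map_def image_subset_iff)
qed

section \<open>The criterion\<close>

theorem theorem4p6:
  fixes k :: "'k::field set"
    and D :: "'k set set"
    and h :: nat
    and F1 :: "('k, 'a::ab_group_add) vbundle"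
    and W :: "('k, 'w::ab_group_add) vbundle"
    and F2 :: "('k, 'b::ab_group_add) vbundle"
    and \<iota> :: "'a \<Rightarrow> 'w" and \<pi> :: "'w \<Rightarrow> 'b"
  assumes "curve k"
    and "finite D" and "\<forall>x\<in>D. rational_point k x"
    and "h \<ge> 1"
    and "extension k F1 W F2 \<iota> \<pi>" and "\<not> split_extension k W F2 \<pi>"
  shows "(\<exists>T. T \<subseteq> Delta_on F2 F1 D \<and> finite T \<and> card T \<le> h \<and>
            (\<forall>P\<in>T. psi_defined k (hom_bundle F2 F1) P) \<and>
            inj_on (psi k (hom_bundle F2 F1)) T \<and>
            independent_points (ring_on k) (H1 k (hom_bundle F2 F1)) (psi k (hom_bundle F2 F1) ` T) \<and>
            proj_point (ring_on k) (H1 k (hom_bundle F2 F1)) (ext_class k F1 W F2 \<iota> \<pi>)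
              \<subseteq> mod_span (ring_on k) (H1 k (hom_bundle F2 F1)) (\<Union>(psi k (hom_bundle F2 F1) ` T)))
     \<longleftrightarrow> (\<exists>G \<tau>. elementary_transformation k F2 G \<and> lifts_to_subbundle k W \<pi> G \<and>
            quotient_sequence k G F2 F1 \<tau> \<and> prin_subsheaf k F1 \<tau> \<and>
            simple_poles_on k F1 D \<tau> \<and> skyscraper_length F1 D \<tau> \<le> enat h)"
    (is "?L \<longleftrightarrow> ?R")
proof -
  have vb: "vector_bundle k F1" "vector_bundle k W" "vector_bundle k F2" and \<pi>: "gen_linear W F2 \<pi>"
    using assms(5) by (simp_all add: extension_def bundle_map_def)
  let ?V = "hom_bundle F2 F1"
  have hom_regular: "regular_sheaf k ?V" by (rule hom_bundle_regular_sheaf[OF assms(1) vb(3,1)])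
  interpret F: vector_space "\<lambda>a r x. scal ?V a (r x)" by (rule vector_space_pointwise[OF regular_sheafD(1)[OF hom_regular]])
  interpret HV: vector_space "scal ?V" by (rule regular_sheafD(1)[OF hom_regular])
  have ground_ring: "closed_ring k" by (rule subfield_closed_ring(1)) (use assms(1) in \<open>simp add: curve_def\<close>)
  note N = rational_reps_rmodule[OF hom_regular ground_ring]
  have split: "split_extension k W F2 \<pi>" if "points k = {}" "gen_linear F2 W \<sigma>" "\<forall>v\<in>gen F2. \<pi> (\<sigma> v) = v" for \<sigma>
    unfolding split_extension_def bundle_map_def using that by (intro exI[of _ \<sigma>]) simp
  show ?thesis
  proof
    assume ?L
    then obtain T where T: "T \<subseteq> Delta_on F2 F1 D" "finite T" "card T \<le> h"
      "proj_point (ring_on k) (H1 k ?V) (ext_class k F1 W F2 \<iota> \<pi>) \<subseteq> mod_span (ring_on k) (H1 k ?V) (\<Union>(psi k ?V ` T))" by blast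
    \<comment> \<open>without points the first cohomology vanishes and every rational splitting is a splitting\<close>
    have ne: "points k \<noteq> {}"
    proof
      assume e: "points k = {}"
      have "D = {}" using assms(3) e by (auto simp: rational_point_def)
      then have "T = {}" using T(1) by (auto simp: Delta_on_def)
      define E where "E = ext_class k F1 W F2 \<iota> \<pi>"
      have "submodule ((\<lambda>v. v +o rational_reps k ?V) ` {0}) (ring_on k) (H1 k ?V)"
        unfolding H1_def
        by (rule F.submodule_quotI[OF ground_ring prin_reps_rmodule[OF hom_regular ground_ring] N])
          (use rmoduleD(1)[OF prin_reps_rmodule[OF hom_regular ground_ring]] in \<open>auto simp: rmodule_def fun_eq_iff\<close>)
      then have "mod_span (ring_on k) (H1 k ?V) {} \<subseteq> {rational_reps k ?V}"
        using mod_span_memD[of _ "ring_on k" "H1 k ?V" "{}"] by auto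
      moreover have "1 \<odot>\<^bsub>H1 k ?V\<^esub> E \<in> proj_point (ring_on k) (H1 k ?V) E"
        unfolding proj_point_def ring_on_simps using closed_ringD(2)[OF ground_ring] by blast
      ultimately have "1 \<odot>\<^bsub>H1 k ?V\<^esub> E = rational_reps k ?V" using T(4) unfolding E_def \<open>T = {}\<close> by auto
      then have "E + rational_reps k ?V = rational_reps k ?V" by (simp add: H1_def)
      then have "E \<noteq> {}" using rmoduleD(1)[OF N] by (auto simp: set_plus_def)
      then obtain s where s: "s \<in> gen (hom_bundle F2 W)" "\<forall>v\<in>gen F2. \<pi> (s v) = v"
        unfolding E_def ext_class_def by blast
      have "split_extension k W F2 \<pi>" by (rule split[OF e _ s(2)]) (use s(1) in \<open>simp add: hom_bundle_simps\<close>)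
      then show False using assms(6) by blast
    qed
    interpret curve_extension k F1 W F2 \<iota> \<pi> by unfold_locales (use assms ne in auto)
    show ?R by (rule class_in_span_gives_subbundle[OF assms(2,3) T])
  next
    assume ?R
    then obtain G \<tau> where G: "elementary_transformation k F2 G" "lifts_to_subbundle k W \<pi> G"
            "quotient_sequence k G F2 F1 \<tau>" "prin_subsheaf k F1 \<tau>"
            "simple_poles_on k F1 D \<tau>" "skyscraper_length F1 D \<tau> \<le> enat h" by blast
    obtain \<sigma> where \<sigma>: "gen_linear F2 W \<sigma>" "\<forall>v\<in>gen F2. \<pi> (\<sigma> v) = v"
      "\<forall>x\<in>points k. \<forall>u\<in>stalk G x. \<sigma> u \<in> stalk W x"
      using lift_generic_splitting(2)[OF vb(3) \<pi> G(1,2)] by blast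
    have ne: "points k \<noteq> {}" using split[OF _ \<sigma>(1,2)] assms(6) by blast
    interpret curve_extension k F1 W F2 \<iota> \<pi> by unfold_locales (use assms ne in auto)
    let ?E = "ext_class k F1 W F2 \<iota> \<pi>" and ?M = "mod_span (ring_on k) (H1 k ?V)"
    obtain T0 where T0: "finite T0" "card T0 \<le> h" "T0 \<subseteq> Delta_on F2 F1 D" "?E \<noteq> {}"
      "\<forall>p\<in>?E. p +o rational_reps k ?V \<in> ?M (\<Union>(psi k ?V ` T0))"
      using subbundle_gives_class_in_span[OF assms(2,3) \<sigma>(1) _ _ G(3-6)] \<sigma>(2,3) by blast
    then obtain p where p: "p \<in> ?E" by blast
    obtain T where T: "T \<subseteq> T0" "p +o rational_reps k ?V \<in> ?M (\<Union>(psi k ?V ` T))"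
      "inj_on (psi k ?V) T" "independent_points (ring_on k) (H1 k ?V) (psi k ?V ` T)"
      using independent_subfamily_exists[OF T0(1) T0(5)[rule_format, OF p]] by blast
    have "psi_defined k ?V P" if P: "P \<in> T" for P
    proof -
      have "rational_reps k ?V \<in> ?M S" for S by (rule mod_span_memI) (rule H1_closed(1)[OF hom_regular ground_ring])
      moreover have "\<not> psi k ?V P \<subseteq> ?M (\<Union>(psi k ?V ` T - {psi k ?V P}))"
        using T(4) P unfolding independent_points_def by blast
      ultimately show ?thesis by (auto simp: psi_defined_def H1_def)
    qed
    moreover have "proj_point (ring_on k) (H1 k ?V) ?E \<subseteq> ?M (\<Union>(psi k ?V ` T))"
    proof (intro subsetI mod_span_memI)
      fix A H assume A: "A \<in> proj_point (ring_on k) (H1 k ?V) ?E"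
        and H: "submodule H (ring_on k) (H1 k ?V)" "\<Union>(psi k ?V ` T) \<subseteq> H"
      obtain a where a: "A = a \<odot>\<^bsub>H1 k ?V\<^esub> ?E" "a \<in> k" using A unfolding proj_point_def by auto
      have pH: "p +o rational_reps k ?V \<in> H" by (rule mod_span_memD[OF T(2) H])
      have "a \<odot>\<^bsub>H1 k ?V\<^esub> ?E = a \<odot>\<^bsub>H1 k ?V\<^esub> (p +o rational_reps k ?V)"
      proof
        have Eeq: "(\<lambda>r x. scal ?V a (r x)) ` ?E + rational_reps k ?V \<subseteq> (\<lambda>r x. scal ?V a (r x)) ` (p +o rational_reps k ?V) + rational_reps k ?V"
          by (intro set_plus_mono2 image_mono ext_class_coset[OF p] order.refl)
        then show "a \<odot>\<^bsub>H1 k ?V\<^esub> ?E \<subseteq> a \<odot>\<^bsub>H1 k ?V\<^esub> (p +o rational_reps k ?V)" by (simp add: H1_def)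
        have "(\<lambda>r x. scal ?V a (r x)) ` (p +o rational_reps k ?V) + rational_reps k ?V = (\<lambda>x. scal ?V a (p x)) +o rational_reps k ?V"
          by (rule F.coset_smult[OF N a(2)])
        also have "\<dots> \<subseteq> (\<lambda>r x. scal ?V a (r x)) ` ?E + rational_reps k ?V"
          using p unfolding elt_set_plus_def set_plus_def by blast
        finally show "a \<odot>\<^bsub>H1 k ?V\<^esub> (p +o rational_reps k ?V) \<subseteq> a \<odot>\<^bsub>H1 k ?V\<^esub> ?E" by (simp add: H1_def)
      qed
      then show "A \<in> H" using submodule_closed(3)[OF H(1) _ pH, of a] a by simp
    qed
    moreover have "card T \<le> h" using card_mono[OF T0(1) T(1)] T0(2) by simp
    moreover have "finite T" using T(1) T0(1) by (rule finite_subset)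
    moreover have "T \<subseteq> Delta_on F2 F1 D" using T(1) T0(3) by blast
    ultimately show ?L using T(3,4) by blast
  qed
qed

end
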